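(* For the Dynkin diagram of type $C_n$, there is an isomorphism $\mathcal{M}_{C_n}\cong\mathring Z_n/(\mathbb{Z}/2\mathbb{Z})$, where $\mathring Z_n$ is the space of matrices $$\begin{bmatrix}1&1&\cdots&1&1\\ z_1&z_2&\cdots&z_n&1\end{bmatrix},\qquad(z_1,\dots,z_n)\in\mathbb{C}^n,$$ for which the linear forms $z_i-z_j$ and $z_i+z_j$ ($1\le i<j\le n$), $1-z_i$, $1+z_i$, $z_i$ ($1\le i\le n$) are all non-vanishing, and the non-trivial element of $\mathbb{Z}/2\mathbb{Z}$ acts (freely) by $(z_1,\dots,z_n)\mapsto(1/z_1,\dots,1/z_n)$.
   Context: Let $P_{2n+2}$ be the convex $(2n+2)$-gon with vertices cyclically labeled $1,2,\dots,n+1,\bar1,\bar2,\dots,\overline{n+1}$. Let $\Pi$ be the set consisting of the long diagonals $[i,\bar i]=(i,\bar i)$ for $1\le i\le n+1$, and the pairs of centrally symmetric (non-long) diagonals $[i,j]=\{(i,j),(\bar i,\bar j)\}$ for $1\le i<j-1<n+1$ and $[i,\bar j]=\{(i,\bar j),(j,\bar i)\}$ for $1\le i<j\le n+1$, $(i,j)\ne(1,n+1)$ (sides of the polygon excluded; $|\Pi|=n^2+n$). $\Pi$ indexes the mutable cluster variables of a cluster algebra of type $C_n$. The type $C_n$ compatibility degree $(\gamma\|\omega)$ is the number of crossings (in the interior of the polygon) of one of the diagonals representing $\omega$ with the diagonals representing $\gamma$; for example $([1,\bar1]\|[2,\bar3])=1$ and $([2,\bar3]\|[1,\bar1])=2$.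 The cluster configuration space is $\mathcal{M}_{C_n}=\operatorname{Spec}\big(\mathbb{C}[u_\gamma^{\pm1}\mid\gamma\in\Pi]/I\big)$, where $I$ is generated by the elements $u_\gamma+\prod_{\omega\in\Pi}u_\omega^{(\omega\|\gamma)}-1$ for $\gamma\in\Pi$. *)

theory Defs
  imports
    "HOL-Library.Poly_Mapping"
    "HOL-Algebra.QuotRing"
    "HOL-Algebra.Group_Action"
    "HOL-Algebra.Elementary_Groups"
    "HOL-Analysis.Abstract_Topology"
    "Jordan_Normal_Form.Matrix"
begin

section \<open>Commutative algebras over the complex numbers\<close>

text \<open>A \<open>\<complex>\<close>-algebra is a ring together with its structure map from \<open>\<complex>\<close>.\<close>

record 'a complex_algebra = "'a ring" +
  const :: "complex \<Rightarrow> 'a"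

definition complex_algebra_iso ::
    "('a, 'c) complex_algebra_scheme \<Rightarrow> ('b, 'd) complex_algebra_scheme \<Rightarrow> ('a \<Rightarrow> 'b) set" where
  "complex_algebra_iso A B = {h \<in> ring_iso A B. \<forall>c. h (const A c) = const B c}"

definition quotient_algebra ::
    "('a, 'c) complex_algebra_scheme \<Rightarrow> 'a set \<Rightarrow> 'a set complex_algebra" where
  "quotient_algebra A I =
     ring.extend (A Quot I) (complex_algebra.fields (\<lambda>c. I +>\<^bsub>A\<^esub> const A c))"

section \<open>The spectrum as a ringed space over the complex numbers\<close>

record ('p, 's) ringed_space =
  space_top :: "'p topology"
  sheaf :: "'p set \<Rightarrow> 's complex_algebra"
  restr :: "'p set \<Rightarrow> 'p set \<Rightarrow> 's \<Rightarrow> 's"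

text \<open>
  Isomorphism of ringed spaces over \<open>\<complex>\<close>: a homeomorphism \<open>f\<close> together with an isomorphism of
  sheaves of \<open>\<complex>\<close>-algebras from the structure sheaf of \<open>Y\<close> to the direct image under \<open>f\<close> of that
  of \<open>X\<close>.  For locally ringed spaces this is the same as an isomorphism of locally ringed spaces,
  because an isomorphism of local rings is automatically a local homomorphism.
\<close>

definition ringed_space_isomorphic ::
    "('p, 's) ringed_space \<Rightarrow> ('q, 't) ringed_space \<Rightarrow> bool" where
  "ringed_space_isomorphic X Y \<longleftrightarrow>
    (\<exists>f \<phi>. homeomorphic_map (space_top X) (space_top Y) f \<and>
      (\<forall>V. openin (space_top Y) V \<longrightarrow>
         \<phi> V \<in> complex_algebra_iso (sheaf Y V) (sheaf X (f -` V \<inter> topspace (space_top X)))) \<and>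
      (\<forall>V W. openin (space_top Y) V \<longrightarrow> openin (space_top Y) W \<longrightarrow> W \<subseteq> V \<longrightarrow>
         (\<forall>s \<in> carrier (sheaf Y V).
            restr X (f -` V \<inter> topspace (space_top X)) (f -` W \<inter> topspace (space_top X)) (\<phi> V s) =
            \<phi> W (restr Y V W s))))"

definition prime_spectrum :: "('a, 'c) ring_scheme \<Rightarrow> 'a set set" where
  "prime_spectrum R = {P. primeideal P R}"

definition zariski_topology :: "('a, 'c) ring_scheme \<Rightarrow> 'a set topology" where
  "zariski_topology R =
     topology (\<lambda>U. \<exists>E \<subseteq> carrier R. U = {P \<in> prime_spectrum R. \<not> E \<subseteq> P})"

text \<open>
  The element \<open>a / s\<close> of the localization of \<open>R\<close> at the prime \<open>P\<close>, as an equivalence class of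
  numerator-denominator pairs; \<open>local_mult\<close> and \<open>local_add\<close> are the operations of that
  localization on such classes.
\<close>

definition fraction_at :: "('a, 'c) ring_scheme \<Rightarrow> 'a set \<Rightarrow> 'a \<Rightarrow> 'a \<Rightarrow> ('a \<times> 'a) set" where
  "fraction_at R P a s =
     {(b, t). b \<in> carrier R \<and> t \<in> carrier R - P \<and>
        (\<exists>w \<in> carrier R - P. w \<otimes>\<^bsub>R\<^esub> (t \<otimes>\<^bsub>R\<^esub> a) = w \<otimes>\<^bsub>R\<^esub> (s \<otimes>\<^bsub>R\<^esub> b))}"

definition local_mult ::
    "('a, 'c) ring_scheme \<Rightarrow> 'a set \<Rightarrow> ('a \<times> 'a) set \<Rightarrow> ('a \<times> 'a) set \<Rightarrow> ('a \<times> 'a) set" where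
  "local_mult R P x y =
     (\<Union>(a, s) \<in> x. \<Union>(b, t) \<in> y. fraction_at R P (a \<otimes>\<^bsub>R\<^esub> b) (s \<otimes>\<^bsub>R\<^esub> t))"

definition local_add ::
    "('a, 'c) ring_scheme \<Rightarrow> 'a set \<Rightarrow> ('a \<times> 'a) set \<Rightarrow> ('a \<times> 'a) set \<Rightarrow> ('a \<times> 'a) set" where
  "local_add R P x y =
     (\<Union>(a, s) \<in> x. \<Union>(b, t) \<in> y.
        fraction_at R P (t \<otimes>\<^bsub>R\<^esub> a \<oplus>\<^bsub>R\<^esub> s \<otimes>\<^bsub>R\<^esub> b) (s \<otimes>\<^bsub>R\<^esub> t))"

text \<open>
  A section over \<open>U\<close> assigns to each \<open>P\<close> in \<open>U\<close> an element of the localization at \<open>P\<close> and is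
  locally given by a single fraction.
\<close>

definition spec_sections ::
    "('a, 'c) complex_algebra_scheme \<Rightarrow> 'a set set \<Rightarrow> ('a set \<Rightarrow> ('a \<times> 'a) set) complex_algebra" where
  "spec_sections A U =
    \<lparr>carrier = {s \<in> extensional U. \<forall>P \<in> U. \<exists>V a g.
        openin (zariski_topology A) V \<and> P \<in> V \<and> V \<subseteq> U \<and> a \<in> carrier A \<and> g \<in> carrier A \<and>
        (\<forall>Q \<in> V. g \<notin> Q \<and> s Q = fraction_at A Q a g)},
     monoid.mult = (\<lambda>s t. \<lambda>P\<in>U. local_mult A P (s P) (t P)),
     one = (\<lambda>P\<in>U. fraction_at A P \<one>\<^bsub>A\<^esub> \<one>\<^bsub>A\<^esub>),
     zero = (\<lambda>P\<in>U. fraction_at A P \<zero>\<^bsub>A\<^esub> \<one>\<^bsub>A\<^esub>),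
     add = (\<lambda>s t. \<lambda>P\<in>U. local_add A P (s P) (t P)),
     const = (\<lambda>c. \<lambda>P\<in>U. fraction_at A P (const A c) \<one>\<^bsub>A\<^esub>)\<rparr>"

definition Spec ::
    "('a, 'c) complex_algebra_scheme \<Rightarrow> ('a set, 'a set \<Rightarrow> ('a \<times> 'a) set) ringed_space" where
  "Spec A = \<lparr>space_top = zariski_topology A, sheaf = spec_sections A, restr = (\<lambda>U V s. restrict s V)\<rparr>"

section \<open>Diagonals of the polygon and the compatibility degree of type C\<close>

text \<open>
  The vertices \<open>1, \<dots>, n+1\<close>, followed by their barred copies, are numbered cyclically by
  \<open>1, \<dots>, 2n+2\<close>.  A diagonal is the set of its two endpoints, and an element of \<open>\<Pi>\<close> is the set of
  diagonals representing it.
\<close>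

definition bar :: "nat \<Rightarrow> nat \<Rightarrow> nat" where
  "bar n i = n + 1 + i"

definition long_diag :: "nat \<Rightarrow> nat \<Rightarrow> nat set set" where
  "long_diag n i = {{i, bar n i}}"

definition unbarred_pair :: "nat \<Rightarrow> nat \<Rightarrow> nat \<Rightarrow> nat set set" where
  "unbarred_pair n i j = {{i, j}, {bar n i, bar n j}}"

definition barred_pair :: "nat \<Rightarrow> nat \<Rightarrow> nat \<Rightarrow> nat set set" where
  "barred_pair n i j = {{i, bar n j}, {j, bar n i}}"

definition Pi_C :: "nat \<Rightarrow> nat set set set" where
  "Pi_C n =
     {long_diag n i | i. 1 \<le> i \<and> i \<le> n + 1} \<union>
     {unbarred_pair n i j | i j. 1 \<le> i \<and> i + 1 < j \<and> j \<le> n + 1} \<union>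
     {barred_pair n i j | i j. 1 \<le> i \<and> i < j \<and> j \<le> n + 1 \<and> (i, j) \<noteq> (1, n + 1)}"

definition crosses :: "nat set \<Rightarrow> nat set \<Rightarrow> bool" where
  "crosses d e \<longleftrightarrow> (\<exists>p q r s. p < q \<and> q < r \<and> r < s \<and> {d, e} = {{p, r}, {q, s}})"

text \<open>
  \<open>compat_degree \<gamma> \<omega>\<close> is \<open>(\<gamma> \<parallel> \<omega>)\<close>; by central symmetry the number does not depend on which of the
  diagonals representing \<open>\<omega>\<close> is chosen.
\<close>

definition compat_degree :: "nat set set \<Rightarrow> nat set set \<Rightarrow> nat" where
  "compat_degree \<gamma> \<omega> = card {d \<in> \<gamma>. crosses d (SOME e. e \<in> \<omega>)}"

section \<open>The cluster configuration space of type C\<close>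

text \<open>
  Laurent polynomials in variables of type \<open>'v\<close> are finitely supported functions from exponent
  vectors \<open>'v \<Rightarrow>\<^sub>0 int\<close> to \<open>\<complex>\<close>, with the convolution product.
\<close>

type_synonym 'v laurent = "('v \<Rightarrow>\<^sub>0 int) \<Rightarrow>\<^sub>0 complex"

definition laurent_algebra :: "'v set \<Rightarrow> 'v laurent complex_algebra" where
  "laurent_algebra V =
    \<lparr>carrier = {p. \<forall>m \<in> Poly_Mapping.keys p. Poly_Mapping.keys m \<subseteq> V},
     monoid.mult = (*), one = 1, zero = 0, add = (+), const = Poly_Mapping.single 0\<rparr>"

definition laurent_var :: "'v \<Rightarrow> 'v laurent" where
  "laurent_var v = Poly_Mapping.single (Poly_Mapping.single v 1) 1"

definition u_relation :: "nat \<Rightarrow> nat set set \<Rightarrow> nat set set laurent" where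
  "u_relation n \<gamma> =
     laurent_var \<gamma> + (\<Prod>\<omega> \<in> Pi_C n. laurent_var \<omega> ^ compat_degree \<omega> \<gamma>) - 1"

definition u_algebra :: "nat \<Rightarrow> nat set set laurent set complex_algebra" where
  "u_algebra n =
     quotient_algebra (laurent_algebra (Pi_C n))
       (genideal (laurent_algebra (Pi_C n)) (u_relation n ` Pi_C n))"

definition M_C ::
    "nat \<Rightarrow> (nat set set laurent set set,
       nat set set laurent set set \<Rightarrow> (nat set set laurent set \<times> nat set set laurent set) set)
     ringed_space" where
  "M_C n = Spec (u_algebra n)"

section \<open>The space of matrices and its quotient\<close>

text \<open>Matrix rows and columns are indexed from 0, while the parameters are \<open>z 1, \<dots>, z n\<close>.\<close>

definition Z_matrix :: "nat \<Rightarrow> (nat \<Rightarrow> complex) \<Rightarrow> complex mat" where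
  "Z_matrix n z = mat 2 (n + 1) (\<lambda>(r, c). if r = 0 \<or> c = n then 1 else z (c + 1))"

definition z_coord :: "complex mat \<Rightarrow> nat \<Rightarrow> complex" where
  "z_coord A i = A $$ (1, i - 1)"

definition Z_space :: "nat \<Rightarrow> complex mat set" where
  "Z_space n = {Z_matrix n z | z.
     (\<forall>i j. 1 \<le> i \<and> i < j \<and> j \<le> n \<longrightarrow> z i - z j \<noteq> 0 \<and> z i + z j \<noteq> 0) \<and>
     (\<forall>i. 1 \<le> i \<and> i \<le> n \<longrightarrow> 1 - z i \<noteq> 0 \<and> 1 + z i \<noteq> 0 \<and> z i \<noteq> 0)}"

definition Z_action :: "nat \<Rightarrow> int \<Rightarrow> complex mat \<Rightarrow> complex mat" where
  "Z_action n g = (\<lambda>A \<in> Z_space n. if g = 0 then A else Z_matrix n (\<lambda>i. 1 / z_coord A i))"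

definition poly_eval :: "(nat \<Rightarrow> complex) \<Rightarrow> ((nat \<Rightarrow>\<^sub>0 nat) \<Rightarrow>\<^sub>0 complex) \<Rightarrow> complex" where
  "poly_eval z p =
     (\<Sum>m \<in> Poly_Mapping.keys p. Poly_Mapping.lookup p m *
        (\<Prod>i \<in> Poly_Mapping.keys m. z i ^ Poly_Mapping.lookup m i))"

definition Z_forms_product :: "nat \<Rightarrow> (nat \<Rightarrow> complex) \<Rightarrow> complex" where
  "Z_forms_product n z =
     (\<Prod>j \<in> {1..n}. \<Prod>i \<in> {1..<j}. (z i - z j) * (z i + z j)) *
     (\<Prod>i \<in> {1..n}. (1 - z i) * (1 + z i) * z i)"

text \<open>
  \<open>Z_space n\<close> is the principal open subset of affine \<open>n\<close>-space on which the product of the linear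
  forms does not vanish; its coordinate ring consists of the functions \<open>p / \<Delta>\<^sup>k\<close>, where \<open>p\<close> is a
  polynomial in \<open>z 1, \<dots>, z n\<close> and \<open>\<Delta>\<close> is that product.
\<close>

definition Z_regular :: "nat \<Rightarrow> (complex mat \<Rightarrow> complex) complex_algebra" where
  "Z_regular n =
    \<lparr>carrier = {f \<in> extensional (Z_space n). \<exists>p k.
        (\<forall>m \<in> Poly_Mapping.keys p. Poly_Mapping.keys m \<subseteq> {1..n}) \<and>
        (\<forall>A \<in> Z_space n. f A = poly_eval (z_coord A) p / Z_forms_product n (z_coord A) ^ k)},
     monoid.mult = (\<lambda>f g. \<lambda>A \<in> Z_space n. f A * g A),
     one = (\<lambda>A \<in> Z_space n. 1),
     zero = (\<lambda>A \<in> Z_space n. 0),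
     add = (\<lambda>f g. \<lambda>A \<in> Z_space n. f A + g A),
     const = (\<lambda>c. \<lambda>A \<in> Z_space n. c)\<rparr>"

text \<open>
  The quotient of an affine variety with coordinate ring \<open>A\<close> by a finite group is the spectrum of
  the subalgebra of invariants of \<open>A\<close>; here \<open>A\<close> consists of functions on the set \<open>X\<close> acted upon.
\<close>

definition invariant_algebra ::
    "('g, 'h) monoid_scheme \<Rightarrow> 'x set \<Rightarrow> ('g \<Rightarrow> 'x \<Rightarrow> 'x) \<Rightarrow> ('x \<Rightarrow> 'k) complex_algebra \<Rightarrow>
     ('x \<Rightarrow> 'k) complex_algebra" where
  "invariant_algebra G X \<alpha> A =
     A\<lparr>carrier := {f \<in> carrier A. \<forall>g \<in> carrier G. \<forall>x \<in> X. f (\<alpha> g x) = f x}\<rparr>"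

definition Z_quotient ::
    "nat \<Rightarrow> ((complex mat \<Rightarrow> complex) set,
       (complex mat \<Rightarrow> complex) set \<Rightarrow> ((complex mat \<Rightarrow> complex) \<times> (complex mat \<Rightarrow> complex)) set)
     ringed_space" where
  "Z_quotient n =
     Spec (invariant_algebra (integer_mod_group 2) (Z_space n) (Z_action n) (Z_regular n))"

end

theory Submission
  imports Defs
begin

text \<open>
  A point of \<open>Z_space n\<close> is a centrally symmetric configuration of the \<open>2 n + 2\<close> distinct points
  \<open>z\<^sub>1, \<dots>, z\<^sub>n, 1, - z\<^sub>1, \<dots>, - z\<^sub>n, - 1\<close>, attached to the vertices of the polygon in this order. For
  a diagonal \<open>(i, j)\<close> in \<open>\<gamma>\<close>, the variable \<open>u\<^sub>\<gamma>\<close> corresponds to the cross ratio of the points at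
  \<open>i\<close>, \<open>i + 1\<close>, \<open>j\<close>, \<open>j + 1\<close>. Products of these cross ratios over blocks of vertices telescope, so
  the u-equations are instances of the Pluecker relation. Inversion of the \<open>z\<^sub>i\<close> does not change
  the cross ratios, and this gives an algebra homomorphism from \<open>u_algebra n\<close> to the invariant
  regular functions.

  It is injective because the u-equations imply their extended versions for arbitrary blocks, which
  say that suitable products of the \<open>u\<^sub>\<gamma>\<close> behave like differences of coordinates of points in a
  chart with one vertex at infinity. Hence modulo the relations every \<open>u\<^sub>\<gamma>\<close> is a fraction in
  \<open>n + 1\<close> parameters, by the same formula that holds for actual configurations, and a relation
  between the cross ratios becomes a polynomial identity in the parameters.

  It is surjective because the functions \<open>(z\<^sub>i \<plusminus> z\<^sub>j)\<^sup>2 / (z\<^sub>i z\<^sub>j)\<close> are, up to constants, invertible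
  products of cross ratios, and every regular function is a combination \<open>F + y G\<close> of functions \<open>F\<close>
  and \<open>G\<close> of these with the anti-invariant \<open>y = z\<^sub>1 - 1 / z\<^sub>1\<close>.
\<close>

text \<open>The Laurent ring modulo the relations is not known beforehand to be reduced, so a
  Laurent polynomial that vanishes at all configurations cannot be placed in the ideal by looking at
  points alone. Injectivity is therefore proved by a polynomial identity: a numerator in the
  parameters is multiplied by the product of all vertex determinants, which kills it at degenerate
  parameters as well, so the product is the zero polynomial; the determinants are then cancelled,
  being units modulo the relations.

  The parameters are not the \<open>z i\<close>, which are determined only up to simultaneous
  inversion. With one vertex at infinity and its antipode at 0 the half turn is t -> -c/t, and c and
  the positions of the vertices are, up to sign, quotients of monomials in the variables. Only at
  complex points is a square root of -c extracted; it moves the involution to z -> -z, and its two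
  signs give the two tuples \<open>z\<close> and \<open>1 / z\<close>.

  For surjectivity the same ambiguity appears as the sign of y = z_1 - 1/z_1: it is lost, but y^2 is
  a unit among the functions of the cross ratios, so y itself may be divided by.\<close>

section \<open>Isomorphic algebras have isomorphic spectra\<close>

lemma zariski_istopology:
  assumes "cring R"
  shows "istopology (\<lambda>U. \<exists>E \<subseteq> carrier R. U = {P \<in> prime_spectrum R. \<not> E \<subseteq> P})"
  unfolding istopology_def
proof (intro conjI allI impI)
  interpret cring R by fact
  fix S T
  assume "\<exists>E\<subseteq>carrier R. S = {P \<in> prime_spectrum R. \<not> E \<subseteq> P}"
    and "\<exists>E\<subseteq>carrier R. T = {P \<in> prime_spectrum R. \<not> E \<subseteq> P}"
  then obtain E F where E: "E \<subseteq> carrier R" "S = {P \<in> prime_spectrum R. \<not> E \<subseteq> P}"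
    and F: "F \<subseteq> carrier R" "T = {P \<in> prime_spectrum R. \<not> F \<subseteq> P}" by blast
  let ?M = "{e \<otimes>\<^bsub>R\<^esub> f | e f. e \<in> E \<and> f \<in> F}"
  have "\<not> ?M \<subseteq> P \<longleftrightarrow> \<not> E \<subseteq> P \<and> \<not> F \<subseteq> P" if P: "primeideal P R" for P
  proof -
    interpret primeideal P R by fact
    show ?thesis
    proof
      assume "\<not> ?M \<subseteq> P"
      then obtain e f where "e \<in> E" "f \<in> F" "e \<otimes>\<^bsub>R\<^esub> f \<notin> P" by blast
      then show "\<not> E \<subseteq> P \<and> \<not> F \<subseteq> P"
        using E(1) F(1) I_l_closed I_r_closed by blast
    next
      assume "\<not> E \<subseteq> P \<and> \<not> F \<subseteq> P"
      then obtain e f where ef: "e \<in> E" "f \<in> F" "e \<notin> P" "f \<notin> P" by blast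
      then have "e \<otimes>\<^bsub>R\<^esub> f \<notin> P" using E(1) F(1) I_prime by blast
      then show "\<not> ?M \<subseteq> P" using ef by blast
    qed
  qed
  then have "S \<inter> T = {P \<in> prime_spectrum R. \<not> ?M \<subseteq> P}"
    unfolding E F prime_spectrum_def by blast
  moreover have "?M \<subseteq> carrier R" using E(1) F(1) by auto
  ultimately show "\<exists>E\<subseteq>carrier R. S \<inter> T = {P \<in> prime_spectrum R. \<not> E \<subseteq> P}" by blast
next
  fix K
  assume K: "\<forall>S\<in>K. \<exists>E\<subseteq>carrier R. S = {P \<in> prime_spectrum R. \<not> E \<subseteq> P}"
  then obtain e where e: "\<And>S. S \<in> K \<Longrightarrow> e S \<subseteq> carrier R \<and> S = {P \<in> prime_spectrum R. \<not> e S \<subseteq> P}"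
    by metis
  have "\<Union>K = {P \<in> prime_spectrum R. \<not> (\<Union>S\<in>K. e S) \<subseteq> P}"
    using e by blast
  moreover have "(\<Union>S\<in>K. e S) \<subseteq> carrier R" using e by blast
  ultimately show "\<exists>E\<subseteq>carrier R. \<Union>K = {P \<in> prime_spectrum R. \<not> E \<subseteq> P}" by blast
qed

lemma openin_zariski:
  assumes "cring R"
  shows "openin (zariski_topology R) U \<longleftrightarrow>
    (\<exists>E \<subseteq> carrier R. U = {P \<in> prime_spectrum R. \<not> E \<subseteq> P})"
  unfolding zariski_topology_def using topology_inverse'[OF zariski_istopology[OF assms]] by simp

lemma topspace_zariski:
  assumes "cring R"
  shows "topspace (zariski_topology R) = prime_spectrum R"
proof -
  interpret cring R by fact
  have "\<not> carrier R \<subseteq> P" if "primeideal P R" for P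
    using primeideal.I_notcarr[OF that] ideal.Icarr[OF primeideal.axioms(1)[OF that]] by blast
  then have "openin (zariski_topology R) (prime_spectrum R)"
    unfolding openin_zariski[OF assms] prime_spectrum_def by blast
  moreover have "U \<subseteq> prime_spectrum R" if "openin (zariski_topology R) U" for U
    using that unfolding openin_zariski[OF assms] by blast
  ultimately show ?thesis
    unfolding topspace_def by blast
qed

text \<open>A round trip through an isomorphism and its inverse is pointwise the identity on a
  prime, on a set of primes and on a class of fractions; this form serves all three.\<close>

lemma image_eq_selfI: "(\<And>x. x \<in> P \<Longrightarrow> f x = x) \<Longrightarrow> f ` P = P"
  by (simp cong: image_cong_simp)

section \<open>Transport of primes, fractions and sections along a ring isomorphism\<close>

locale cring_iso = R: cring R + S: cring S
  for R :: "('a, 'c) ring_scheme" and S :: "('b, 'd) ring_scheme" +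
  fixes g :: "'a \<Rightarrow> 'b"
  assumes iso: "g \<in> ring_iso R S"
begin

lemma g_carrier [simp, intro]: "x \<in> carrier R \<Longrightarrow> g x \<in> carrier S"
  using ring_iso_memE(1)[OF iso] .

lemma g_mult: "x \<in> carrier R \<Longrightarrow> y \<in> carrier R \<Longrightarrow> g (x \<otimes>\<^bsub>R\<^esub> y) = g x \<otimes>\<^bsub>S\<^esub> g y"
  using ring_iso_memE(2)[OF iso] .

lemma g_add: "x \<in> carrier R \<Longrightarrow> y \<in> carrier R \<Longrightarrow> g (x \<oplus>\<^bsub>R\<^esub> y) = g x \<oplus>\<^bsub>S\<^esub> g y"
  using ring_iso_memE(3)[OF iso] .

lemma g_inj: "inj_on g (carrier R)"
  using ring_iso_memE(5)[OF iso] by (simp add: bij_betw_def)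

lemma g_surj: "g ` carrier R = carrier S"
  using ring_iso_memE(5)[OF iso] by (simp add: bij_betw_def)

lemma g_eq_iff: "x \<in> carrier R \<Longrightarrow> y \<in> carrier R \<Longrightarrow> g x = g y \<longleftrightarrow> x = y"
  using g_inj by (auto dest: inj_onD)

lemma mem_image_iff: "P \<subseteq> carrier R \<Longrightarrow> x \<in> carrier R \<Longrightarrow> g x \<in> g ` P \<longleftrightarrow> x \<in> P"
  using g_inj by (meson inj_on_image_mem_iff)

lemma image_diff: "P \<subseteq> carrier R \<Longrightarrow> carrier S - g ` P = g ` (carrier R - P)"
  using inj_on_image_set_diff[OF g_inj, of "carrier R" P] g_surj by auto

lemma hom_ring: "ring_hom_ring R S g"
  using iso by (auto intro!: ring_hom_ringI2 simp: ring_iso_def R.ring_axioms S.ring_axioms)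

lemma prime_subset: "P \<in> prime_spectrum R \<Longrightarrow> P \<subseteq> carrier R"
  unfolding prime_spectrum_def by (auto dest: primeideal.axioms(1) ideal.Icarr)

lemma prime_image:
  assumes "P \<in> prime_spectrum R"
  shows "g ` P \<in> prime_spectrum S"
proof -
  interpret primeideal P R using assms by (simp add: prime_spectrum_def)
  have sub: "P \<subseteq> carrier R" using Icarr by blast
  interpret hom: ring_hom_ring R S g by (rule hom_ring)
  have "additive_subgroup (g ` P) S"
    using hom.img_is_add_subgroup[OF a_subgroup] by (simp add: additive_subgroup_def)
  then have "primeideal (g ` P) S"
  proof (rule primeidealI2[OF _ S.cring_axioms])
    fix a x assume "a \<in> g ` P" "x \<in> carrier S"
    then obtain b y where "a = g b" "b \<in> P" "x = g y" "y \<in> carrier R" using g_surj by blast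
    then show "x \<otimes>\<^bsub>S\<^esub> a \<in> g ` P" "a \<otimes>\<^bsub>S\<^esub> x \<in> g ` P"
      using I_l_closed[of b y] I_r_closed[of b y] sub by (auto simp flip: g_mult)
  next
    show "carrier S \<noteq> g ` P"
      using I_notcarr inj_on_image_eq_iff[OF g_inj subset_refl sub] g_surj by simp
  next
    fix a b assume "a \<in> carrier S" "b \<in> carrier S" and ab: "a \<otimes>\<^bsub>S\<^esub> b \<in> g ` P"
    then obtain x y where xy: "a = g x" "x \<in> carrier R" "b = g y" "y \<in> carrier R" using g_surj by blast
    then have "x \<otimes>\<^bsub>R\<^esub> y \<in> P"
      using ab mem_image_iff[OF sub, of "x \<otimes>\<^bsub>R\<^esub> y"] by (simp add: g_mult)
    then show "a \<in> g ` P \<or> b \<in> g ` P" using I_prime xy by blast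
  qed
  then show ?thesis by (simp add: prime_spectrum_def)
qed

text \<open>A fraction is the whole class of its representatives, so the images of the
  representatives must exhaust the target class: by \<open>image_diff\<close> every denominator and
  every witness outside the image prime lifts to an element outside \<open>P\<close>.\<close>

lemma image_fraction_at:
  assumes "P \<subseteq> carrier R" "a \<in> carrier R" "s \<in> carrier R"
  shows "map_prod g g ` fraction_at R P a s = fraction_at S (g ` P) (g a) (g s)" (is "?l = ?r")
proof (intro equalityI subsetI)
  fix x assume "x \<in> ?l"
  then obtain b t w where x: "x = (g b, g t)" and b: "b \<in> carrier R" "t \<in> carrier R - P"
    "w \<in> carrier R - P" and eq: "w \<otimes>\<^bsub>R\<^esub> (t \<otimes>\<^bsub>R\<^esub> a) = w \<otimes>\<^bsub>R\<^esub> (s \<otimes>\<^bsub>R\<^esub> b)"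
    unfolding fraction_at_def by auto
  have "g w \<otimes>\<^bsub>S\<^esub> (g t \<otimes>\<^bsub>S\<^esub> g a) = g (w \<otimes>\<^bsub>R\<^esub> (t \<otimes>\<^bsub>R\<^esub> a))"
    using b assms by (simp add: g_mult)
  also have "\<dots> = g w \<otimes>\<^bsub>S\<^esub> (g s \<otimes>\<^bsub>S\<^esub> g b)"
    unfolding eq using b assms by (simp add: g_mult)
  finally show "x \<in> ?r"
    unfolding fraction_at_def x using b mem_image_iff[OF assms(1)] by (auto intro!: bexI[of _ "g w"])
next
  fix x assume "x \<in> ?r"
  then obtain b' t' w' where x: "x = (b', t')" and b': "b' \<in> carrier S" "t' \<in> carrier S - g ` P"
    "w' \<in> carrier S - g ` P" and eq: "w' \<otimes>\<^bsub>S\<^esub> (t' \<otimes>\<^bsub>S\<^esub> g a) = w' \<otimes>\<^bsub>S\<^esub> (g s \<otimes>\<^bsub>S\<^esub> b')"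
    unfolding fraction_at_def by auto
  obtain b t w where b: "b \<in> carrier R" "t \<in> carrier R - P" "w \<in> carrier R - P"
    "b' = g b" "t' = g t" "w' = g w"
    using b' unfolding image_diff[OF assms(1)] by (metis (no_types) g_surj imageE)
  have "g (w \<otimes>\<^bsub>R\<^esub> (t \<otimes>\<^bsub>R\<^esub> a)) = g (w \<otimes>\<^bsub>R\<^esub> (s \<otimes>\<^bsub>R\<^esub> b))"
    using eq b assms by (simp add: g_mult)
  then have "w \<otimes>\<^bsub>R\<^esub> (t \<otimes>\<^bsub>R\<^esub> a) = w \<otimes>\<^bsub>R\<^esub> (s \<otimes>\<^bsub>R\<^esub> b)"
    using b assms by (simp add: g_eq_iff)
  then have "(b, t) \<in> fraction_at R P a s"
    unfolding fraction_at_def using b by blast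
  then show "x \<in> ?l" unfolding x using b by force
qed

lemma image_local_mult:
  assumes "P \<subseteq> carrier R" "x \<subseteq> carrier R \<times> carrier R" "y \<subseteq> carrier R \<times> carrier R"
  shows "map_prod g g ` local_mult R P x y
    = local_mult S (g ` P) (map_prod g g ` x) (map_prod g g ` y)"
proof -
  have "map_prod g g ` fraction_at R P (fst p \<otimes>\<^bsub>R\<^esub> fst q) (snd p \<otimes>\<^bsub>R\<^esub> snd q)
      = fraction_at S (g ` P) (g (fst p) \<otimes>\<^bsub>S\<^esub> g (fst q)) (g (snd p) \<otimes>\<^bsub>S\<^esub> g (snd q))"
    if "p \<in> x" "q \<in> y" for p q
  proof -
    have "fst p \<in> carrier R" "snd p \<in> carrier R" "fst q \<in> carrier R" "snd q \<in> carrier R"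
      using that assms by auto
    then show ?thesis using assms(1) by (simp add: image_fraction_at g_mult)
  qed
  then show ?thesis
    unfolding local_mult_def case_prod_beta image_UN image_image
    by (auto simp: map_prod_def case_prod_beta)
qed

lemma image_local_add:
  assumes "P \<subseteq> carrier R" "x \<subseteq> carrier R \<times> carrier R" "y \<subseteq> carrier R \<times> carrier R"
  shows "map_prod g g ` local_add R P x y
    = local_add S (g ` P) (map_prod g g ` x) (map_prod g g ` y)"
proof -
  have "map_prod g g ` fraction_at R P
        (snd q \<otimes>\<^bsub>R\<^esub> fst p \<oplus>\<^bsub>R\<^esub> snd p \<otimes>\<^bsub>R\<^esub> fst q) (snd p \<otimes>\<^bsub>R\<^esub> snd q)
      = fraction_at S (g ` P)
        (g (snd q) \<otimes>\<^bsub>S\<^esub> g (fst p) \<oplus>\<^bsub>S\<^esub> g (snd p) \<otimes>\<^bsub>S\<^esub> g (fst q)) (g (snd p) \<otimes>\<^bsub>S\<^esub> g (snd q))"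
    if "p \<in> x" "q \<in> y" for p q
  proof -
    have "fst p \<in> carrier R" "snd p \<in> carrier R" "fst q \<in> carrier R" "snd q \<in> carrier R"
      using that assms by auto
    then show ?thesis using assms(1) by (simp add: image_fraction_at g_mult g_add)
  qed
  then show ?thesis
    unfolding local_add_def case_prod_beta image_UN image_image
    by (auto simp: map_prod_def case_prod_beta)
qed


text \<open>Taking images is injective on subsets of the carrier, hence the inverse on
  \<open>Pow (carrier R)\<close>. The result is cut off outside the image of \<open>U\<close>
  because sections are extensional functions.\<close>

definition transport :: "'a set set \<Rightarrow> ('a set \<Rightarrow> ('a \<times> 'a) set) \<Rightarrow> 'b set \<Rightarrow> ('b \<times> 'b) set" where
  "transport U s = (\<lambda>Q \<in> (`) g ` U. map_prod g g ` s (the_inv_into (Pow (carrier R)) ((`) g) Q))"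

lemma inj_on_image_Pow: "inj_on ((`) g) (Pow (carrier R))"
  using g_inj by (rule inj_on_image_Pow)

lemma transport_apply:
  assumes "P \<in> U" "U \<subseteq> prime_spectrum R"
  shows "transport U s (g ` P) = map_prod g g ` s P"
proof -
  have "P \<in> Pow (carrier R)" using assms prime_subset by blast
  then show ?thesis
    using assms the_inv_into_f_f[OF inj_on_image_Pow] by (auto simp: transport_def)
qed

lemma openin_image:
  assumes "openin (zariski_topology R) U"
  shows "openin (zariski_topology S) ((`) g ` U)"
proof -
  obtain E where E: "E \<subseteq> carrier R" "U = {P \<in> prime_spectrum R. \<not> E \<subseteq> P}"
    using assms unfolding openin_zariski[OF R.cring_axioms] by blast
  define k where "k = inv_into (carrier R) g"
  have k: "k \<in> ring_iso S R" unfolding k_def using ring_iso_set_sym[OF R.ring_axioms iso] .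
  have gk: "g (k x) = x" if "x \<in> carrier S" for x
    using that f_inv_into_f[of x g "carrier R"] by (simp add: k_def g_surj)
  have sub: "g ` E \<subseteq> g ` P \<longleftrightarrow> E \<subseteq> P" if "P \<subseteq> carrier R" for P
    unfolding image_subset_iff using E(1) mem_image_iff[OF that] by (simp add: subset_iff Ball_def)
  have "Q \<in> (`) g ` U" if Q: "Q \<in> prime_spectrum S" "\<not> g ` E \<subseteq> Q" for Q
  proof -
    \<comment> \<open>The locale is instantiated with the inverse map, so that a prime of
      \<open>S\<close> is pulled back as an image and \<open>prime_image\<close> applies to
      it.\<close>
    interpret k: cring_iso S R k by (unfold_locales) (rule k)
    have eq: "g ` k ` Q = Q"
      unfolding image_image by (rule image_eq_selfI) (use k.prime_subset[OF Q(1)] gk in auto)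
    have "k ` Q \<in> prime_spectrum R" using k.prime_image Q(1) .
    moreover have "\<not> E \<subseteq> k ` Q" using Q(2) eq by (metis image_mono)
    ultimately have "k ` Q \<in> U" unfolding E(2) by simp
    then show ?thesis using eq by (auto intro!: image_eqI[where x = "k ` Q"])
  qed
  then have "(`) g ` U = {Q \<in> prime_spectrum S. \<not> g ` E \<subseteq> Q}"
    unfolding E(2) by (auto simp: prime_image sub prime_subset)
  moreover have "g ` E \<subseteq> carrier S" using E(1) by blast
  ultimately show ?thesis unfolding openin_zariski[OF S.cring_axioms] by blast
qed

end

lemma fraction_at_subset: "fraction_at R P a s \<subseteq> carrier R \<times> carrier R"
  by (auto simp: fraction_at_def)

lemma spec_sections_subset:
  assumes "s \<in> carrier (spec_sections A U)" "P \<in> U"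
  shows "s P \<subseteq> carrier A \<times> carrier A"
  using assms fraction_at_subset unfolding spec_sections_def by fastforce

text \<open>Scalars enter sections as fractions, and \<open>image_fraction_at\<close> asks for
  numerators in the carrier; the record type does not ensure this, hence
  \<open>const_closed\<close>.\<close>

locale complex_cring_iso = cring_iso A B g
  for A :: "('a, 'c) complex_algebra_scheme" and B :: "('b, 'd) complex_algebra_scheme" and g +
  assumes g_const: "g (const A c) = const B c"
    and const_closed: "const A c \<in> carrier A"
begin

lemma transport_sections:
  assumes U: "openin (zariski_topology A) U" and s: "s \<in> carrier (spec_sections A U)"
  shows "transport U s \<in> carrier (spec_sections B ((`) g ` U))"
proof -
  have Usub: "U \<subseteq> prime_spectrum A"
    using U openin_subset topspace_zariski[OF R.cring_axioms] by metis
  have "\<exists>V a h. openin (zariski_topology B) V \<and> g ` P \<in> V \<and> V \<subseteq> (`) g ` U \<and> a \<in> carrier B \<and>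
      h \<in> carrier B \<and> (\<forall>Q\<in>V. h \<notin> Q \<and> transport U s Q = fraction_at B Q a h)"
    if P: "P \<in> U" for P
  proof -
    obtain V a h where V: "openin (zariski_topology A) V" "P \<in> V" "V \<subseteq> U" "a \<in> carrier A"
      "h \<in> carrier A" "\<forall>Q\<in>V. h \<notin> Q \<and> s Q = fraction_at A Q a h"
      using s P unfolding spec_sections_def by auto
    have "g h \<notin> g ` Q \<and> transport U s (g ` Q) = fraction_at B (g ` Q) (g a) (g h)" if "Q \<in> V" for Q
    proof -
      have "Q \<subseteq> carrier A" using that V(3) Usub prime_subset by blast
      then show ?thesis
        using that V Usub by (subst transport_apply) (auto simp: image_fraction_at mem_image_iff)
    qed
    then have "\<forall>Q\<in>(`) g ` V. g h \<notin> Q \<and> transport U s Q = fraction_at B Q (g a) (g h)" by simp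
    then show ?thesis
      using V openin_image[OF V(1)]
      by (intro exI[of _ "(`) g ` V"] exI[of _ "g a"] exI[of _ "g h"]) (simp add: image_mono)
  qed
  moreover have "transport U s \<in> extensional ((`) g ` U)" by (simp add: transport_def)
  ultimately show ?thesis unfolding spec_sections_def by auto
qed

lemma transport_hom:
  assumes U: "openin (zariski_topology A) U"
  shows "transport U \<in> Ring.ring_hom (spec_sections A U) (spec_sections B ((`) g ` U))"
    and "transport U (const (spec_sections A U) c) = const (spec_sections B ((`) g ` U)) c"
proof -
  have Usub: "U \<subseteq> prime_spectrum A"
    using U openin_subset topspace_zariski[OF R.cring_axioms] by metis
  have sub: "P \<subseteq> carrier A" if "P \<in> U" for P using that Usub prime_subset by blast
  have eqI: "transport U s = s'"
    if "s' \<in> extensional ((`) g ` U)" "\<And>P. P \<in> U \<Longrightarrow> map_prod g g ` s P = s' (g ` P)" for s s'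
    using that Usub
    by (intro extensionalityI[of _ "(`) g ` U"]) (auto simp: transport_apply, simp add: transport_def)
  note simps = spec_sections_def sub transport_apply[OF _ Usub]
  have g1: "g \<one>\<^bsub>A\<^esub> = \<one>\<^bsub>B\<^esub>" using ring_iso_memE(4)[OF iso] .
  show "transport U \<in> Ring.ring_hom (spec_sections A U) (spec_sections B ((`) g ` U))"
  proof (rule ring_hom_memI)
    fix s t assume st: "s \<in> carrier (spec_sections A U)" "t \<in> carrier (spec_sections A U)"
    note st_sub = spec_sections_subset[OF st(1)] spec_sections_subset[OF st(2)]
    show "transport U (s \<otimes>\<^bsub>spec_sections A U\<^esub> t)
        = transport U s \<otimes>\<^bsub>spec_sections B ((`) g ` U)\<^esub> transport U t"
      using st_sub by (intro eqI) (simp_all add: simps image_local_mult)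
    show "transport U (s \<oplus>\<^bsub>spec_sections A U\<^esub> t)
        = transport U s \<oplus>\<^bsub>spec_sections B ((`) g ` U)\<^esub> transport U t"
      using st_sub by (intro eqI) (simp_all add: simps image_local_add)
  next
    show "transport U \<one>\<^bsub>spec_sections A U\<^esub> = \<one>\<^bsub>spec_sections B ((`) g ` U)\<^esub>"
      by (intro eqI) (simp_all add: simps image_fraction_at g1)
  qed (rule transport_sections[OF U])
  show "transport U (const (spec_sections A U) c) = const (spec_sections B ((`) g ` U)) c"
    by (intro eqI) (simp_all add: simps image_fraction_at g1 g_const const_closed)
qed

end

text \<open>Primes move forward along \<open>h\<close>, but the sheaf map runs from sections over
  \<open>B\<close> to sections over \<open>A\<close>. It is therefore transport along the inverse
  \<open>k\<close>, and the preimage of an open set under the homeomorphism has to be recognised as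
  its image under \<open>k\<close>.\<close>

lemma Spec_isomorphic:
  assumes A: "cring A" and B: "cring B" and cA: "\<And>c. const A c \<in> carrier A"
    and h: "h \<in> complex_algebra_iso A B"
  shows "ringed_space_isomorphic (Spec A) (Spec B)"
proof -
  interpret A: cring A by fact
  interpret B: cring B by fact
  have hi: "h \<in> ring_iso A B" and hc: "\<And>c. h (const A c) = const B c"
    using h by (auto simp: complex_algebra_iso_def)
  define k where "k = inv_into (carrier A) h"
  interpret h: complex_cring_iso A B h
    by unfold_locales (use hi hc cA in auto)
  have k: "k \<in> ring_iso B A" unfolding k_def using ring_iso_set_sym[OF A.ring_axioms hi] .
  have kh: "k (h x) = x" if "x \<in> carrier A" for x
    using that h.g_inj by (simp add: k_def)
  have hk: "h (k x) = x" if "x \<in> carrier B" for x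
    using that f_inv_into_f[of x h "carrier A"] by (simp add: k_def h.g_surj)
  have cB: "const B c \<in> carrier B" for c using h.g_carrier[OF cA] hc by metis
  interpret k: complex_cring_iso B A k
    by unfold_locales (use k hc cA cB kh in \<open>auto simp flip: hc\<close>)
  have kh_image: "k ` h ` P = P" if "P \<in> prime_spectrum A" for P
    unfolding image_image by (rule image_eq_selfI) (use h.prime_subset[OF that] kh in auto)
  have hk_image: "h ` k ` Q = Q" if "Q \<in> prime_spectrum B" for Q
    unfolding image_image by (rule image_eq_selfI) (use k.prime_subset[OF that] hk in auto)
  have inj: "inj_on ((`) h) (prime_spectrum A)"
    by (rule inj_on_inverseI[of _ "(`) k"]) (rule kh_image)
  have img: "(`) h ` prime_spectrum A = prime_spectrum B"
  proof (intro equalityI subsetI)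
    fix Q assume "Q \<in> prime_spectrum B"
    then show "Q \<in> (`) h ` prime_spectrum A"
      using k.prime_image hk_image by (intro image_eqI[where x = "k ` Q"]) (auto simp del: image_image)
  qed (auto intro: h.prime_image)
  have vimage: "(`) h -` V \<inter> prime_spectrum A = (`) k ` V" if V: "V \<subseteq> prime_spectrum B" for V
  proof (intro equalityI subsetI)
    fix P assume "P \<in> (`) h -` V \<inter> prime_spectrum A"
    then show "P \<in> (`) k ` V" using kh_image by (auto intro!: image_eqI[where x = "h ` P"])
  next
    fix P assume "P \<in> (`) k ` V"
    then show "P \<in> (`) h -` V \<inter> prime_spectrum A"
      using V k.prime_image hk_image by auto
  qed
  have homeo: "homeomorphic_map (zariski_topology A) (zariski_topology B) ((`) h)"
    unfolding homeomorphic_map_def quotient_map_def topspace_zariski[OF A] topspace_zariski[OF B]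
  proof (intro conjI allI impI)
    fix V assume V: "V \<subseteq> prime_spectrum B"
    then have "(`) h ` (`) k ` V = V"
      unfolding image_image[of "(`) h"] by (intro image_eq_selfI) (simp add: hk_image subsetD[OF V] del: image_image)
    moreover have "{P \<in> prime_spectrum A. h ` P \<in> V} = (`) k ` V"
      using vimage[OF V] by blast
    ultimately show "openin (zariski_topology A) {P \<in> prime_spectrum A. h ` P \<in> V}
        = openin (zariski_topology B) V"
      using h.openin_image[of "(`) k ` V"] k.openin_image[of V] by auto
  qed (fact inj img)+
  have sub: "V \<subseteq> prime_spectrum B" if "openin (zariski_topology B) V" for V
    using that openin_subset topspace_zariski[OF B] by metis
  have "k.transport V \<in> complex_algebra_iso (spec_sections B V) (spec_sections A ((`) k ` V))"
    if V: "openin (zariski_topology B) V" for V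
  proof -
    have W: "openin (zariski_topology A) ((`) k ` V)" using k.openin_image[OF V] .
    have eq: "(`) h ` (`) k ` V = V"
      unfolding image_image[of "(`) h"]
      by (rule image_eq_selfI) (simp add: hk_image subsetD[OF sub[OF V]] del: image_image)
    have Wsub: "(`) k ` V \<subseteq> prime_spectrum A" using sub[OF V] k.prime_image by auto
    have 1: "h.transport ((`) k ` V) (k.transport V s) = s"
      if s: "s \<in> carrier (spec_sections B V)" for s
    proof (rule extensionalityI[of _ V])
      fix Q assume Q: "Q \<in> V"
      have "h.transport ((`) k ` V) (k.transport V s) (h ` (k ` Q)) = map_prod h h ` map_prod k k ` s Q"
        using Q sub[OF V] Wsub by (simp add: h.transport_apply k.transport_apply)
      also have "\<dots> = s Q"
        unfolding image_image
        by (rule image_eq_selfI) (use spec_sections_subset[OF s Q] hk in auto)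
      finally show "h.transport ((`) k ` V) (k.transport V s) Q = s Q"
        using hk_image Q sub[OF V] by (simp add: subset_iff)
    qed (use s eq in \<open>auto simp: h.transport_def spec_sections_def\<close>)
    have 2: "k.transport V (h.transport ((`) k ` V) s) = s"
      if s: "s \<in> carrier (spec_sections A ((`) k ` V))" for s
    proof (rule extensionalityI[of _ "(`) k ` V"])
      fix P assume P: "P \<in> (`) k ` V"
      then have "h ` P \<in> (`) h ` (`) k ` V" by (rule imageI)
      then have hP: "h ` P \<in> V" "k ` h ` P = P"
        unfolding eq using P Wsub kh_image by (simp_all add: subset_iff)
      have "k.transport V (h.transport ((`) k ` V) s) (k ` (h ` P)) = map_prod k k ` map_prod h h ` s P"
        using P hP(1) sub[OF V] Wsub by (subst k.transport_apply) (simp_all add: h.transport_apply)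
      also have "\<dots> = s P"
        unfolding image_image
        by (rule image_eq_selfI) (use spec_sections_subset[OF s P] kh in auto)
      finally show "k.transport V (h.transport ((`) k ` V) s) P = s P"
        using hP by simp
    qed (use s in \<open>auto simp: k.transport_def spec_sections_def\<close>)
    have "bij_betw (k.transport V) (carrier (spec_sections B V)) (carrier (spec_sections A ((`) k ` V)))"
      by (rule bij_betw_byWitness[where f' = "h.transport ((`) k ` V)"])
        (use 1 2 k.transport_sections[OF V] h.transport_sections[OF W] eq in auto)
    then show ?thesis
      using k.transport_hom[OF V] by (simp add: complex_algebra_iso_def ring_iso_def)
  qed
  moreover have "restrict (k.transport V s) ((`) k ` W) = k.transport W (restrict s W)"
    if V: "openin (zariski_topology B) V" and W: "openin (zariski_topology B) W" "W \<subseteq> V" for V W s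
  proof (rule extensionalityI[of _ "(`) k ` W"])
    fix P assume "P \<in> (`) k ` W"
    then obtain Q where Q: "P = k ` Q" "Q \<in> W" by blast
    moreover have "k.transport V s (k ` Q) = map_prod k k ` s Q"
      using Q(2) W(2) sub[OF V] by (intro k.transport_apply) auto
    moreover have "k.transport W (restrict s W) (k ` Q) = map_prod k k ` s Q"
      using Q(2) W(2) sub[OF V] by (subst k.transport_apply) auto
    ultimately show "restrict (k.transport V s) ((`) k ` W) P = k.transport W (restrict s W) P"
      by simp
  qed (auto simp: k.transport_def)
  ultimately show ?thesis
    unfolding ringed_space_isomorphic_def Spec_def
    using homeo sub vimage topspace_zariski[OF A]
    by (intro exI[of _ "(`) h"] exI[of _ "k.transport"]) simp
qed

section \<open>Evaluation of polynomials and Laurent polynomials\<close>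

type_synonym 'v polynomial = "('v \<Rightarrow>\<^sub>0 nat) \<Rightarrow>\<^sub>0 complex"

lemma poly_mapping_sum_single:
  fixes p :: "'m \<Rightarrow>\<^sub>0 'b::comm_monoid_add"
  shows "p = (\<Sum>m\<in>Poly_Mapping.keys p. Poly_Mapping.single m (Poly_Mapping.lookup p m))"
  by (rule poly_mapping_eqI)
    (simp add: lookup_sum lookup_single when_def in_keys_iff)

text \<open>The case of a single term keeps its exponent among the keys of \<open>p\<close>, so that
  restrictions on the variables of \<open>p\<close>, such as membership in a carrier, remain
  available.\<close>

lemma poly_mapping_additive_induct:
  fixes p :: "'m \<Rightarrow>\<^sub>0 'b::comm_monoid_add"
  assumes "P 0" "\<And>m c. m \<in> Poly_Mapping.keys p \<Longrightarrow> P (Poly_Mapping.single m c)"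
    "\<And>x y. P x \<Longrightarrow> P y \<Longrightarrow> P (x + y)"
  shows "P p"
proof -
  have "P (\<Sum>m\<in>S. Poly_Mapping.single m (Poly_Mapping.lookup p m))"
    if "finite S" "S \<subseteq> Poly_Mapping.keys p" for S
    using that by (induction S rule: finite_induct) (simp_all add: assms)
  from this[OF finite_keys subset_refl] show ?thesis
    by (simp flip: poly_mapping_sum_single)
qed

text \<open>Scalars and exponents are mapped separately, \<open>\<chi>\<close> turning sums into
  products. This covers polynomials in any commutative ring, Laurent polynomials at nonzero points,
  and the substitution that removes variables.\<close>

locale ring_evaluation =
  fixes \<iota> :: "complex \<Rightarrow> 'a::comm_ring_1" and \<chi> :: "'m::comm_monoid_add \<Rightarrow> 'a"
  assumes scalar_one: "\<iota> 1 = 1"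
    and scalar_add: "\<iota> (a + b) = \<iota> a + \<iota> b"
    and scalar_mult: "\<iota> (a * b) = \<iota> a * \<iota> b"
    and char_zero: "\<chi> 0 = 1"
    and char_add: "\<chi> (m + m') = \<chi> m * \<chi> m'"
begin

definition eval_at :: "('m \<Rightarrow>\<^sub>0 complex) \<Rightarrow> 'a" where
  "eval_at p = (\<Sum>m\<in>Poly_Mapping.keys p. \<iota> (Poly_Mapping.lookup p m) * \<chi> m)"

lemma scalar_zero: "\<iota> 0 = 0"
  using scalar_add[of 0 0] by simp

lemma eval_at_superset:
  "finite S \<Longrightarrow> Poly_Mapping.keys p \<subseteq> S \<Longrightarrow> eval_at p = (\<Sum>m\<in>S. \<iota> (Poly_Mapping.lookup p m) * \<chi> m)"
  unfolding eval_at_def by (rule sum.mono_neutral_left) (auto simp: in_keys_iff scalar_zero)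

lemma eval_at_single: "eval_at (Poly_Mapping.single m c) = \<iota> c * \<chi> m"
  by (subst eval_at_superset[of "{m}"]) auto

lemma eval_at_zero: "eval_at 0 = 0"
  by (simp add: eval_at_def)

lemma eval_at_add: "eval_at (p + q) = eval_at p + eval_at q"
proof -
  let ?S = "Poly_Mapping.keys p \<union> Poly_Mapping.keys q"
  have "eval_at (p + q) = (\<Sum>m\<in>?S. \<iota> (Poly_Mapping.lookup (p + q) m) * \<chi> m)"
    by (rule eval_at_superset) (simp_all add: keys_add)
  also have "\<dots> = (\<Sum>m\<in>?S. \<iota> (Poly_Mapping.lookup p m) * \<chi> m) + (\<Sum>m\<in>?S. \<iota> (Poly_Mapping.lookup q m) * \<chi> m)"
    by (simp add: lookup_add scalar_add distrib_right sum.distrib)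
  also have "\<dots> = eval_at p + eval_at q"
    by (simp add: eval_at_superset[of ?S])
  finally show ?thesis .
qed

lemma eval_at_one: "eval_at 1 = 1"
  using eval_at_single[of 0 1] by (simp add: scalar_one char_zero)

lemma eval_at_mult: "eval_at (p * q) = eval_at p * eval_at q"
proof (rule poly_mapping_additive_induct[of _ p])
  fix m c
  show "eval_at (Poly_Mapping.single m c * q) = eval_at (Poly_Mapping.single m c) * eval_at q"
    by (rule poly_mapping_additive_induct[of _ q])
      (simp_all add: eval_at_zero mult_single eval_at_single scalar_mult char_add mult_ac
        distrib_left distrib_right eval_at_add)
qed (simp_all add: eval_at_zero distrib_right eval_at_add)

lemma eval_at_uminus: "eval_at (- p) = - eval_at p"
  using eval_at_add[of p "- p"] by (simp add: eval_at_zero add_eq_0_iff)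

lemma eval_at_diff: "eval_at (p - q) = eval_at p - eval_at q"
  using eval_at_add[of p "- q"] by (simp add: eval_at_uminus)

lemma eval_at_power: "eval_at (p ^ k) = eval_at p ^ k"
  by (induction k) (simp_all add: eval_at_one eval_at_mult)

lemma eval_at_prod: "eval_at (\<Prod>i\<in>S. f i) = (\<Prod>i\<in>S. eval_at (f i))"
  by (induction S rule: infinite_finite_induct) (simp_all add: eval_at_one eval_at_mult)

end

definition nat_monomial :: "('v \<Rightarrow> 'a::comm_ring_1) \<Rightarrow> ('v \<Rightarrow>\<^sub>0 nat) \<Rightarrow> 'a" where
  "nat_monomial a m = (\<Prod>v\<in>Poly_Mapping.keys m. a v ^ Poly_Mapping.lookup m v)"

lemma nat_monomial_superset:
  "finite S \<Longrightarrow> Poly_Mapping.keys m \<subseteq> S \<Longrightarrow> nat_monomial a m = (\<Prod>v\<in>S. a v ^ Poly_Mapping.lookup m v)"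
  unfolding nat_monomial_def by (rule prod.mono_neutral_left) (auto simp: in_keys_iff)

lemma nat_monomial_add: "nat_monomial a (m + m') = nat_monomial a m * nat_monomial a m'"
proof -
  let ?S = "Poly_Mapping.keys m \<union> Poly_Mapping.keys m'"
  have "nat_monomial a (m + m') = (\<Prod>v\<in>?S. a v ^ Poly_Mapping.lookup (m + m') v)"
    by (rule nat_monomial_superset) (simp_all add: keys_add)
  also have "\<dots> = nat_monomial a m * nat_monomial a m'"
    by (simp add: nat_monomial_superset[of ?S] lookup_add power_add prod.distrib)
  finally show ?thesis .
qed

definition int_monomial :: "('v \<Rightarrow> complex) \<Rightarrow> ('v \<Rightarrow>\<^sub>0 int) \<Rightarrow> complex" where
  "int_monomial a m = (\<Prod>v\<in>Poly_Mapping.keys m. a v powi Poly_Mapping.lookup m v)"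

lemma int_monomial_superset:
  "finite S \<Longrightarrow> Poly_Mapping.keys m \<subseteq> S \<Longrightarrow> int_monomial a m = (\<Prod>v\<in>S. a v powi Poly_Mapping.lookup m v)"
  unfolding int_monomial_def by (rule prod.mono_neutral_left) (auto simp: in_keys_iff)

lemma int_monomial_add:
  assumes "\<And>v. a v \<noteq> 0"
  shows "int_monomial a (m + m') = int_monomial a m * int_monomial a m'"
proof -
  let ?S = "Poly_Mapping.keys m \<union> Poly_Mapping.keys m'"
  have "int_monomial a (m + m') = (\<Prod>v\<in>?S. a v powi Poly_Mapping.lookup (m + m') v)"
    by (rule int_monomial_superset) (simp_all add: keys_add)
  also have "\<dots> = int_monomial a m * int_monomial a m'"
    by (simp add: int_monomial_superset[of ?S] lookup_add power_int_add assms prod.distrib)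
  finally show ?thesis .
qed

definition laurent_eval :: "('v \<Rightarrow> complex) \<Rightarrow> 'v laurent \<Rightarrow> complex" where
  "laurent_eval a p = (\<Sum>m\<in>Poly_Mapping.keys p. Poly_Mapping.lookup p m * int_monomial a m)"

locale nonzero_point =
  fixes a :: "'v \<Rightarrow> complex"
  assumes nonzero: "a v \<noteq> 0"
begin

sublocale ring_evaluation "\<lambda>c. c" "int_monomial a"
  by unfold_locales (simp_all add: int_monomial_add nonzero int_monomial_def[of a 0])

lemma laurent_eval_eq: "laurent_eval a = eval_at"
  by (simp add: laurent_eval_def eval_at_def fun_eq_iff)

lemma laurent_eval_var: "laurent_eval a (laurent_var v) = a v"
  by (simp add: laurent_eval_eq laurent_var_def eval_at_single int_monomial_def)

end

text \<open>The target ring is arbitrary because one and the same polynomial is later evaluated at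
  complex parameters and at Laurent polynomials.\<close>

definition generic_eval :: "('v \<Rightarrow> 'a::comm_ring_1) \<Rightarrow> (complex \<Rightarrow> 'a) \<Rightarrow> 'v polynomial \<Rightarrow> 'a" where
  "generic_eval a \<iota> p = (\<Sum>m\<in>Poly_Mapping.keys p. \<iota> (Poly_Mapping.lookup p m) * nat_monomial a m)"

lemma poly_eval_eq: "poly_eval z = generic_eval z (\<lambda>c. c)"
  by (simp add: poly_eval_def generic_eval_def nat_monomial_def fun_eq_iff)

definition poly_var :: "'v \<Rightarrow> 'v polynomial" where
  "poly_var v = Poly_Mapping.single (Poly_Mapping.single v 1) 1"

locale scalars =
  fixes \<iota> :: "complex \<Rightarrow> 'a::comm_ring_1"
  assumes one: "\<iota> 1 = 1"
    and add: "\<iota> (a + b) = \<iota> a + \<iota> b"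
    and mult: "\<iota> (a * b) = \<iota> a * \<iota> b"
begin

lemma ring_evaluation: "ring_evaluation \<iota> (nat_monomial a)"
  by unfold_locales (simp_all add: one add mult nat_monomial_add nat_monomial_def[of a 0])

lemma generic_eval_eq: "generic_eval a \<iota> = ring_evaluation.eval_at \<iota> (nat_monomial a)"
  by (simp add: generic_eval_def ring_evaluation.eval_at_def[OF ring_evaluation] fun_eq_iff)

lemma generic_eval_hom:
  "generic_eval a \<iota> 0 = 0" "generic_eval a \<iota> 1 = 1"
  "generic_eval a \<iota> (p + q) = generic_eval a \<iota> p + generic_eval a \<iota> q"
  "generic_eval a \<iota> (p - q) = generic_eval a \<iota> p - generic_eval a \<iota> q"
  "generic_eval a \<iota> (- p) = - generic_eval a \<iota> p"
  "generic_eval a \<iota> (p * q) = generic_eval a \<iota> p * generic_eval a \<iota> q"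
  "generic_eval a \<iota> (prod f S) = (\<Prod>i\<in>S. generic_eval a \<iota> (f i))"
  "generic_eval a \<iota> (poly_var v) = a v"
  "generic_eval a \<iota> (Poly_Mapping.single 0 c) = \<iota> c"
proof -
  interpret E: ring_evaluation \<iota> "nat_monomial a" by (rule ring_evaluation)
  show "generic_eval a \<iota> 0 = 0" "generic_eval a \<iota> 1 = 1"
    "generic_eval a \<iota> (p + q) = generic_eval a \<iota> p + generic_eval a \<iota> q"
    "generic_eval a \<iota> (p - q) = generic_eval a \<iota> p - generic_eval a \<iota> q"
    "generic_eval a \<iota> (- p) = - generic_eval a \<iota> p"
    "generic_eval a \<iota> (p * q) = generic_eval a \<iota> p * generic_eval a \<iota> q"
    "generic_eval a \<iota> (prod f S) = (\<Prod>i\<in>S. generic_eval a \<iota> (f i))"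
    by (simp_all add: generic_eval_eq E.eval_at_zero E.eval_at_one E.eval_at_add E.eval_at_diff
        E.eval_at_uminus E.eval_at_mult E.eval_at_prod)
  show "generic_eval a \<iota> (poly_var v) = a v" "generic_eval a \<iota> (Poly_Mapping.single 0 c) = \<iota> c"
    by (simp_all add: generic_eval_eq poly_var_def E.eval_at_single one nat_monomial_def)
qed

end

interpretation complex_scalars: scalars "\<lambda>c. c"
  by unfold_locales simp_all

lemma poly_eval_hom:
  "poly_eval a 0 = 0" "poly_eval a 1 = 1"
  "poly_eval a (p + q) = poly_eval a p + poly_eval a q"
  "poly_eval a (p - q) = poly_eval a p - poly_eval a q"
  "poly_eval a (- p) = - poly_eval a p"
  "poly_eval a (p * q) = poly_eval a p * poly_eval a q"
  "poly_eval a (prod f S) = (\<Prod>i\<in>S. poly_eval a (f i))"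
  "poly_eval a (poly_var v) = a v"
  "poly_eval a (Poly_Mapping.single 0 c) = c"
  unfolding poly_eval_eq by (simp_all add: complex_scalars.generic_eval_hom)

text \<open>Dedekind's argument: distinct characters are linearly independent.\<close>

lemma nat_monomials_independent:
  fixes c :: "('v \<Rightarrow>\<^sub>0 nat) \<Rightarrow> complex"
  assumes "finite S" "\<And>z. (\<Sum>m\<in>S. c m * nat_monomial z m) = 0" "m \<in> S"
  shows "c m = 0"
  using assms
proof (induction S arbitrary: c m rule: finite_induct)
  case (insert m0 S)
  have *: "c m = 0" if m: "m \<in> S" for m
  proof -
    have "m \<noteq> m0" using m insert.hyps by auto
    then obtain v where v: "Poly_Mapping.lookup m v \<noteq> Poly_Mapping.lookup m0 v"
      by (metis poly_mapping_eqI)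
    \<comment> \<open>Doubling the coordinate \<open>v\<close> multiplies the monomials of
      \<open>m\<close> and \<open>m0\<close> by different powers of 2; subtracting a multiple of the
      original relation from the rescaled one eliminates \<open>m0\<close>.\<close>
    define g where "g = (\<lambda>u. if u = v then 2 else (1::complex))"
    have g: "nat_monomial g m = 2 ^ Poly_Mapping.lookup m v" for m
      by (subst nat_monomial_superset[of "insert v (Poly_Mapping.keys m)"])
        (auto simp: g_def prod.insert_remove)
    have mult: "nat_monomial (\<lambda>u. g u * z u) m = nat_monomial g m * nat_monomial z m" for z m
      by (simp add: nat_monomial_def power_mult_distrib prod.distrib)
    have "(\<Sum>m\<in>S. c m * (nat_monomial g m - nat_monomial g m0) * nat_monomial z m) = 0" for z
    proof -
      have "(\<Sum>m\<in>insert m0 S. c m * nat_monomial (\<lambda>u. g u * z u) m)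
          - nat_monomial g m0 * (\<Sum>m\<in>insert m0 S. c m * nat_monomial z m) = 0"
        using insert.prems(1) by simp
      then show ?thesis
        using insert.hyps by (simp add: mult algebra_simps sum_distrib_left sum_subtractf)
    qed
    then have "c m * (nat_monomial g m - nat_monomial g m0) = 0"
      by (rule insert.IH) (rule m)
    moreover have "nat_monomial g m \<noteq> nat_monomial g m0"
    proof -
      have "(of_nat (2 ^ Poly_Mapping.lookup m v) :: complex) \<noteq> of_nat (2 ^ Poly_Mapping.lookup m0 v)"
        unfolding of_nat_eq_iff using v by simp
      then show ?thesis unfolding g by simp
    qed
    ultimately show ?thesis by simp
  qed
  have "c m0 = 0"
    using insert.prems(1)[of "\<lambda>_. 1"] insert.hyps * by (simp add: nat_monomial_def)
  then show ?case using * insert.prems(2) by auto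
qed simp

lemma poly_eval_eq_zero_imp:
  assumes "\<And>z. poly_eval z p = 0"
  shows "p = 0"
proof (rule poly_mapping_eqI)
  fix m
  show "Poly_Mapping.lookup p m = Poly_Mapping.lookup 0 m"
  proof (cases "m \<in> Poly_Mapping.keys p")
    case True
    then show ?thesis
      using nat_monomials_independent[of "Poly_Mapping.keys p" "Poly_Mapping.lookup p" m] assms
      by (simp add: poly_eval_eq generic_eval_def)
  qed (simp add: in_keys_iff)
qed

section \<open>Retraction of the Laurent ring onto a given set of variables\<close>

definition restrict_exponent :: "'v set \<Rightarrow> ('v \<Rightarrow>\<^sub>0 int) \<Rightarrow> ('v \<Rightarrow>\<^sub>0 int)" where
  "restrict_exponent V m = frag_extend (\<lambda>v. if v \<in> V then frag_of v else 0) m"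

lemma keys_restrict_exponent: "Poly_Mapping.keys (restrict_exponent V m) \<subseteq> V"
  unfolding restrict_exponent_def
  by (rule subset_trans[OF keys_frag_extend]) (auto split: if_splits)

lemma restrict_exponent_id:
  assumes "Poly_Mapping.keys m \<subseteq> V"
  shows "restrict_exponent V m = m"
proof -
  have "restrict_exponent V m = frag_extend frag_of m"
    unfolding restrict_exponent_def by (rule frag_extend_eq) (use assms in auto)
  then show ?thesis by (simp flip: frag_expansion)
qed

lemma laurent_scalars: "scalars (Poly_Mapping.single 0 :: complex \<Rightarrow> 'v laurent)"
  by unfold_locales (simp_all add: single_add mult_single)

lemma retraction_evaluation:
  "ring_evaluation (Poly_Mapping.single 0) (\<lambda>m. Poly_Mapping.single (restrict_exponent V m) 1 :: 'v laurent)"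
  by unfold_locales
    (simp_all add: single_add mult_single restrict_exponent_def frag_extend_add)

text \<open>The substitution of 1 for the variables outside \<open>V\<close>. On exponents it is a
  homomorphism of free abelian groups, which is why \<open>restrict_exponent\<close> is built from
  \<open>frag_extend\<close>.\<close>

definition laurent_retract :: "'v set \<Rightarrow> 'v laurent \<Rightarrow> 'v laurent" where
  "laurent_retract V = ring_evaluation.eval_at (Poly_Mapping.single 0)
     (\<lambda>m. Poly_Mapping.single (restrict_exponent V m) 1)"

lemmas laurent_retract_hom =
  ring_evaluation.eval_at_add[OF retraction_evaluation, folded laurent_retract_def]
  ring_evaluation.eval_at_mult[OF retraction_evaluation, folded laurent_retract_def]
  ring_evaluation.eval_at_zero[OF retraction_evaluation, folded laurent_retract_def]

lemma laurent_algebra_carrier: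
  "p \<in> carrier (laurent_algebra V) \<longleftrightarrow> (\<forall>m \<in> Poly_Mapping.keys p. Poly_Mapping.keys m \<subseteq> V)"
  by (simp add: laurent_algebra_def)

lemma laurent_algebra_simps:
  "x \<otimes>\<^bsub>laurent_algebra V\<^esub> y = x * y" "x \<oplus>\<^bsub>laurent_algebra V\<^esub> y = x + y"
  "\<one>\<^bsub>laurent_algebra V\<^esub> = 1" "\<zero>\<^bsub>laurent_algebra V\<^esub> = 0"
  "const (laurent_algebra V) = Poly_Mapping.single 0"
  by (simp_all add: laurent_algebra_def)

lemma laurent_algebra_closed:
  "0 \<in> carrier (laurent_algebra V)" "1 \<in> carrier (laurent_algebra V)"
  "Poly_Mapping.single 0 c \<in> carrier (laurent_algebra V)"
  "x \<in> carrier (laurent_algebra V) \<Longrightarrow> y \<in> carrier (laurent_algebra V) \<Longrightarrow> x + y \<in> carrier (laurent_algebra V)"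
  "x \<in> carrier (laurent_algebra V) \<Longrightarrow> - x \<in> carrier (laurent_algebra V)"
  "x \<in> carrier (laurent_algebra V) \<Longrightarrow> y \<in> carrier (laurent_algebra V) \<Longrightarrow> x - y \<in> carrier (laurent_algebra V)"
  "x \<in> carrier (laurent_algebra V) \<Longrightarrow> y \<in> carrier (laurent_algebra V) \<Longrightarrow> x * y \<in> carrier (laurent_algebra V)"
  "v \<in> V \<Longrightarrow> Poly_Mapping.single (Poly_Mapping.single v k) 1 \<in> carrier (laurent_algebra V)"
proof -
  show 1: "x + y \<in> carrier (laurent_algebra V)"
    if "x \<in> carrier (laurent_algebra V)" "y \<in> carrier (laurent_algebra V)"
    using that keys_add[of x y] unfolding laurent_algebra_carrier by blast
  show 2: "- x \<in> carrier (laurent_algebra V)" if "x \<in> carrier (laurent_algebra V)"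
    using that unfolding laurent_algebra_carrier by (simp add: in_keys_iff)
  show "x - y \<in> carrier (laurent_algebra V)"
    if "x \<in> carrier (laurent_algebra V)" "y \<in> carrier (laurent_algebra V)"
    using that keys_diff[of x y] unfolding laurent_algebra_carrier by blast
  show "x * y \<in> carrier (laurent_algebra V)"
    if xy: "x \<in> carrier (laurent_algebra V)" "y \<in> carrier (laurent_algebra V)"
    unfolding laurent_algebra_carrier
  proof
    fix m assume "m \<in> Poly_Mapping.keys (x * y)"
    then obtain a b where "a \<in> Poly_Mapping.keys x" "b \<in> Poly_Mapping.keys y" "m = a + b"
      using keys_mult[of x y] by blast
    then show "Poly_Mapping.keys m \<subseteq> V"
      using xy keys_add[of a b] unfolding laurent_algebra_carrier by blast
  qed
qed (auto simp: laurent_algebra_carrier)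

lemma laurent_var_closed: "v \<in> V \<Longrightarrow> laurent_var v \<in> carrier (laurent_algebra V)"
  by (simp add: laurent_var_def laurent_algebra_closed)

lemma laurent_prod_closed:
  "(\<And>i. i \<in> S \<Longrightarrow> f i \<in> carrier (laurent_algebra V)) \<Longrightarrow> prod f S \<in> carrier (laurent_algebra V)"
  by (induction S rule: infinite_finite_induct) (simp_all add: laurent_algebra_closed)

lemma laurent_power_closed:
  "x \<in> carrier (laurent_algebra V) \<Longrightarrow> x ^ k \<in> carrier (laurent_algebra V)"
  by (induction k) (simp_all add: laurent_algebra_closed)

lemma laurent_var_unit: "laurent_var v dvd 1"
proof
  show "1 = laurent_var v * Poly_Mapping.single (Poly_Mapping.single v (- 1)) 1"
    by (simp add: laurent_var_def mult_single flip: single_add)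
qed

lemma laurent_retract_carrier: "laurent_retract V p \<in> carrier (laurent_algebra V)"
proof (rule poly_mapping_additive_induct[of _ p])
  fix m c
  have "laurent_retract V (Poly_Mapping.single m c) = Poly_Mapping.single (restrict_exponent V m) c"
    by (simp add: laurent_retract_def ring_evaluation.eval_at_single[OF retraction_evaluation] mult_single)
  then show "laurent_retract V (Poly_Mapping.single m c) \<in> carrier (laurent_algebra V)"
    using keys_restrict_exponent[of V m] by (auto simp: laurent_algebra_carrier split: if_splits)
qed (simp_all add: laurent_retract_hom laurent_algebra_closed)

lemma laurent_retract_id:
  assumes "p \<in> carrier (laurent_algebra V)"
  shows "laurent_retract V p = p"
proof -
  have "laurent_retract V p = (\<Sum>m\<in>Poly_Mapping.keys p. Poly_Mapping.single m (Poly_Mapping.lookup p m))"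
    unfolding laurent_retract_def ring_evaluation.eval_at_def[OF retraction_evaluation]
    by (intro sum.cong refl)
      (use assms in \<open>simp add: laurent_algebra_carrier restrict_exponent_id mult_single\<close>)
  then show ?thesis by (simp flip: poly_mapping_sum_single)
qed

lemma laurent_algebra_cring: "cring (laurent_algebra V)"
proof (rule cringI)
  show "abelian_group (laurent_algebra V)"
  proof (rule abelian_groupI)
    fix x assume "x \<in> carrier (laurent_algebra V)"
    then show "\<exists>y\<in>carrier (laurent_algebra V). y \<oplus>\<^bsub>laurent_algebra V\<^esub> x = \<zero>\<^bsub>laurent_algebra V\<^esub>"
      by (intro bexI[of _ "- x"]) (simp_all add: laurent_algebra_simps laurent_algebra_closed)
  qed (simp_all add: laurent_algebra_simps laurent_algebra_closed add_ac)
  show "comm_monoid (laurent_algebra V)"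
    by (rule comm_monoidI) (simp_all add: laurent_algebra_simps laurent_algebra_closed mult_ac)
qed (simp add: laurent_algebra_simps distrib_right)

section \<open>The extended u-equations\<close>

locale congruence_ideal =
  fixes J :: "'a::comm_ring_1 set"
  assumes zero_mem: "0 \<in> J"
    and add_mem: "x \<in> J \<Longrightarrow> y \<in> J \<Longrightarrow> x + y \<in> J"
    and mult_mem: "x \<in> J \<Longrightarrow> r * x \<in> J"
begin

definition cong :: "'a \<Rightarrow> 'a \<Rightarrow> bool" (infix \<open>\<approx>\<close> 50) where
  "a \<approx> b \<longleftrightarrow> a - b \<in> J"

lemma cong_refl [simp]: "a \<approx> a"
  by (simp add: cong_def zero_mem)

lemma cong_sym: "a \<approx> b \<Longrightarrow> b \<approx> a"
  using mult_mem[of "a - b" "-1"] by (simp add: cong_def)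

lemma cong_trans [trans]: "a \<approx> b \<Longrightarrow> b \<approx> c \<Longrightarrow> a \<approx> c"
  using add_mem[of "a - b" "b - c"] by (simp add: cong_def)

lemma cong_eq_trans [trans]: "a = b \<Longrightarrow> b \<approx> c \<Longrightarrow> a \<approx> c" "a \<approx> b \<Longrightarrow> b = c \<Longrightarrow> a \<approx> c"
  by simp_all

lemma cong_add: "a \<approx> b \<Longrightarrow> c \<approx> d \<Longrightarrow> a + c \<approx> b + d"
  using add_mem[of "a - b" "c - d"] by (simp add: cong_def algebra_simps)

lemma cong_mult: "a \<approx> b \<Longrightarrow> c \<approx> d \<Longrightarrow> a * c \<approx> b * d"
  using add_mem[OF mult_mem[of "a - b" c] mult_mem[of "c - d" b]]
  by (simp add: cong_def algebra_simps)

lemma cong_uminus: "a \<approx> b \<Longrightarrow> - a \<approx> - b"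
  using cong_mult[of "-1" "-1" a b] by simp

lemma cong_diff: "a \<approx> b \<Longrightarrow> c \<approx> d \<Longrightarrow> a - c \<approx> b - d"
  using cong_add[of a b "-c" "-d"] cong_uminus by simp

lemma cong_zero_iff: "a \<approx> 0 \<longleftrightarrow> a \<in> J"
  by (simp add: cong_def)

end

section \<open>Products over two blocks of vertices\<close>

definition block_prod :: "(nat \<Rightarrow> nat \<Rightarrow> 'a::comm_monoid_mult) \<Rightarrow> nat \<Rightarrow> nat \<Rightarrow> nat \<Rightarrow> nat \<Rightarrow> 'a" where
  "block_prod w a b c d = (\<Prod>k\<in>{a..<b}. \<Prod>l\<in>{c..<d}. w k l)"

lemma block_prod_split_left:
  "a \<le> b \<Longrightarrow> b \<le> b' \<Longrightarrow> block_prod w a b' c d = block_prod w a b c d * block_prod w b b' c d"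
  by (simp add: block_prod_def prod.atLeastLessThan_concat)

lemma block_prod_split_right:
  "c \<le> d \<Longrightarrow> d \<le> d' \<Longrightarrow> block_prod w a b c d' = block_prod w a b c d * block_prod w a b d d'"
  by (simp add: block_prod_def prod.atLeastLessThan_concat flip: prod.distrib)

lemma block_prod_single [simp]: "block_prod w i (Suc i) j (Suc j) = w i j"
  by (simp add: block_prod_def)

lemma block_prod_empty [simp]: "block_prod w a a c d = 1" "block_prod w a b c c = 1"
  by (simp_all add: block_prod_def)

lemma prod_nat_ivl_shift: "(\<Prod>k\<in>{a + N..<b + N}. f k) = (\<Prod>k\<in>{a..<b::nat}. f (k + N))"
  using prod.shift_bounds_nat_ivl[of f a N b] .

text \<open>
  The number \<open>w i j\<close> belongs to the diagonal from vertex \<open>i\<close> to vertex \<open>j\<close>, with indices modulo \<open>N\<close>.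
  Using representatives beyond \<open>N\<close>, every cyclic range of vertices is an interval of natural numbers.
\<close>

locale polygon_function =
  fixes N :: nat and w :: "nat \<Rightarrow> nat \<Rightarrow> 'a::comm_monoid_mult"
  assumes period: "w (i + N) j = w i j"
    and symm: "w i j = w j i"
begin

lemma block_prod_symm: "block_prod w a b c d = block_prod w c d a b"
  unfolding block_prod_def by (subst prod.swap) (simp add: symm)

lemma block_prod_period: "block_prod w (a + N) (b + N) c d = block_prod w a b c d"
  unfolding block_prod_def prod_nat_ivl_shift by (simp add: period)

lemma block_prod_rotate: "block_prod w c d (a + N) (b + N) = block_prod w a b c d"
  using block_prod_symm block_prod_period by metis

end

text \<open>The half-open intervals list the vertices strictly on either side of the diagonal, so
  the block product runs over the diagonals that cross it; the two inequalities exclude the sides of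
  the polygon.\<close>

locale u_equations = congruence_ideal J + polygon_function N w
  for J :: "'a::comm_ring_1 set" and N and w +
  assumes u_equation: "i + 2 \<le> j \<Longrightarrow> j + 2 \<le> i + N \<Longrightarrow>
    w i j + block_prod w (Suc i) j (Suc j) (i + N) \<approx> 1"
begin

text \<open>The claim is a combination of the three defects without any division, so it holds modulo
  every ideal. In each use \<open>A\<close> belongs to the old block and \<open>B\<close> to one
  added vertex, against the same block, and \<open>Q\<close> and \<open>R\<close> are what the
  opposite products of \<open>A\<close> and of \<open>B\<close> contain beyond
  \<open>P\<close>.\<close>

lemma u_equation_step:
  assumes "A + P * Q \<approx> 1" "B + P * R \<approx> 1" "Q + R * A \<approx> 1"
  shows "A * B + P \<approx> 1"
proof -
  have "A * B + P - 1 = A * (B + P * R - 1) + (A + P * Q - 1) + (- P) * (Q + R * A - 1)"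
    by (simp add: algebra_simps)
  then show ?thesis
    using assms unfolding cong_def by (simp only: add_mem mult_mem)
qed

text \<open>
  The u-equation for the blocks of lengths \<open>1\<close> and \<open>m\<close> separated by gaps of lengths \<open>p\<close> and \<open>q\<close>. The
  block of length \<open>m\<close> can be extended at either end, at the expense of a gap; the step also
  uses an equation in which the roles of gap and block are interchanged, which dictates the order
  of the inductions below.
\<close>

definition single_block :: "nat \<Rightarrow> nat \<Rightarrow> nat \<Rightarrow> bool" where
  "single_block p m q \<longleftrightarrow> (p + m + q + 1 = N \<longrightarrow> (\<forall>i.
     block_prod w i (Suc i) (Suc i + p) (Suc i + p + m)
     + block_prod w (Suc i) (Suc i + p) (Suc i + p + m) (i + N) \<approx> 1))"

lemma single_blockD:
  assumes "single_block p m q" "c = Suc i + p" "d = c + m" "d + q = i + N"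
  shows "block_prod w i (Suc i) c d + block_prod w (Suc i) c d (i + N) \<approx> 1"
  using assms by (auto simp: single_block_def)

lemma single_block_one:
  assumes "p \<ge> 1" "q \<ge> 1"
  shows "single_block p 1 q"
  unfolding single_block_def
proof (intro impI allI)
  fix i assume "p + 1 + q + 1 = N"
  then show "block_prod w i (Suc i) (Suc i + p) (Suc i + p + 1)
     + block_prod w (Suc i) (Suc i + p) (Suc i + p + 1) (i + N) \<approx> 1"
    using u_equation[of i "Suc i + p"] assms by simp
qed

lemma single_block_extend_right:
  assumes "single_block p m (Suc q)" "single_block (Suc q) p m" "p \<ge> 1" "m \<ge> 1" "q \<ge> 1"
  shows "single_block p (Suc m) q"
  unfolding single_block_def
proof (intro impI allI)
  fix i assume N: "p + Suc m + q + 1 = N"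
  define c d where "c = Suc i + p" and "d = c + m"
  have Nd: "i + N = Suc d + q" using N by (simp add: c_def d_def)
  let ?A = "block_prod w i (Suc i) c d" and ?B = "block_prod w i (Suc i) d (Suc d)"
    and ?P = "block_prod w (Suc i) c (Suc d) (i + N)" and ?Q = "block_prod w (Suc i) c d (Suc d)"
    and ?R = "block_prod w c d (Suc d) (i + N)"
  have ord: "Suc i \<le> c" "c \<le> d" "Suc d \<le> i + N" using Nd by (auto simp: c_def d_def)
  have far: "i + 2 \<le> d" "d + 2 \<le> i + N" using Nd assms(3-5) by (auto simp: c_def d_def)
  have "?A + ?P * ?Q \<approx> 1"
    using single_blockD[OF assms(1) c_def d_def] Nd ord block_prod_split_right[of d "Suc d" "i + N" w "Suc i" c]
    by (simp add: mult.commute)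
  moreover have "?B + ?P * ?R \<approx> 1"
    using u_equation[OF far] ord block_prod_split_left[of "Suc i" c d w "Suc d" "i + N"]
    by (simp add: mult.commute)
  moreover have "?Q + ?R * ?A \<approx> 1"
  proof -
    \<comment> \<open>Seen from \<open>d\<close>: the vertex \<open>d\<close> is the single block,
      the gap of length \<open>p\<close> behind \<open>i\<close> becomes the long block one turn
      later, and the old block from \<open>c\<close> to \<open>d\<close> becomes the last
      gap.\<close>
    have "block_prod w d (Suc d) (Suc i + N) (c + N) + block_prod w (Suc d) (Suc i + N) (c + N) (d + N) \<approx> 1"
      by (rule single_blockD[OF assms(2)]) (use Nd in \<open>auto simp: c_def d_def\<close>)
    also have "block_prod w d (Suc d) (Suc i + N) (c + N) = ?Q"
      by (rule block_prod_rotate)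
    also have "block_prod w (Suc d) (Suc i + N) (c + N) (d + N) = block_prod w c d (Suc d) (Suc i + N)"
      by (rule block_prod_rotate)
    also have "\<dots> = ?R * block_prod w c d (i + N) (Suc i + N)"
      using ord by (intro block_prod_split_right) auto
    also have "block_prod w c d (i + N) (Suc i + N) = ?A"
      by (rule block_prod_rotate)
    finally show ?thesis .
  qed
  ultimately have "?A * ?B + ?P \<approx> 1" by (rule u_equation_step)
  moreover have "?A * ?B = block_prod w i (Suc i) c (Suc d)"
    using ord block_prod_split_right[of c d "Suc d" w i "Suc i"] by simp
  ultimately show "block_prod w i (Suc i) (Suc i + p) (Suc i + p + Suc m)
     + block_prod w (Suc i) (Suc i + p) (Suc i + p + Suc m) (i + N) \<approx> 1"
    by (simp add: c_def d_def)
qed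

text \<open>The mirror image of \<open>single_block_extend_right\<close>: the added vertex is
  \<open>c\<close>, and in the auxiliary equation it stands alone opposite the former gap of length
  \<open>q\<close>.\<close>

lemma single_block_extend_left:
  assumes "single_block (Suc p) m q" "single_block m q (Suc p)" "p \<ge> 1" "m \<ge> 1" "q \<ge> 1"
  shows "single_block p (Suc m) q"
  unfolding single_block_def
proof (intro impI allI)
  fix i assume N: "p + Suc m + q + 1 = N"
  define c d where "c = Suc i + p" and "d = Suc c + m"
  have Nd: "i + N = d + q" using N by (simp add: c_def d_def)
  let ?A = "block_prod w i (Suc i) (Suc c) d" and ?B = "block_prod w i (Suc i) c (Suc c)"
    and ?P = "block_prod w (Suc i) c d (i + N)" and ?Q = "block_prod w c (Suc c) d (i + N)"
    and ?R = "block_prod w (Suc i) c (Suc c) d"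
  have ord: "Suc i \<le> c" "Suc c \<le> d" "d \<le> i + N" using Nd by (auto simp: c_def d_def)
  have far: "i + 2 \<le> c" "c + 2 \<le> i + N" using Nd assms(3-5) by (auto simp: c_def d_def)
  have "?A + ?P * ?Q \<approx> 1"
    using single_blockD[OF assms(1) _ d_def, of i] Nd ord block_prod_split_left[of "Suc i" c "Suc c" w d "i + N"]
    by (simp add: c_def)
  moreover have "?B + ?P * ?R \<approx> 1"
    using u_equation[OF far] ord block_prod_split_right[of "Suc c" d "i + N" w "Suc i" c]
    by (simp add: mult.commute)
  moreover have "?Q + ?R * ?A \<approx> 1"
    using single_blockD[OF assms(2) d_def, of "i + N"] Nd ord
      block_prod_split_left[of i "Suc i" c w "Suc c" d]
      block_prod_rotate[of "Suc c" d i c]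
    by (simp add: c_def mult.commute)
  ultimately have "?A * ?B + ?P \<approx> 1" by (rule u_equation_step)
  moreover have "?A * ?B = block_prod w i (Suc i) c d"
    using ord block_prod_split_right[of c "Suc c" d w i "Suc i"] by (simp add: mult.commute)
  ultimately show "block_prod w i (Suc i) (Suc i + p) (Suc i + p + Suc m)
     + block_prod w (Suc i) (Suc i + p) (Suc i + p + Suc m) (i + N) \<approx> 1"
    by (simp add: c_def d_def)
qed

lemma single_block_all: "p \<ge> 1 \<Longrightarrow> m \<ge> 1 \<Longrightarrow> q \<ge> 1 \<Longrightarrow> single_block p m q"
proof (induction m arbitrary: p q)
  case (Suc m)
  show ?case
  proof (cases "m = 0")
    case True
    then show ?thesis using single_block_one Suc.prems by simp
  next
    case False
    \<comment> \<open>The auxiliary equation for extending to the right has \<open>m\<close> as a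
      gap and \<open>p\<close> as its block, so the hypothesis on \<open>m\<close> does not apply to
      it directly. It is reached by growing the block to length \<open>p\<close> on the left; the
      auxiliary equations of these steps do have block length \<open>m\<close>.\<close>
    have "single_block s p m" if "s \<ge> 1" "p \<ge> 1" for s p
      using that
    proof (induction p arbitrary: s)
      case (Suc p)
      show ?case
      proof (cases "p = 0")
        case True
        then show ?thesis using single_block_one Suc.prems False by simp
      next
        case p: False
        then have "single_block (Suc s) p m" "single_block p m (Suc s)"
          using Suc.IH[of "Suc s"] \<open>\<And>q p. 1 \<le> p \<Longrightarrow> 1 \<le> m \<Longrightarrow> 1 \<le> q \<Longrightarrow> single_block p m q\<close> False by auto
        then show ?thesis using single_block_extend_left Suc.prems False p by simp
      qed
    qed simp
    then show ?thesis
      using single_block_extend_right[of p m q] Suc False by simp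
  qed
qed simp

text \<open>The first block grows by one vertex \<open>e\<close> at its end. Both auxiliary
  equations have \<open>e\<close> alone as one block, so \<open>single_block_all\<close> provides
  them, and the induction provides the equation for the shorter block.\<close>

theorem extended_u_equation:
  assumes "a < b" "b < c" "c < d" "d < a + N"
  shows "block_prod w a b c d + block_prod w b c d (a + N) \<approx> 1"
proof -
  obtain r where "b = Suc a + r" using less_imp_Suc_add[OF \<open>a < b\<close>] by auto
  then show ?thesis
    using assms
  proof (induction r arbitrary: b)
    case 0
    have "single_block (c - Suc a) (d - c) (a + N - d)"
      using single_block_all 0 by simp
    then show ?case
      using single_blockD[of "c - Suc a" "d - c" "a + N - d" c a d] 0 by simp
  next
    case (Suc r)
    define e where "e = Suc a + r"
    have b: "b = Suc e" and e: "a < e" "Suc e < c" using Suc.prems by (auto simp: e_def)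
    let ?A = "block_prod w a e c d" and ?B = "block_prod w e (Suc e) c d"
      and ?P = "block_prod w (Suc e) c d (a + N)" and ?Q = "block_prod w e (Suc e) d (a + N)"
      and ?R = "block_prod w a e (Suc e) c"
    have "?A + ?P * ?Q \<approx> 1"
      using Suc.IH[OF e_def] Suc.prems e block_prod_split_left[of e "Suc e" c w d "a + N"]
      by (simp add: mult.commute)
    moreover have "?B + ?P * ?R \<approx> 1"
      using single_blockD[OF single_block_all[of "c - Suc e" "d - c" "e + N - d"], of c e d] Suc.prems e
        block_prod_split_right[of d "a + N" "e + N" w "Suc e" c] block_prod_rotate[of "Suc e" c a e]
      by simp
    moreover have "?Q + ?R * ?A \<approx> 1"
      using single_blockD[OF single_block_all[of "d - Suc e" "a + N - d" "e - a"], of d e "a + N"] Suc.prems e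
        block_prod_split_right[of "Suc e" c d w a e] block_prod_rotate[of "Suc e" d a e]
      by simp
    ultimately have "?A * ?B + ?P \<approx> 1" by (rule u_equation_step)
    then show ?case
      using e block_prod_split_left[of a e "Suc e" w c d] by (simp add: b)
  qed
qed

end


text \<open>
  Homogeneous coordinates \<open>(x : y)\<close> of the vertices \<open>0, \<dots>, 2 h\<close> of a centrally symmetric
  configuration whose involution is \<open>t \<mapsto> - c / t\<close>: the vertices \<open>0\<close> and \<open>2 h\<close> are both at
  infinity (with opposite representatives), the vertex \<open>h\<close> is at \<open>0\<close> and the vertices \<open>k\<close> and
  \<open>h + k\<close> are at \<open>- P k\<close> and \<open>c / P k\<close>.
\<close>

definition vertex_x :: "nat \<Rightarrow> (nat \<Rightarrow> 'a) \<Rightarrow> 'a \<Rightarrow> nat \<Rightarrow> 'a::comm_ring_1" where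
  "vertex_x h P c k = (if k = 0 then -1 else if k < h then - P k else if k = h then 0
    else if k < 2 * h then c else 1)"

definition vertex_y :: "nat \<Rightarrow> (nat \<Rightarrow> 'a) \<Rightarrow> nat \<Rightarrow> 'a::comm_ring_1" where
  "vertex_y h P k = (if k = 0 then 0 else if k \<le> h then 1 else if k < 2 * h then P (k - h) else 0)"

text \<open>The order of the terms makes this the position of \<open>l\<close> minus that of
  \<open>k\<close>, multiplied by both denominators. The opposite signs of the two representatives
  of infinity make a determinant of either with a finite vertex, taken in increasing order, equal to
  the finite denominator.\<close>

definition vertex_det :: "nat \<Rightarrow> (nat \<Rightarrow> 'a) \<Rightarrow> 'a \<Rightarrow> nat \<Rightarrow> nat \<Rightarrow> 'a::comm_ring_1" where
  "vertex_det h P c k l = vertex_y h P k * vertex_x h P c l - vertex_x h P c k * vertex_y h P l"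

locale symmetric_u_equations = u_equations J "2 * h" w
  for J :: "'a::comm_ring_1 set" and h and w +
  assumes h_ge: "h \<ge> 2"
    and half_period: "w (i + h) (j + h) = w i j"
    and unit: "w i j dvd 1"
begin

lemma block_prod_half: "block_prod w (a + h) (b + h) (c + h) (d + h) = block_prod w a b c d"
  unfolding block_prod_def prod_nat_ivl_shift by (simp add: half_period)

lemma block_prod_unit: "block_prod w a b c d dvd 1"
proof -
  have *: "prod f A dvd 1" if "\<And>x. x \<in> A \<Longrightarrow> f x dvd (1::'a)" for f and A :: "nat set"
    using that by (induction A rule: infinite_finite_induct) (auto intro: mult_dvd_mono[of _ 1 _ 1, simplified])
  show ?thesis unfolding block_prod_def by (intro * unit)
qed

text \<open>
  In a coordinate with vertex \<open>0\<close> at infinity, \<open>gap k l\<close> is the difference of the positions of the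
  vertices \<open>l\<close> and \<open>k\<close>.
\<close>

definition gap :: "nat \<Rightarrow> nat \<Rightarrow> 'a" where
  "gap k l = block_prod w 0 k l (2 * h)"

lemma gap_zero [simp]: "gap 0 l = 1" and gap_top [simp]: "gap k (2 * h) = 1"
  by (simp_all add: gap_def)

lemma gap_unit: "gap k l dvd 1"
  by (simp add: gap_def block_prod_unit)

text \<open>The extended equation is multiplied by \<open>gap k m\<close>, which divides both
  summands: ratios of gaps are the cross ratios with the point at infinity. The factor
  \<open>w 0 (2 * h - 1)\<close>, attached to a side, occurs exactly once in each of these gaps and
  only fixes the scale of the coordinate.\<close>

lemma gap_add:
  assumes "1 \<le> k" "k < l" "l < m" "m < 2 * h"
  shows "gap k l + gap l m \<approx> gap k m"
proof -
  have "gap k l + gap l m = (block_prod w 0 k l m + block_prod w k l m (2 * h)) * gap k m"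
    using assms block_prod_split_right[of l m "2 * h" w 0 k] block_prod_split_left[of 0 k l w m "2 * h"]
    by (simp add: gap_def algebra_simps)
  also have "\<dots> \<approx> 1 * gap k m"
    using extended_u_equation[of 0 k l m] assms by (intro cong_mult) auto
  finally show ?thesis by simp
qed

lemma gap_cross_ratio:
  assumes "k < l" "l < 2 * h"
  shows "w k l * gap k l * gap (Suc k) (Suc l) = gap (Suc k) l * gap k (Suc l)"
  using assms block_prod_split_left[of 0 k "Suc k" w] block_prod_split_right[of l "Suc l" "2 * h" w k "Suc k"]
  by (simp add: gap_def mult_ac)

text \<open>With vertex \<open>h\<close> at the origin, \<open>k\<close> is at minus
  \<open>gap k h\<close> and its antipode at \<open>gap h (h + k)\<close>; a constant product is
  what makes the half turn t -> -c/t. Passing from 1 to \<open>k\<close> moves the same factor, up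
  to a half turn, from one gap to the other.\<close>

lemma gap_opposite:
  assumes "1 \<le> k" "k < h"
  shows "gap k h * gap h (h + k) = gap 1 h * gap h (h + 1)"
proof -
  have "gap k h = gap 1 h * block_prod w 1 k h (2 * h)"
    using assms block_prod_split_left[of 0 1 k w h "2 * h"] by (simp add: gap_def)
  moreover have "gap h (h + 1) = block_prod w 0 h (h + 1) (h + k) * gap h (h + k)"
    using assms block_prod_split_right[of "h + 1" "h + k" "2 * h" w 0 h] by (simp add: gap_def)
  moreover have "block_prod w 0 h (h + 1) (h + k) = block_prod w 1 k h (2 * h)"
    using block_prod_half[of 0 h "h + 1" "h + k"] block_prod_rotate[of h "2 * h" 1 k]
      block_prod_symm[of h "2 * h" 1 k]
    by (simp add: mult_2 add_ac)
  ultimately show ?thesis by (simp add: mult_ac)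
qed

abbreviation param :: "nat \<Rightarrow> 'a" where
  "param k \<equiv> gap k h"

abbreviation modulus :: 'a where
  "modulus \<equiv> gap 1 h * gap h (h + 1)"

text \<open>The denominator of the position. At infinity \<open>vertex_y\<close> is 0, but there the
  determinant consists of the other denominator alone, which calls for the weight 1.\<close>

definition weight :: "nat \<Rightarrow> 'a" where
  "weight k = (if k = 0 \<or> k = 2 * h then 1 else vertex_y h param k)"

lemma weight_unit: "k \<le> 2 * h \<Longrightarrow> weight k dvd 1"
  by (auto simp: weight_def vertex_y_def gap_unit)

text \<open>For two finite vertices the difference of positions is a gap by \<open>gap_add\<close>,
  applied relative to the origin \<open>h\<close>. For a vertex beyond \<open>h\<close>,
  \<open>gap_opposite\<close> rewrites \<open>modulus\<close> as its denominator times its position.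
  The excluded pair consists of the two representatives of infinity.\<close>

lemma vertex_det_cong:
  assumes "k < l" "l \<le> 2 * h" "(k, l) \<noteq> (0, 2 * h)"
  shows "vertex_det h param modulus k l \<approx> weight k * weight l * gap k l"
proof -
  note defs = vertex_det_def vertex_x_def vertex_y_def weight_def
  have opp: "modulus = gap m h * gap h (h + m)" if "1 \<le> m" "m < h" for m
    using gap_opposite[OF that] by simp
  consider "l < h" | "l = h" | "h < l" "l < 2 * h" | "l = 2 * h" using assms(2) by linarith
  then consider "k = 0" "l < 2 * h" | "1 \<le> k" "l = 2 * h" | "1 \<le> k" "l < h"
    | "1 \<le> k" "k < h" "l = h" | "1 \<le> k" "k < h" "h < l" "l < 2 * h"
    | "k = h" "h < l" "l < 2 * h" | "h < k" "l < 2 * h"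
  proof cases
    case 1
    then show ?thesis using that(1,3) by (cases "k = 0") auto
  next
    case 2
    then show ?thesis using that(1,4) assms(1) h_ge by (cases "k = 0") auto
  next
    case 3
    then show ?thesis using that(1,5-7) by (cases "k = 0"; cases k h rule: linorder_cases) auto
  next
    case 4
    then show ?thesis using that(2) assms(3) by (cases "k = 0") auto
  qed
  then show ?thesis
  proof cases
    case 1
    then show ?thesis using assms by (simp add: defs)
  next
    case 2
    then show ?thesis using assms by (simp add: defs)
  next
    case 3
    then show ?thesis
      using assms cong_diff[OF gap_add[of k l h] cong_refl[of "gap l h"]]
      by (simp add: defs cong_sym)
  next
    case 4
    then show ?thesis using assms by (simp add: defs)
  next
    case 5
    define m where "m = l - h"
    have 5: "1 \<le> k" "k < h" "l = h + m" "1 \<le> m" "m < h" using 5 by (auto simp: m_def)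
    have "vertex_det h param modulus k l = gap m h * (gap k h + gap h (h + m))"
      using 5 h_ge opp[of m] by (simp add: defs algebra_simps)
    also have "\<dots> \<approx> gap m h * gap k (h + m)"
      using 5 by (intro cong_mult gap_add) auto
    also have "gap m h * gap k (h + m) = weight k * weight l * gap k l"
      using 5 by (simp add: defs)
    finally show ?thesis .
  next
    case 6
    define m where "m = l - h"
    have "k = h" "l = h + m" "1 \<le> m" "m < h" using 6 by (auto simp: m_def)
    then show ?thesis using opp[of m] h_ge by (simp add: defs)
  next
    case 7
    define i m where "i = k - h" and "m = l - h"
    have 7: "k = h + i" "l = h + m" "1 \<le> i" "i < m" "m < h" using 7 assms by (auto simp: i_def m_def)
    have "vertex_det h param modulus k l = gap i h * (gap m h * gap h (h + m)) - (gap i h * gap h (h + i)) * gap m h"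
      using 7 h_ge opp[of m] opp[of i] by (simp add: defs)
    also have "\<dots> = gap i h * gap m h * (gap h (h + m) - gap h (h + i))"
      by (simp add: algebra_simps)
    also have "\<dots> \<approx> gap i h * gap m h * gap k l"
      using 7 cong_diff[OF gap_add[of h k l] cong_refl[of "gap h k"]] h_ge
      by (intro cong_mult) (simp_all add: cong_sym)
    also have "\<dots> = weight k * weight l * gap k l"
      using 7 by (simp add: defs)
    finally show ?thesis .
  qed
qed

lemma vertex_det_unit:
  assumes "k < l" "l \<le> 2 * h" "(k, l) \<noteq> (0, 2 * h)"
  shows "\<exists>v. v * vertex_det h param modulus k l \<approx> 1"
proof -
  have "weight k * weight l * gap k l dvd 1"
    using mult_dvd_mono[OF mult_dvd_mono[OF weight_unit[of k] weight_unit[of l]] gap_unit, of k l] assms by simp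
  then obtain v where "1 = v * (weight k * weight l * gap k l)" by (metis dvdE mult.commute)
  then show ?thesis
    using cong_mult[OF cong_refl[of v] vertex_det_cong[OF assms]] by metis
qed

text \<open>Each of the four vertices occurs once on either side, so the weights agree and the exact
  identity \<open>gap_cross_ratio\<close> remains. The third hypothesis excludes
  \<open>k = 0\<close> with \<open>l = 2 * h - 1\<close>, where \<open>k\<close> and
  \<open>Suc l\<close> are the same point at infinity.\<close>

lemma vertex_det_cross_ratio:
  assumes "k + 2 \<le> l" "l < 2 * h" "k = 0 \<Longrightarrow> l + 2 \<le> 2 * h"
  shows "w k l * (vertex_det h param modulus k l * vertex_det h param modulus (Suc k) (Suc l))
    \<approx> vertex_det h param modulus (Suc k) l * vertex_det h param modulus k (Suc l)"
proof -
  let ?W = "weight k * weight l * weight (Suc k) * weight (Suc l)"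
  have "w k l * (vertex_det h param modulus k l * vertex_det h param modulus (Suc k) (Suc l))
      \<approx> w k l * (weight k * weight l * gap k l * (weight (Suc k) * weight (Suc l) * gap (Suc k) (Suc l)))"
    using assms by (intro cong_mult vertex_det_cong cong_refl) auto
  also have "\<dots> = ?W * (w k l * gap k l * gap (Suc k) (Suc l))"
    by (simp add: mult_ac)
  also have "\<dots> = ?W * (gap (Suc k) l * gap k (Suc l))"
    using assms by (simp add: gap_cross_ratio)
  also have "\<dots> = (weight (Suc k) * weight l * gap (Suc k) l) * (weight k * weight (Suc l) * gap k (Suc l))"
    by (simp add: mult_ac)
  also have "\<dots> \<approx> vertex_det h param modulus (Suc k) l * vertex_det h param modulus k (Suc l)"
    using assms by (intro cong_mult cong_sym[OF vertex_det_cong]) auto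
  finally show ?thesis .
qed

end

section \<open>Diagonals of the polygon\<close>

definition vertex :: "nat \<Rightarrow> nat \<Rightarrow> nat" where
  "vertex h k = (if k mod (2 * h) = 0 then 2 * h else k mod (2 * h))"

definition antipode :: "nat \<Rightarrow> nat \<Rightarrow> nat" where
  "antipode h k = (if k \<le> h then h + k else k - h)"

definition diagonals :: "nat \<Rightarrow> nat set set" where
  "diagonals h = {{k, l} | k l. 1 \<le> k \<and> k + 2 \<le> l \<and> l \<le> 2 * h \<and> l + 2 \<le> k + 2 * h}"

definition symm_class :: "nat \<Rightarrow> nat set \<Rightarrow> nat set set" where
  "symm_class h d = {d, antipode h ` d}"

definition diag_class :: "nat \<Rightarrow> nat \<Rightarrow> nat \<Rightarrow> nat set set" where
  "diag_class h i j = symm_class h {vertex h i, vertex h j}"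

lemma vertex_period [simp]: "vertex h (i + 2 * h) = vertex h i"
  by (simp add: vertex_def)

lemma vertex_range: "h \<ge> 1 \<Longrightarrow> 1 \<le> vertex h k \<and> vertex h k \<le> 2 * h"
  by (auto simp: vertex_def intro: less_imp_le)

lemma vertex_id [simp]: "1 \<le> k \<Longrightarrow> k \<le> 2 * h \<Longrightarrow> vertex h k = k"
  by (cases "k = 2 * h") (auto simp: vertex_def)

lemma vertex_minus: "2 * h < k \<Longrightarrow> k \<le> 4 * h \<Longrightarrow> vertex h k = k - 2 * h"
  using vertex_period[of h "k - 2 * h"] vertex_id[of "k - 2 * h" h] by simp

lemma vertex_half:
  assumes "h \<ge> 1"
  shows "vertex h (k + h) = antipode h (vertex h k)"
proof -
  have "vertex h (k + h) = vertex h (vertex h k + h)"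
  proof -
    have "vertex h k mod (2 * h) = k mod (2 * h)" by (simp add: vertex_def)
    then have "(k + h) mod (2 * h) = (vertex h k + h) mod (2 * h)" by (intro mod_add_cong) simp_all
    then show ?thesis unfolding vertex_def[of h "k + h"] vertex_def[of h "vertex h k + h"] by simp
  qed
  moreover have "vertex h (vertex h k + h) = antipode h (vertex h k)"
    using vertex_range[OF assms, of k] vertex_minus[of h "vertex h k + h"]
    by (cases "vertex h k \<le> h") (auto simp: antipode_def)
  ultimately show ?thesis by simp
qed

lemma antipode_antipode: "1 \<le> k \<Longrightarrow> k \<le> 2 * h \<Longrightarrow> antipode h (antipode h k) = k"
  by (auto simp: antipode_def)

lemma antipode_range: "k \<in> {1..2 * h} \<Longrightarrow> antipode h k \<in> {1..2 * h}"
  by (auto simp: antipode_def)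

lemma symm_class_antipode:
  assumes "d \<subseteq> {1..2 * h}"
  shows "symm_class h (antipode h ` d) = symm_class h d"
proof -
  have "(\<lambda>x. antipode h (antipode h x)) ` d = id ` d"
    using assms by (intro image_cong) (auto simp: antipode_antipode)
  then show ?thesis
    by (auto simp: symm_class_def image_image)
qed

lemma diagonals_range: "d \<in> diagonals h \<Longrightarrow> d \<subseteq> {1..2 * h}"
  by (auto simp: diagonals_def)

lemma symm_class_eq:
  assumes "d' \<in> diagonals h" "d \<in> symm_class h d'"
  shows "symm_class h d' = symm_class h d"
proof -
  have "d = d' \<or> d = antipode h ` d'" using assms(2) by (simp add: symm_class_def)
  then show ?thesis using symm_class_antipode[OF diagonals_range[OF assms(1)]] by metis
qed

lemma Pi_C_intros:
  "1 \<le> i \<Longrightarrow> i \<le> n + 1 \<Longrightarrow> long_diag n i \<in> Pi_C n"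
  "1 \<le> i \<Longrightarrow> i + 1 < j \<Longrightarrow> j \<le> n + 1 \<Longrightarrow> unbarred_pair n i j \<in> Pi_C n"
  "1 \<le> i \<Longrightarrow> i < j \<Longrightarrow> j \<le> n + 1 \<Longrightarrow> (i, j) \<noteq> (1, n + 1) \<Longrightarrow> barred_pair n i j \<in> Pi_C n"
  unfolding Pi_C_def by blast+

text \<open>The three families are the orbits of genuine diagonals under the half turn, told apart
  by which endpoints are barred. The pair (1, n+1) left out of the barred family is the side from 1
  to \<open>2 * h\<close>, which \<open>diagonals\<close> excludes by
  \<open>l + 2 \<le> k + 2 * h\<close>.\<close>

lemma Pi_C_eq:
  assumes "n \<ge> 1"
  shows "Pi_C n = symm_class (n + 1) ` diagonals (n + 1)"
proof (intro equalityI subsetI)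
  fix \<gamma> assume "\<gamma> \<in> Pi_C n"
  then consider i where "1 \<le> i" "i \<le> n + 1" "\<gamma> = long_diag n i"
    | i j where "1 \<le> i" "i + 1 < j" "j \<le> n + 1" "\<gamma> = unbarred_pair n i j"
    | i j where "1 \<le> i" "i < j" "j \<le> n + 1" "(i, j) \<noteq> (1, n + 1)" "\<gamma> = barred_pair n i j"
    unfolding Pi_C_def by blast
  then show "\<gamma> \<in> symm_class (n + 1) ` diagonals (n + 1)"
  proof cases
    case (1 i)
    then have "\<gamma> = symm_class (n + 1) {i, n + 1 + i}"
      by (auto simp: long_diag_def symm_class_def bar_def antipode_def)
    moreover have "{i, n + 1 + i} \<in> diagonals (n + 1)"
      unfolding diagonals_def using 1 assms by (intro CollectI exI[of _ i] exI[of _ "n + 1 + i"]) auto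
    ultimately show ?thesis by blast
  next
    case (2 i j)
    then have "\<gamma> = symm_class (n + 1) {i, j}"
      by (auto simp: unbarred_pair_def symm_class_def bar_def antipode_def)
    moreover have "{i, j} \<in> diagonals (n + 1)"
      unfolding diagonals_def using 2 assms by (intro CollectI exI[of _ i] exI[of _ j]) auto
    ultimately show ?thesis by blast
  next
    case (3 i j)
    then have "\<gamma> = symm_class (n + 1) {i, n + 1 + j}"
      by (auto simp: barred_pair_def symm_class_def bar_def antipode_def insert_commute)
    moreover have "{i, n + 1 + j} \<in> diagonals (n + 1)"
      unfolding diagonals_def using 3 assms by (intro CollectI exI[of _ i] exI[of _ "n + 1 + j"]) auto
    ultimately show ?thesis by blast
  qed
next
  fix \<gamma> assume "\<gamma> \<in> symm_class (n + 1) ` diagonals (n + 1)"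
  then obtain k l where kl: "1 \<le> k" "k + 2 \<le> l" "l \<le> 2 * (n + 1)" "l + 2 \<le> k + 2 * (n + 1)"
    and \<gamma>: "\<gamma> = symm_class (n + 1) {k, l}" unfolding diagonals_def by blast
  consider "l \<le> n + 1" | j where "k \<le> n + 1" "l = n + 1 + j" "k = j" "1 \<le> j"
    | j where "k \<le> n + 1" "l = n + 1 + j" "k < j" | j where "k \<le> n + 1" "l = n + 1 + j" "j < k" "1 \<le> j"
    | i j where "k = n + 1 + i" "l = n + 1 + j" "1 \<le> i"
  proof (cases "l \<le> n + 1")
    case l: False
    define j where "j = l - (n + 1)"
    then have j: "l = n + 1 + j" "1 \<le> j" using l by auto
    show ?thesis
    proof (cases "k \<le> n + 1")
      case True
      then show ?thesis using that(2-4)[of j] j by linarith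
    next
      case False
      then show ?thesis using that(5)[of "k - (n + 1)" j] j by simp
    qed
  qed (rule that(1))
  then show "\<gamma> \<in> Pi_C n"
  proof cases
    case 1
    then have "\<gamma> = unbarred_pair n k l"
      using kl by (auto simp: \<gamma> unbarred_pair_def symm_class_def bar_def antipode_def)
    then show ?thesis using kl 1 by (simp add: Pi_C_intros(2))
  next
    case (2 j)
    then have "\<gamma> = long_diag n k"
      using kl by (auto simp: \<gamma> long_diag_def symm_class_def bar_def antipode_def)
    then show ?thesis using kl 2 by (simp add: Pi_C_intros(1))
  next
    case (3 j)
    then have "\<gamma> = barred_pair n k j"
      using kl by (auto simp: \<gamma> barred_pair_def symm_class_def bar_def antipode_def insert_commute)
    moreover have "(k, j) \<noteq> (1, n + 1)" using kl 3 by auto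
    ultimately show ?thesis using kl 3 by (simp add: Pi_C_intros(3))
  next
    case (4 j)
    then have "\<gamma> = barred_pair n j k"
      using kl by (auto simp: \<gamma> barred_pair_def symm_class_def bar_def antipode_def insert_commute)
    moreover have "(j, k) \<noteq> (1, n + 1)" using kl 4 by auto
    ultimately show ?thesis using kl 4 by (simp add: Pi_C_intros(3))
  next
    case (5 i j)
    then have "\<gamma> = unbarred_pair n i j"
      using kl by (auto simp: \<gamma> unbarred_pair_def symm_class_def bar_def antipode_def)
    then show ?thesis using kl 5 by (simp add: Pi_C_intros(2))
  qed
qed

lemma finite_diagonals: "finite (diagonals h)"
  by (rule finite_subset[of _ "Pow {1..2 * h}"]) (use diagonals_range in auto)

lemma polygon_function_class:
  assumes "h \<ge> 1"
  shows "polygon_function (2 * h) (\<lambda>i j. W (diag_class h i j))"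
    and "diag_class h (i + h) (j + h) = diag_class h i j"
proof -
  show "polygon_function (2 * h) (\<lambda>i j. W (diag_class h i j))"
    by unfold_locales (simp_all add: diag_class_def insert_commute)
  have "{vertex h (i + h), vertex h (j + h)} = antipode h ` {vertex h i, vertex h j}"
    using vertex_half[OF assms] by simp
  then show "diag_class h (i + h) (j + h) = diag_class h i j"
    using symm_class_antipode[of "{vertex h i, vertex h j}" h] vertex_range[OF assms]
    by (simp add: diag_class_def)
qed

text \<open>Index pairs may start at 0 or run past \<open>2 * h\<close>. When one endpoint wraps,
  the two arcs beside the diagonal change places, which does not alter the block product.\<close>

lemma diagonal_normal_form:
  assumes "i < j" "j < i + 2 * h" "h \<ge> 1"
  obtains a b where "1 \<le> a" "a < b" "b \<le> 2 * h" "{vertex h i, vertex h j} = {a, b}"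
    "\<And>w :: nat \<Rightarrow> nat \<Rightarrow> 'a::comm_monoid_mult. polygon_function (2 * h) w \<Longrightarrow>
      block_prod w (Suc i) j (Suc j) (i + 2 * h) = block_prod w (Suc a) b (Suc b) (a + 2 * h)"
    "i + 2 \<le> j \<Longrightarrow> j + 2 \<le> i + 2 * h \<Longrightarrow> a + 2 \<le> b \<and> b + 2 \<le> a + 2 * h"
  using assms
proof (induction i arbitrary: j thesis rule: less_induct)
  case (less i)
  consider "i = 0" | "1 \<le> i" "j \<le> 2 * h" | "1 \<le> i" "i \<le> 2 * h" "2 * h < j" | "2 * h < i" by linarith
  then show ?case
  proof cases
    case 1
    have "block_prod w (Suc i) j (Suc j) (i + 2 * h) = block_prod w (Suc j) (2 * h) (Suc (2 * h)) (j + 2 * h)"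
      if "polygon_function (2 * h) w" for w :: "nat \<Rightarrow> nat \<Rightarrow> 'a"
      using 1 polygon_function.block_prod_rotate[OF that, of "Suc j" "2 * h" "1" j] by simp
    moreover have "{vertex h i, vertex h j} = {j, 2 * h}"
      using 1 less.prems by (auto simp: vertex_def)
    ultimately show ?thesis using less.prems 1 by (intro less.prems(1)[of j "2 * h"]) auto
  next
    case 2
    then show ?thesis using less.prems by (intro less.prems(1)[of i j]) auto
  next
    case 3
    define b where "b = j - 2 * h"
    have b: "j = b + 2 * h" "1 \<le> b" "b < i" using 3 less.prems by (auto simp: b_def)
    have "block_prod w (Suc i) j (Suc j) (i + 2 * h) = block_prod w (Suc b) i (Suc i) (b + 2 * h)"
      if "polygon_function (2 * h) w" for w :: "nat \<Rightarrow> nat \<Rightarrow> 'a"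
      using b polygon_function.block_prod_rotate[OF that, of "Suc i" j "Suc b" i] by simp
    moreover have "{vertex h i, vertex h j} = {b, i}"
      using b 3 less.prems by auto
    ultimately show ?thesis using less.prems 3 b by (intro less.prems(1)[of b i]) auto
  next
    case 4
    define i' j' where "i' = i - 2 * h" and "j' = j - 2 * h"
    have *: "i = i' + 2 * h" "j = j' + 2 * h" "i' < i"
      using 4 less.prems by (auto simp: i'_def j'_def)
    have eq: "block_prod w (Suc i) j (Suc j) (i + 2 * h) = block_prod w (Suc i') j' (Suc j') (i' + 2 * h)"
      if "polygon_function (2 * h) w" for w :: "nat \<Rightarrow> nat \<Rightarrow> 'a"
    proof -
      interpret polygon_function "2 * h" w by fact
      show ?thesis
        using * block_prod_period[of "Suc i'" j' "Suc j + 0" "i + 2 * h"]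
          block_prod_rotate[of "Suc i'" j' "Suc j'" "i' + 2 * h"] block_prod_symm by simp
    qed
    show ?thesis
      by (rule less.IH[of i' j']) (use * less.prems eq in auto)
  qed
qed

lemma diag_class_in:
  assumes "i + 2 \<le> j" "j + 2 \<le> i + 2 * h" "h \<ge> 1"
  shows "diag_class h i j \<in> symm_class h ` diagonals h"
proof -
  obtain a b where ab: "1 \<le> a" "a < b" "b \<le> 2 * h" "{vertex h i, vertex h j} = {a, b}"
    "a + 2 \<le> b \<and> b + 2 \<le> a + 2 * h"
    by (rule diagonal_normal_form[of i j h]) (use assms in auto)
  then show ?thesis unfolding diag_class_def diagonals_def by auto
qed

text \<open>The vertex \<open>2 * h\<close> is represented by 0 here, which keeps
  \<open>Suc l\<close> within the chart with vertices 0 to \<open>2 * h\<close> used for the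
  determinants.\<close>

lemma diag_class_cases:
  assumes "\<gamma> \<in> symm_class h ` diagonals h"
  obtains k l where "k + 2 \<le> l" "l < 2 * h" "l + 2 \<le> k + 2 * h" "\<gamma> = diag_class h k l"
proof -
  obtain k l where kl: "1 \<le> k" "k + 2 \<le> l" "l \<le> 2 * h" "l + 2 \<le> k + 2 * h" "\<gamma> = symm_class h {k, l}"
    using assms unfolding diagonals_def by blast
  show thesis
  proof (cases "l = 2 * h")
    case True
    then have "\<gamma> = diag_class h 0 k"
      using kl by (auto simp: diag_class_def vertex_def insert_commute)
    then show ?thesis using True kl by (intro that[of 0 k]) auto
  next
    case False
    then show ?thesis using kl by (intro that[of k l]) (auto simp: diag_class_def)
  qed
qed

text \<open>The chord from \<open>a\<close> to \<open>b\<close> leaves two arcs. The arc through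
  \<open>2 * h\<close> is unfolded to an interval ending below \<open>a + 2 * h\<close>, so that the
  crossing diagonals are the pairs with one index from each interval, as in a block product.\<close>

lemma crossing_diagonals:
  assumes "1 \<le> a" "a < b" "b \<le> 2 * h"
  shows "bij_betw (\<lambda>(k, l). {k, vertex h l}) ({Suc a..<b} \<times> {Suc b..<a + 2 * h})
    {d \<in> diagonals h. crosses d {a, b}}"
proof -
  have v: "vertex h l = (if l \<le> 2 * h then l else l - 2 * h)" if "l \<in> {Suc b..<a + 2 * h}" for l
    using that assms vertex_minus[of h l] by auto
  have out: "vertex h l \<in> {1..<a} \<union> {Suc b..2 * h}" if "l \<in> {Suc b..<a + 2 * h}" for l
    using that assms by (auto simp: v[OF that])
  have sep: "(k, l) = (k', l')"
    if k: "k \<in> {Suc a..<b}" "l \<in> {Suc b..<a + 2 * h}" "k' \<in> {Suc a..<b}" "l' \<in> {Suc b..<a + 2 * h}"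
      and eq: "{k, vertex h l} = {k', vertex h l'}" for k l k' l'
  proof -
    have "k = k' \<and> vertex h l = vertex h l'"
      using eq out[OF k(2)] out[OF k(4)] k by (auto simp: doubleton_eq_iff)
    then show ?thesis using k assms by (auto simp: v split: if_splits)
  qed
  have crossing: "{k, vertex h l} \<in> diagonals h \<and> crosses {k, vertex h l} {a, b}"
    if kl: "k \<in> {Suc a..<b}" "l \<in> {Suc b..<a + 2 * h}" for k l
  proof (cases "vertex h l < a")
    case True
    let ?m = "vertex h l"
    have "{?m, k} \<in> diagonals h"
      unfolding diagonals_def using True kl out[OF kl(2)] assms
      by (intro CollectI exI[of _ ?m] exI[of _ k]) auto
    moreover have "crosses {?m, k} {a, b}"
      unfolding crosses_def using True kl by (intro exI[of _ ?m] exI[of _ a] exI[of _ k] exI[of _ b]) auto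
    ultimately show ?thesis by (simp add: insert_commute)
  next
    case False
    let ?m = "vertex h l"
    have "?m \<in> {Suc b..2 * h}" using False out[OF kl(2)] by auto
    moreover from this have "{k, ?m} \<in> diagonals h"
      unfolding diagonals_def using kl assms
      by (intro CollectI exI[of _ k] exI[of _ ?m]) auto
    moreover have "crosses {k, ?m} {a, b}" if "?m \<in> {Suc b..2 * h}"
      unfolding crosses_def using that kl
      by (intro exI[of _ a] exI[of _ k] exI[of _ b] exI[of _ ?m]) auto
    ultimately show ?thesis by simp
  qed
  have onto: "d \<in> (\<lambda>(k, l). {k, vertex h l}) ` ({Suc a..<b} \<times> {Suc b..<a + 2 * h})"
    if d: "d \<in> diagonals h" "crosses d {a, b}" for d
  proof -
    obtain p q r s where pq: "p < q" "q < r" "r < s" "{d, {a, b}} = {{p, r}, {q, s}}"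
      using d unfolding crosses_def by blast
    then consider "d = {p, r}" "{a, b} = {q, s}" | "d = {q, s}" "{a, b} = {p, r}"
      unfolding doubleton_eq_iff[of d] by blast
    then show ?thesis
    proof cases
      case 1
      then have ab: "a = q" "b = s" using assms pq(1-3) unfolding doubleton_eq_iff by auto
      have "1 \<le> p" using 1 diagonals_range[OF d(1)] by auto
      then show ?thesis
        using 1(1) ab pq(1-3) assms
        by (intro image_eqI[where x = "(r, p + 2 * h)"]) (simp_all add: insert_commute)
    next
      case 2
      then have ab: "a = p" "b = r" using assms pq(1-3) unfolding doubleton_eq_iff by auto
      have "s \<le> 2 * h" using 2 diagonals_range[OF d(1)] by auto
      then show ?thesis
        using 2(1) ab pq(1-3) assms by (intro image_eqI[where x = "(q, s)"]) simp_all
    qed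
  qed
  show ?thesis
  proof (intro bij_betw_imageI inj_onI equalityI subsetI)
    fix x y
    assume "x \<in> {Suc a..<b} \<times> {Suc b..<a + 2 * h}" "y \<in> {Suc a..<b} \<times> {Suc b..<a + 2 * h}"
      "(case x of (k, l) \<Rightarrow> {k, vertex h l}) = (case y of (k, l) \<Rightarrow> {k, vertex h l})"
    then show "x = y"
      using sep[of "fst x" "snd x" "fst y" "snd y"] by (simp add: case_prod_beta mem_Times_iff prod_eq_iff)
  next
    fix d
    assume "d \<in> (\<lambda>(k, l). {k, vertex h l}) ` ({Suc a..<b} \<times> {Suc b..<a + 2 * h})"
    then obtain k l where "k \<in> {Suc a..<b}" "l \<in> {Suc b..<a + 2 * h}" "d = {k, vertex h l}"
      by blast
    then show "d \<in> {d \<in> diagonals h. crosses d {a, b}}" using crossing by simp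
  next
    fix d assume "d \<in> {d \<in> diagonals h. crosses d {a, b}}"
    then show "d \<in> (\<lambda>(k, l). {k, vertex h l}) ` ({Suc a..<b} \<times> {Suc b..<a + 2 * h})"
      using onto by simp
  qed
qed

text \<open>\<open>compat_degree\<close> counts the members of a class that cross one fixed
  diagonal; the power of \<open>W\<close> is thus a product over these members, and the product over
  all classes collects every crossing diagonal once.\<close>

lemma prod_compat_degree:
  fixes W :: "nat set set \<Rightarrow> 'a::comm_monoid_mult"
  assumes n: "n \<ge> 1" and h: "h = n + 1" and ij: "i + 2 \<le> j" "j + 2 \<le> i + 2 * h"
  shows "(\<Prod>\<omega>\<in>Pi_C n. W \<omega> ^ compat_degree \<omega> (diag_class h i j))
    = block_prod (\<lambda>k l. W (diag_class h k l)) (Suc i) j (Suc j) (i + 2 * h)"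
proof -
  define w where "w = (\<lambda>k l. W (diag_class h k l))"
  define e where "e = (SOME e. e \<in> diag_class h i j)"
  interpret polygon_function "2 * h" w
    unfolding w_def by (rule polygon_function_class) (simp add: h)
  have "e \<in> diag_class h i j"
    unfolding e_def by (rule someI[of _ "{vertex h i, vertex h j}"]) (simp add: diag_class_def symm_class_def)
  \<comment> \<open>The representative picked by \<open>SOME\<close> is one of two antipodal
    diagonals; a half turn carries the block product of one to that of the other.\<close>
  then consider "e = {vertex h i, vertex h j}" | "e = {vertex h (i + h), vertex h (j + h)}"
    using vertex_half[of h] h by (auto simp: diag_class_def symm_class_def)
  then obtain i' j' where e: "e = {vertex h i', vertex h j'}" "i' < j'" "j' < i' + 2 * h"
    and eq: "block_prod w (Suc i) j (Suc j) (i + 2 * h) = block_prod w (Suc i') j' (Suc j') (i' + 2 * h)"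
  proof cases
    case 1
    then show ?thesis using that ij by simp
  next
    case 2
    have "block_prod w (Suc i + h) (j + h) (Suc j + h) (i + 2 * h + h) = block_prod w (Suc i) j (Suc j) (i + 2 * h)"
      unfolding block_prod_def prod_nat_ivl_shift w_def
      by (subst polygon_function_class(2)) (simp_all add: h)
    then show ?thesis using that[OF 2] ij by (simp add: add_ac)
  qed
  obtain a b where ab: "1 \<le> a" "a < b" "b \<le> 2 * h" "e = {a, b}"
    and eq': "block_prod w (Suc i') j' (Suc j') (i' + 2 * h) = block_prod w (Suc a) b (Suc b) (a + 2 * h)"
    by (rule diagonal_normal_form[of i' j' h]) (use e h polygon_function_axioms in auto)
  let ?D = "diagonals h"
  have Pi: "Pi_C n = symm_class h ` ?D" using Pi_C_eq[OF n] h by simp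
  have card: "{d \<in> \<omega>. crosses d e} = {d \<in> {d \<in> ?D. crosses d e}. symm_class h d = \<omega>}" if \<omega>: "\<omega> \<in> Pi_C n" for \<omega>
  proof -
    obtain d' where d': "d' \<in> ?D" "\<omega> = symm_class h d'" using \<omega> unfolding Pi by blast
    have mem: "d \<in> \<omega> \<longleftrightarrow> symm_class h d = \<omega>" for d
    proof
      show "symm_class h d = \<omega>" if "d \<in> \<omega>"
        using symm_class_eq[OF d'(1)] that d'(2) by simp
      show "d \<in> \<omega>" if "symm_class h d = \<omega>"
        unfolding that[symmetric] symm_class_def by simp
    qed
    \<comment> \<open>Crossing \<open>e\<close> puts a vertex on either arc between the endpoints of
      \<open>d\<close>, so these are not adjacent and \<open>d\<close> is a genuine
      diagonal.\<close>
    have diag: "d \<in> ?D" if d: "crosses d e" "d \<in> \<omega>" for d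
    proof -
      have range: "d \<subseteq> {1..2 * h}"
      proof -
        have "d = d' \<or> d = antipode h ` d'" using d(2) d'(2) by (simp add: symm_class_def)
        then show ?thesis using diagonals_range[OF d'(1)] antipode_range[of _ h] by blast
      qed
      obtain p q r s where pq: "p < q" "q < r" "r < s" "{d, e} = {{p, r}, {q, s}}"
        using d(1) unfolding crosses_def by blast
      then consider "d = {p, r}" "e = {q, s}" | "d = {q, s}" "e = {p, r}"
        unfolding doubleton_eq_iff by blast
      then show ?thesis
      proof cases
        case 1
        have "s \<in> {a, b}" using 1(2) ab(4) by simp
        then have "s \<le> 2 * h" using ab(1-3) by auto
        moreover have "1 \<le> p" using range 1(1) by simp
        ultimately show ?thesis
          unfolding diagonals_def using pq(1-3) 1(1) by (intro CollectI exI[of _ p] exI[of _ r]) simp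
      next
        case 2
        have "p \<in> {a, b}" using 2(2) ab(4) by simp
        then have "1 \<le> p" using ab(1-3) by auto
        moreover have "s \<le> 2 * h" using range 2(1) by simp
        ultimately show ?thesis
          unfolding diagonals_def using pq(1-3) 2(1) by (intro CollectI exI[of _ q] exI[of _ s]) simp
      qed
    qed
    show ?thesis
    proof (intro Collect_cong)
      fix d
      show "(d \<in> \<omega> \<and> crosses d e) = (d \<in> {d \<in> ?D. crosses d e} \<and> symm_class h d = \<omega>)"
        using mem[of d] diag[of d] by simp blast
    qed
  qed
  have "(\<Prod>\<omega>\<in>Pi_C n. W \<omega> ^ compat_degree \<omega> (diag_class h i j))
      = (\<Prod>\<omega>\<in>Pi_C n. \<Prod>d\<in>{d \<in> {d \<in> ?D. crosses d e}. symm_class h d = \<omega>}. W (symm_class h d))"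
    unfolding compat_degree_def e_def[symmetric] using card by (intro prod.cong refl) simp
  also have "\<dots> = (\<Prod>d\<in>{d \<in> ?D. crosses d e}. W (symm_class h d))"
  proof (rule prod.group)
    show "symm_class h ` {d \<in> ?D. crosses d e} \<subseteq> Pi_C n" unfolding Pi by (rule image_mono) simp
  qed (simp_all add: finite_diagonals Pi)
  also have "\<dots> = (\<Prod>p\<in>{Suc a..<b} \<times> {Suc b..<a + 2 * h}.
      W (symm_class h ((\<lambda>(k, l). {k, vertex h l}) p)))"
    unfolding ab(4) by (rule prod.reindex_bij_betw[OF crossing_diagonals[OF ab(1-3)], symmetric])
  also have "\<dots> = (\<Prod>(k, l)\<in>{Suc a..<b} \<times> {Suc b..<a + 2 * h}. w k l)"
    using ab(1-3) by (intro prod.cong refl) (auto simp: diag_class_def w_def)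
  also have "\<dots> = block_prod w (Suc a) b (Suc b) (a + 2 * h)"
    unfolding block_prod_def by (rule prod.cartesian_product[symmetric])
  finally show ?thesis unfolding w_def[symmetric] eq eq' .
qed

section \<open>Cross ratios of centrally symmetric points\<close>

lemma vertex_eq_iff: "h \<ge> 1 \<Longrightarrow> vertex h i = vertex h j \<longleftrightarrow> i mod (2 * h) = j mod (2 * h)"
proof -
  assume "h \<ge> 1"
  then have "k mod (2 * h) \<noteq> 2 * h" for k
    using mod_less_divisor[of "2 * h" k] by (intro less_imp_neq) simp
  from this[of i] this[of j] show ?thesis by (auto simp: vertex_def)
qed

lemma vertex_neq:
  assumes "i < j" "j < i + 2 * h" "h \<ge> 1"
  shows "vertex h i \<noteq> vertex h j"
proof
  assume "vertex h i = vertex h j"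
  then have "2 * h dvd j - i"
    using assms mod_eq_dvd_iff_nat[of i j "2 * h"] by (simp add: vertex_eq_iff)
  then show False using assms by (auto dest!: dvd_imp_le)
qed

definition represents :: "nat \<Rightarrow> nat \<Rightarrow> nat \<Rightarrow> nat set set \<Rightarrow> bool" where
  "represents h i j \<gamma> \<longleftrightarrow> i + 2 \<le> j \<and> j + 2 \<le> i + 2 * h \<and> \<gamma> = diag_class h i j"

text \<open>
  A function of pairs of vertices that is invariant under central symmetry, as a function on \<open>\<Pi>\<close>;
  the value \<open>1\<close> elsewhere makes it invertible everywhere.
\<close>

definition class_value :: "nat \<Rightarrow> (nat \<Rightarrow> nat \<Rightarrow> 'a) \<Rightarrow> nat set set \<Rightarrow> 'a::one" where
  "class_value h w \<gamma> = (if \<exists>i j. represents h i j \<gamma>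
     then (case SOME (i, j). represents h i j \<gamma> of (i, j) \<Rightarrow> w i j) else 1)"

lemma (in polygon_function) depends_mod: "i mod N = i' mod N \<Longrightarrow> w i j = w i' j"
proof -
  have "w (a + k * N) j = w a j" for a k
    by (induction k) (simp_all add: period add.assoc[symmetric] add.commute[of N])
  then have reduce: "w a j = w (a mod N) j" for a
    by (metis mod_mult_div_eq mult.commute)
  show "w i j = w i' j" if "i mod N = i' mod N"
    unfolding reduce[of i] reduce[of i'] that ..
qed

text \<open>Two index pairs that represent the same class differ by periods, by the order of the
  endpoints and by a half turn. All three leave \<open>w\<close> unchanged, so the choice made by
  \<open>SOME\<close> is harmless.\<close>

lemma class_value_eq:
  assumes w: "polygon_function (2 * h) w" and half: "\<And>i j. w (i + h) (j + h) = w i j"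
    and h: "h \<ge> 1" and ij: "i + 2 \<le> j" "j + 2 \<le> i + 2 * h"
  shows "class_value h w (diag_class h i j) = w i j"
proof -
  interpret polygon_function "2 * h" w by fact
  have norm: "w a b = w (vertex h a) (vertex h b)" for a b
  proof -
    have "vertex h a mod (2 * h) = a mod (2 * h)" for a by (simp add: vertex_def)
    then show ?thesis using depends_mod symm by metis
  qed
  have edge: "w a b = w i j" if "{vertex h a, vertex h b} = {vertex h i, vertex h j}" for a b i j
    using that norm[of a b] norm[of i j] symm by (auto simp: doubleton_eq_iff)
  have rep: "w i' j' = w i j" if eq: "diag_class h i j = diag_class h i' j'" for i' j'
  proof -
    have "{vertex h i', vertex h j'} \<in> diag_class h i j"
      unfolding eq by (simp add: diag_class_def symm_class_def)
    then have "{vertex h i', vertex h j'} = {vertex h i, vertex h j}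
        \<or> {vertex h i', vertex h j'} = {vertex h (i + h), vertex h (j + h)}"
      using vertex_half[OF h] by (simp add: diag_class_def symm_class_def)
    then show ?thesis using edge half by metis
  qed
  let ?P = "\<lambda>(i', j'). represents h i' j' (diag_class h i j)"
  have "?P (SOME p. ?P p)"
    by (rule someI[of ?P "(i, j)"]) (use ij in \<open>simp add: represents_def\<close>)
  moreover obtain i' j' where p: "(SOME p. ?P p) = (i', j')" by (cases "SOME p. ?P p")
  ultimately have "diag_class h i j = diag_class h i' j'" by (simp add: represents_def)
  then have "w i' j' = w i j" by (rule rep)
  then have "(case SOME p. ?P p of (i, j) \<Rightarrow> w i j) = w i j" unfolding p by simp
  moreover have "\<exists>i' j'. represents h i' j' (diag_class h i j)"
    using ij by (auto simp: represents_def)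
  ultimately show ?thesis by (simp add: class_value_def)
qed

locale symmetric_points =
  fixes h :: nat and \<zeta> :: "nat \<Rightarrow> complex"
  assumes h2: "h \<ge> 2"
    and opposite: "\<zeta> (k + h) = - \<zeta> k"
    and distinct: "k < l \<Longrightarrow> l < k + 2 * h \<Longrightarrow> \<zeta> k \<noteq> \<zeta> l"
begin

lemma points_period: "\<zeta> (k + 2 * h) = \<zeta> k"
  using opposite[of "k + h"] opposite[of k] by (simp add: mult_2 add.assoc)

definition cross :: "nat \<Rightarrow> nat \<Rightarrow> complex" where
  "cross k l = (\<zeta> k - \<zeta> (Suc l)) * (\<zeta> (Suc k) - \<zeta> l) / ((\<zeta> k - \<zeta> l) * (\<zeta> (Suc k) - \<zeta> (Suc l)))"

lemma cross_nonzero: "k + 2 \<le> l \<Longrightarrow> l + 2 \<le> k + 2 * h \<Longrightarrow> cross k l \<noteq> 0"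
  using distinct[of k l] distinct[of k "Suc l"] distinct[of "Suc k" l] distinct[of "Suc k" "Suc l"]
  by (simp add: cross_def)

lemma cross_polygon_function: "polygon_function (2 * h) cross"
proof
  fix i j
  show "cross (i + 2 * h) j = cross i j"
    using points_period[of i] points_period[of "Suc i"] by (simp add: cross_def)
  have 1: "(\<zeta> i - \<zeta> (Suc j)) * (\<zeta> (Suc i) - \<zeta> j) = (\<zeta> j - \<zeta> (Suc i)) * (\<zeta> (Suc j) - \<zeta> i)"
    and 2: "(\<zeta> i - \<zeta> j) * (\<zeta> (Suc i) - \<zeta> (Suc j)) = (\<zeta> j - \<zeta> i) * (\<zeta> (Suc j) - \<zeta> (Suc i))"
    by (simp_all add: algebra_simps)
  show "cross i j = cross j i" unfolding cross_def 1 2 ..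
qed

lemma cross_half: "cross (i + h) (j + h) = cross i j"
proof -
  have 1: "(a - b) * (c - d) = (b - a) * (d - c)" for a b c d :: complex
    by (simp add: algebra_simps)
  show ?thesis
    using opposite[of i] opposite[of j] opposite[of "Suc i"] opposite[of "Suc j"]
      1[of "\<zeta> (Suc j)" "\<zeta> i" "\<zeta> j" "\<zeta> (Suc i)"] 1[of "\<zeta> j" "\<zeta> i" "\<zeta> (Suc j)" "\<zeta> (Suc i)"]
    by (simp add: cross_def)
qed

text \<open>One telescoping step: the differences \<open>p\<close> and \<open>q\<close> at the inner
  end cancel.\<close>

lemma cancel_cross: "p \<noteq> 0 \<Longrightarrow> q \<noteq> 0 \<Longrightarrow> p * x / (y * q) * (z * q / (p * v)) = z * x / (y * v)"
  for p q x y z v :: complex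
  by simp

lemma block_prod_cross_row:
  assumes "Suc a < c" "c \<le> d" "d < a + 2 * h"
  shows "(\<Prod>l\<in>{c..<d}. cross a l)
    = (\<zeta> a - \<zeta> d) * (\<zeta> (Suc a) - \<zeta> c) / ((\<zeta> a - \<zeta> c) * (\<zeta> (Suc a) - \<zeta> d))"
  using assms(2,3)
proof (induction d rule: nat_induct_at_least)
  case base
  then show ?case using assms distinct[of a c] distinct[of "Suc a" c] by simp
next
  case (Suc d)
  then have "\<zeta> a - \<zeta> d \<noteq> 0" "\<zeta> (Suc a) - \<zeta> d \<noteq> 0"
    using assms(1) distinct[of a d] distinct[of "Suc a" d] by simp_all
  then show ?case using Suc by (simp add: cross_def cancel_cross)
qed

lemma block_prod_cross:
  assumes "a \<le> b" "b < c" "c \<le> d" "d < a + 2 * h"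
  shows "block_prod cross a b c d
    = (\<zeta> a - \<zeta> d) * (\<zeta> b - \<zeta> c) / ((\<zeta> a - \<zeta> c) * (\<zeta> b - \<zeta> d))"
  using assms(1,2)
proof (induction b rule: nat_induct_at_least)
  case base
  then show ?case using assms distinct[of a c] distinct[of a d] by simp
next
  case (Suc b)
  have "\<zeta> b - \<zeta> c \<noteq> 0" "\<zeta> b - \<zeta> d \<noteq> 0"
    using assms Suc distinct[of b c] distinct[of b d] by simp_all
  moreover have "block_prod cross a (Suc b) c d = block_prod cross a b c d * (\<Prod>l\<in>{c..<d}. cross b l)"
    using Suc by (simp add: block_prod_def)
  ultimately show ?case
    using Suc assms block_prod_cross_row[of b c d]
      cancel_cross[of "\<zeta> b - \<zeta> c" "\<zeta> b - \<zeta> d" "\<zeta> a - \<zeta> d" "\<zeta> a - \<zeta> c" "\<zeta> (Suc b) - \<zeta> c" "\<zeta> (Suc b) - \<zeta> d"]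
    by (simp add: mult.commute)
qed

lemma cross_u_equation:
  assumes "i + 2 \<le> j" "j + 2 \<le> i + 2 * h"
  shows "cross i j + block_prod cross (Suc i) j (Suc j) (i + 2 * h) = 1"
proof -
  have ne: "\<zeta> (Suc i) \<noteq> \<zeta> (Suc j)" "\<zeta> i \<noteq> \<zeta> j" "\<zeta> j \<noteq> \<zeta> i"
    using assms distinct[of i j] distinct[of "Suc i" "Suc j"] by auto
  \<comment> \<open>The end \<open>i + 2 * h\<close> of the second block is the point at
    \<open>i\<close> again, so the telescoped product is a cross ratio of the same four points in
    another order.\<close>
  have "block_prod cross (Suc i) j (Suc j) (i + 2 * h)
      = (\<zeta> (Suc i) - \<zeta> i) * (\<zeta> j - \<zeta> (Suc j)) / ((\<zeta> (Suc i) - \<zeta> (Suc j)) * (\<zeta> j - \<zeta> i))"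
    using block_prod_cross[of "Suc i" j "Suc j" "i + 2 * h"] assms points_period[of i] by simp
  moreover have "\<dots> = - ((\<zeta> (Suc i) - \<zeta> i) * (\<zeta> j - \<zeta> (Suc j))) / ((\<zeta> i - \<zeta> j) * (\<zeta> (Suc i) - \<zeta> (Suc j)))"
    using ne by (simp add: divide_simps) (simp add: algebra_simps)
  ultimately show ?thesis
    unfolding cross_def using ne by (simp add: divide_simps) (simp add: algebra_simps)
qed

abbreviation u_point :: "nat set set \<Rightarrow> complex" where
  "u_point \<equiv> class_value h cross"

lemma u_point_diag_class: "i + 2 \<le> j \<Longrightarrow> j + 2 \<le> i + 2 * h \<Longrightarrow> u_point (diag_class h i j) = cross i j"
  using class_value_eq[OF cross_polygon_function cross_half] h2 by simp

lemma u_point_nonzero: "u_point \<gamma> \<noteq> 0"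
proof (cases "\<exists>i j. represents h i j \<gamma>")
  case True
  then obtain i j where "represents h i j \<gamma>" by blast
  then show ?thesis using u_point_diag_class cross_nonzero by (auto simp: represents_def)
next
  case False
  then show ?thesis unfolding class_value_def by simp
qed

sublocale u: nonzero_point u_point
  by unfold_locales (rule u_point_nonzero)

lemma block_prod_u_point:
  assumes "a \<le> b" "b < c" "c \<le> d" "d < a + 2 * h"
  shows "block_prod (\<lambda>k l. u_point (diag_class h k l)) a b c d = block_prod cross a b c d"
  unfolding block_prod_def using assms by (intro prod.cong refl u_point_diag_class) auto

lemma u_relation_vanishes:
  assumes n: "n \<ge> 1" "h = n + 1" and \<gamma>: "\<gamma> \<in> Pi_C n"
  shows "laurent_eval u_point (u_relation n \<gamma>) = 0"
proof -
  have "\<gamma> \<in> symm_class h ` diagonals h" using \<gamma> Pi_C_eq[OF n(1)] n(2) by simp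
  then obtain k l where kl: "k + 2 \<le> l" "l + 2 \<le> k + 2 * h" "\<gamma> = diag_class h k l"
    by (rule diag_class_cases)
  have "laurent_eval u_point (u_relation n \<gamma>) = u_point \<gamma> + (\<Prod>\<omega>\<in>Pi_C n. u_point \<omega> ^ compat_degree \<omega> \<gamma>) - 1"
    unfolding u_relation_def
    by (simp add: u.laurent_eval_eq u.eval_at_diff u.eval_at_add u.eval_at_prod u.eval_at_power u.eval_at_one)
      (simp add: u.laurent_eval_var flip: u.laurent_eval_eq)
  moreover have "(\<Prod>\<omega>\<in>Pi_C n. u_point \<omega> ^ compat_degree \<omega> \<gamma>) = block_prod cross (Suc k) l (Suc l) (k + 2 * h)"
    unfolding kl(3) prod_compat_degree[OF n kl(1,2)] using kl by (intro block_prod_u_point) auto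
  ultimately show ?thesis
    using cross_u_equation[OF kl(1,2)] u_point_diag_class[OF kl(1,2)] kl(3) by simp
qed

end

section \<open>Relations between the cross ratios\<close>

definition signed_point :: "nat \<Rightarrow> (nat \<Rightarrow> complex) \<Rightarrow> nat \<Rightarrow> complex" where
  "signed_point h z k = (if k < h then z k else if k = h then 1 else if k < 2 * h then - z (k - h) else -1)"

definition vertex_point :: "nat \<Rightarrow> (nat \<Rightarrow> complex) \<Rightarrow> nat \<Rightarrow> complex" where
  "vertex_point h z k = signed_point h z (vertex h k)"

definition admissible :: "nat \<Rightarrow> (nat \<Rightarrow> complex) \<Rightarrow> bool" where
  "admissible n z \<longleftrightarrow>
     (\<forall>i j. 1 \<le> i \<and> i < j \<and> j \<le> n \<longrightarrow> z i - z j \<noteq> 0 \<and> z i + z j \<noteq> 0) \<and>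
     (\<forall>i. 1 \<le> i \<and> i \<le> n \<longrightarrow> 1 - z i \<noteq> 0 \<and> 1 + z i \<noteq> 0 \<and> z i \<noteq> 0)"

lemma signed_point_antipode:
  assumes "1 \<le> k" "k \<le> 2 * h"
  shows "signed_point h z (antipode h k) = - signed_point h z k"
  using assms by (cases "k = h") (auto simp: signed_point_def antipode_def)

text \<open>Up to nonzero constants these are the differences of two points of the symmetric
  configuration; the form \<open>z i\<close> comes from \<open>z i\<close> and its negative, the
  constant form from 1 and -1.\<close>

inductive linear_form :: "nat \<Rightarrow> ((nat \<Rightarrow> complex) \<Rightarrow> complex) \<Rightarrow> bool" for n where
  "1 \<le> i \<Longrightarrow> i < j \<Longrightarrow> j \<le> n \<Longrightarrow> linear_form n (\<lambda>z. z i - z j)"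
| "1 \<le> i \<Longrightarrow> i < j \<Longrightarrow> j \<le> n \<Longrightarrow> linear_form n (\<lambda>z. z i + z j)"
| "1 \<le> i \<Longrightarrow> i \<le> n \<Longrightarrow> linear_form n (\<lambda>z. 1 - z i)"
| "1 \<le> i \<Longrightarrow> i \<le> n \<Longrightarrow> linear_form n (\<lambda>z. 1 + z i)"
| "1 \<le> i \<Longrightarrow> i \<le> n \<Longrightarrow> linear_form n (\<lambda>z. z i)"
| "linear_form n (\<lambda>z. 1)"

lemma linear_form_nonzero: "linear_form n L \<Longrightarrow> admissible n z \<Longrightarrow> L z \<noteq> 0"
  by (induction rule: linear_form.induct) (auto simp: admissible_def)

lemma signed_point_diff:
  assumes h: "h = n + 1" and ab: "1 \<le> a" "a < b" "b \<le> 2 * h"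
  obtains c L where "c \<noteq> 0" "linear_form n L"
    "\<And>z. signed_point h z a - signed_point h z b = c * L z"
proof -
  note result = that
  have mk: thesis
    if "linear_form n L" "\<And>z. signed_point h z a - signed_point h z b = c * L z" "c \<noteq> 0" for L c
    using that(3,1,2) by (rule result)
  consider "b < h" | "b = h" | "h < b" "b < 2 * h" | "b = 2 * h" using ab by linarith
  then show thesis
  proof cases
    case 1
    show thesis
      by (rule mk[OF linear_form.intros(1)[of a b], of 1]) (use 1 ab h in \<open>auto simp: signed_point_def\<close>)
  next
    case 2
    show thesis
      by (rule mk[OF linear_form.intros(3)[of a], of "-1"]) (use 2 ab h in \<open>auto simp: signed_point_def\<close>)
  next
    case b: 3
    consider "a < h" "a < b - h" | "a < h" "b = h + a" | "a < h" "b - h < a" | "a = h" | "h < a"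
      using b by linarith
    then show thesis
    proof cases
      case 1
      show thesis
        by (rule mk[OF linear_form.intros(2)[of a "b - h"], of 1]) (use 1 b ab h in \<open>auto simp: signed_point_def\<close>)
    next
      case 2
      show thesis
        by (rule mk[OF linear_form.intros(5)[of a], of 2]) (use 2(1) ab h in \<open>auto simp: signed_point_def 2(2)\<close>)
    next
      case 3
      show thesis
        by (rule mk[OF linear_form.intros(2)[of "b - h" a], of 1]) (use 3 b ab h in \<open>auto simp: signed_point_def\<close>)
    next
      case 4
      show thesis
        by (rule mk[OF linear_form.intros(4)[of "b - h"], of 1]) (use 4 b ab h in \<open>auto simp: signed_point_def\<close>)
    next
      case 5
      show thesis
        by (rule mk[OF linear_form.intros(1)[of "a - h" "b - h"], of "-1"]) (use 5 b ab h in \<open>auto simp: signed_point_def\<close>)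
    qed
  next
    case b: 4
    consider "a < h" | "a = h" | "h < a" by linarith
    then show thesis
    proof cases
      case 1
      show thesis
        by (rule mk[OF linear_form.intros(4)[of a], of 1]) (use 1 b ab h in \<open>auto simp: signed_point_def\<close>)
    next
      case 2
      show thesis
        by (rule mk[OF linear_form.intros(6), of 2]) (use 2 b ab h in \<open>auto simp: signed_point_def\<close>)
    next
      case 3
      show thesis
        by (rule mk[OF linear_form.intros(3)[of "a - h"], of 1]) (use 3 b ab h in \<open>auto simp: signed_point_def\<close>)
    qed
  qed
qed

lemma signed_point_distinct:
  assumes "admissible n z" "h = n + 1" "1 \<le> a" "a < b" "b \<le> 2 * h"
  shows "signed_point h z a \<noteq> signed_point h z b"
proof -
  obtain c L where "c \<noteq> 0" "linear_form n L" "signed_point h z a - signed_point h z b = c * L z"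
    using signed_point_diff[OF assms(2-5)] by metis
  then show ?thesis using linear_form_nonzero[OF _ assms(1)] by auto
qed

lemma symmetric_points_vertex_point:
  assumes z: "admissible n z" and n: "n \<ge> 1" and h: "h = n + 1"
  shows "symmetric_points h (vertex_point h z)"
proof
  show "h \<ge> 2" using n h by simp
  have h1: "h \<ge> 1" using h by simp
  fix k l :: nat
  show "vertex_point h z (k + h) = - vertex_point h z k"
    unfolding vertex_point_def vertex_half[OF h1]
    using vertex_range[OF h1, of k] by (intro signed_point_antipode) auto
  assume "k < l" "l < k + 2 * h"
  then have "vertex h k \<noteq> vertex h l" using vertex_neq h1 by blast
  then show "vertex_point h z k \<noteq> vertex_point h z l"
    unfolding vertex_point_def
    using signed_point_distinct[OF z h, of "vertex h k" "vertex h l"]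
      signed_point_distinct[OF z h, of "vertex h l" "vertex h k"]
      vertex_range[OF h1, of k] vertex_range[OF h1, of l]
    by (cases "vertex h k < vertex h l") auto
qed

text \<open>
  For parameters \<open>P\<close> and \<open>c = P 0\<close> in general position, the coordinate
  \<open>t \<mapsto> (\<tau> - t) / (\<tau> + t)\<close> with \<open>\<tau>\<^sup>2 = - c\<close> turns the involution \<open>t \<mapsto> - c / t\<close> into \<open>z \<mapsto> - z\<close>.
\<close>

definition general_position :: "nat \<Rightarrow> (nat \<Rightarrow> complex) \<Rightarrow> bool" where
  "general_position h P \<longleftrightarrow>
     (\<forall>k l. k < l \<longrightarrow> l \<le> 2 * h \<longrightarrow> (k, l) \<noteq> (0, 2 * h) \<longrightarrow> vertex_det h P (P 0) k l \<noteq> 0)"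

definition moebius_point :: "(nat \<Rightarrow> complex) \<Rightarrow> nat \<Rightarrow> complex" where
  "moebius_point P k = (csqrt (- P 0) + P k) / (csqrt (- P 0) - P k)"

text \<open>The coordinate change sends infinity to -1 and 0 to 1. It multiplies a determinant by
  \<open>2 * \<tau>\<close> and by one factor for each of its two vertices, and all these factors
  cancel in a cross ratio.\<close>

lemma moebius:
  assumes P: "general_position h P" and n: "n \<ge> 1" and h: "h = n + 1"
  defines "z \<equiv> moebius_point P" and "\<tau> \<equiv> csqrt (- P 0)"
  shows "admissible n z"
    and "k + 2 \<le> l \<Longrightarrow> l < 2 * h \<Longrightarrow> (k = 0 \<Longrightarrow> l + 2 \<le> 2 * h) \<Longrightarrow>
      symmetric_points.cross (vertex_point h z) k l
        * (vertex_det h P (P 0) k l * vertex_det h P (P 0) (Suc k) (Suc l))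
      = vertex_det h P (P 0) (Suc k) l * vertex_det h P (P 0) k (Suc l)"
proof -
  have \<tau>2: "\<tau> * \<tau> = - P 0"
    unfolding \<tau>_def by (simp flip: power2_eq_square)
  have det: "vertex_det h P (P 0) k l \<noteq> 0" if "k < l" "l \<le> 2 * h" "(k, l) \<noteq> (0, 2 * h)" for k l
    using P that unfolding general_position_def by blast
  note defs = vertex_det_def vertex_x_def vertex_y_def
  have P0: "P 0 \<noteq> 0" using det[of h "h + 1"] n h by (simp add: defs)
  then have \<tau>0: "\<tau> \<noteq> 0" using \<tau>2 by auto
  have P1: "P k \<noteq> 0" if "1 \<le> k" "k < h" for k
    using det[of k h] that by (simp add: defs)
  have P2: "P k \<noteq> P l" if "1 \<le> k" "k < l" "l < h" for k l
    using det[of k l] that by (simp add: defs)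
  have P3: "P k * P l + P 0 \<noteq> 0" if "1 \<le> k" "k < h" "1 \<le> l" "l < h" for k l
    using det[of k "h + l"] that by (simp add: defs add.commute mult.commute)
  \<comment> \<open>The points \<tau> and -\<tau> are the fixed points of t -> -c/t. No vertex lies
    there, because its determinant with its antipode does not vanish.\<close>
  have \<tau>m: "\<tau> - P k \<noteq> 0" "\<tau> + P k \<noteq> 0" if "1 \<le> k" "k < h" for k
  proof -
    have "(\<tau> - P k) * (\<tau> + P k) = - (P k * P k + P 0)"
      using \<tau>2 by (simp add: algebra_simps)
    then show "\<tau> - P k \<noteq> 0" "\<tau> + P k \<noteq> 0" using P3[of k k] that by (metis add.inverse_neutral mult_zero_left mult_zero_right neg_equal_iff_equal)+
  qed
  have z: "z k = (\<tau> + P k) / (\<tau> - P k)" for k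
    by (simp add: z_def moebius_point_def \<tau>_def)
  show "admissible n z"
    unfolding admissible_def
  proof (intro conjI allI impI)
    fix i j :: nat assume ij: "1 \<le> i \<and> i < j \<and> j \<le> n"
    then have i: "\<tau> - P i \<noteq> 0" and j: "\<tau> - P j \<noteq> 0" using \<tau>m h by simp_all
    have "z i - z j = 2 * \<tau> * (P i - P j) / ((\<tau> - P i) * (\<tau> - P j))"
      unfolding z using i j by (simp add: divide_simps) (simp add: algebra_simps)
    then show "z i - z j \<noteq> 0" using i j \<tau>0 P2[of i j] ij h by simp
    define s where "s = P i * P j + P 0"
    have s: "s \<noteq> 0" using P3[of i j] ij h by (simp add: s_def)
    have "z i + z j = (2 * (\<tau> * \<tau>) - 2 * (P i * P j)) / ((\<tau> - P i) * (\<tau> - P j))"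
      unfolding z using i j by (simp add: divide_simps) (simp add: algebra_simps)
    also have "\<dots> = - 2 * s / ((\<tau> - P i) * (\<tau> - P j))"
      unfolding \<tau>2 s_def by (simp add: algebra_simps)
    finally show "z i + z j \<noteq> 0" using i j s by simp
  next
    fix i assume ij: "1 \<le> i \<and> i \<le> n"
    then have i: "\<tau> - P i \<noteq> 0" "\<tau> + P i \<noteq> 0" using \<tau>m h by simp_all
    have "1 - z i = - 2 * P i / (\<tau> - P i)" "1 + z i = 2 * \<tau> / (\<tau> - P i)"
      unfolding z using i by (simp_all add: divide_simps)
    then show "1 - z i \<noteq> 0" "1 + z i \<noteq> 0" "z i \<noteq> 0"
      using i \<tau>0 P1[of i] ij h by (simp_all add: z)
  qed
  let ?x = "vertex_x h P (P 0)" and ?y = "vertex_y h P"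
  let ?d = "\<lambda>k. \<tau> * ?y k + ?x k"
  have d: "?d k \<noteq> 0 \<and> vertex_point h z k = (\<tau> * ?y k - ?x k) / ?d k" if k: "k \<le> 2 * h" for k
  proof -
    consider "k = 0" | "1 \<le> k" "k < h" | "k = h" | m where "k = h + m" "1 \<le> m" "m < h" | "k = 2 * h" "k \<noteq> 0"
    proof (cases "h < k \<and> k < 2 * h")
      case True
      then show ?thesis using that(4)[of "k - h"] by auto
    next
      case False
      then show ?thesis using k that(1,2,3,5) by (cases "k < h"; cases "k = 0"; cases "k = h") auto
    qed
    then show ?thesis
    proof cases
      case 1
      then show ?thesis using n h by (simp add: vertex_point_def signed_point_def vertex_def defs)
    next
      case 2
      then show ?thesis using \<tau>m[of k] by (simp add: vertex_point_def signed_point_def defs z)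
    next
      case 3
      then show ?thesis using n h \<tau>0 by (simp add: vertex_point_def signed_point_def defs)
    next
      case (4 m)
      have *: "\<tau> * P m + P 0 = - (\<tau> * (\<tau> - P m))" "\<tau> * P m - P 0 = \<tau> * (\<tau> + P m)"
        using \<tau>2 by (simp_all add: algebra_simps)
      have "vertex_point h z k = - z m"
        using 4 by (simp add: vertex_point_def signed_point_def)
      moreover have "?x k = P 0" "?y k = P m" using 4 by (simp_all add: defs)
      ultimately show ?thesis using \<tau>m[of m] \<tau>0 4 by (simp add: * z)
    next
      case 5
      then show ?thesis using n h by (simp add: vertex_point_def signed_point_def defs)
    qed
  qed
  have diff: "vertex_point h z k - vertex_point h z l = 2 * \<tau> * vertex_det h P (P 0) k l / (?d k * ?d l)"
    if "k \<le> 2 * h" "l \<le> 2 * h" for k l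
  proof -
    have "a / e - b / f = (a * f - b * e) / (e * f)" if "e \<noteq> 0" "f \<noteq> 0" for a b e f :: complex
      using that by (simp add: divide_simps)
    then have "vertex_point h z k - vertex_point h z l
        = ((\<tau> * ?y k - ?x k) * ?d l - (\<tau> * ?y l - ?x l) * ?d k) / (?d k * ?d l)"
      using d[OF that(1)] d[OF that(2)] by simp
    also have "(\<tau> * ?y k - ?x k) * ?d l - (\<tau> * ?y l - ?x l) * ?d k = 2 * \<tau> * vertex_det h P (P 0) k l"
      by (simp add: vertex_det_def algebra_simps)
    finally show ?thesis .
  qed
  assume kl: "k + 2 \<le> l" "l < 2 * h" "k = 0 \<Longrightarrow> l + 2 \<le> 2 * h"
  have ne: "?d k \<noteq> 0" "?d l \<noteq> 0" "?d (Suc k) \<noteq> 0" "?d (Suc l) \<noteq> 0"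
    using d[of k] d[of l] d[of "Suc k"] d[of "Suc l"] kl by auto
  have dets: "vertex_det h P (P 0) k l \<noteq> 0" "vertex_det h P (P 0) (Suc k) (Suc l) \<noteq> 0"
    using kl det[of k l] det[of "Suc k" "Suc l"] by auto
  have cancel: "(2 * \<tau> * a / (d1 * d4)) * (2 * \<tau> * b / (d2 * d3))
      / ((2 * \<tau> * e / (d1 * d3)) * (2 * \<tau> * f / (d2 * d4))) * (e * f) = b * a"
    if "d1 \<noteq> 0" "d2 \<noteq> 0" "d3 \<noteq> 0" "d4 \<noteq> 0" "e \<noteq> 0" "f \<noteq> 0" for a b d1 d2 d3 d4 e f :: complex
    using that \<tau>0 by (simp add: divide_simps)
  interpret symmetric_points h "vertex_point h z"
    using \<open>admissible n z\<close> n h by (rule symmetric_points_vertex_point)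
  show "cross k l * (vertex_det h P (P 0) k l * vertex_det h P (P 0) (Suc k) (Suc l))
      = vertex_det h P (P 0) (Suc k) l * vertex_det h P (P 0) k (Suc l)"
    unfolding cross_def using kl diff ne dets \<tau>0 by (simp add: cancel)
qed


lemma vertex_det_hom:
  assumes "f 0 = 0" "f 1 = 1" "\<And>x y. f (x - y) = f x - f y" "\<And>x. f (- x) = - f x"
    "\<And>x y. f (x * y) = f x * f y"
  shows "f (vertex_det h P c k l) = vertex_det h (\<lambda>i. f (P i)) (f c) k l"
  unfolding vertex_det_def vertex_x_def vertex_y_def by (simp add: assms)

section \<open>Comparison of the ring defined by the relations with actual configurations\<close>

locale type_C =
  fixes n h :: nat
  assumes n: "n \<ge> 1" and h: "h = n + 1"
begin

lemma h2: "h \<ge> 2" and h1: "h \<ge> 1"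
  using n h by auto

definition relation_ideal :: "nat set set laurent set" where
  "relation_ideal = genideal (laurent_algebra (Pi_C n)) (u_relation n ` Pi_C n)"

text \<open>
  Extending the ideal along the retraction to the ring of Laurent polynomials in all variables makes
  congruences available in a type class ring.
\<close>

definition relation_congruence :: "nat set set laurent set" where
  "relation_congruence = {x. laurent_retract (Pi_C n) x \<in> relation_ideal}"

definition diag_var :: "nat \<Rightarrow> nat \<Rightarrow> nat set set laurent" where
  "diag_var i j = laurent_var (diag_class h i j)"

lemma Pi_eq: "Pi_C n = symm_class h ` diagonals h"
  using Pi_C_eq[OF n] h by simp

abbreviation u_laurents :: "nat set set laurent set" where
  "u_laurents \<equiv> carrier (laurent_algebra (Pi_C n))"

lemma u_relation_closed: "\<gamma> \<in> Pi_C n \<Longrightarrow> u_relation n \<gamma> \<in> u_laurents"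
  unfolding u_relation_def
  by (intro laurent_algebra_closed laurent_prod_closed laurent_power_closed laurent_var_closed)

lemma ideal_relation_ideal: "ideal relation_ideal (laurent_algebra (Pi_C n))"
  unfolding relation_ideal_def
  by (intro ring.genideal_ideal cring.axioms(1) laurent_algebra_cring) (use u_relation_closed in auto)

lemma u_relation_in: "\<gamma> \<in> Pi_C n \<Longrightarrow> u_relation n \<gamma> \<in> relation_congruence"
proof -
  assume \<gamma>: "\<gamma> \<in> Pi_C n"
  have "u_relation n ` Pi_C n \<subseteq> relation_ideal"
    unfolding relation_ideal_def
    by (intro ring.genideal_self cring.axioms(1) laurent_algebra_cring) (use u_relation_closed in auto)
  then show ?thesis
    using \<gamma> laurent_retract_id[OF u_relation_closed[OF \<gamma>]] by (auto simp: relation_congruence_def)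
qed

lemma relation_congruence_iff:
  "x \<in> u_laurents \<Longrightarrow> x \<in> relation_congruence \<longleftrightarrow> x \<in> relation_ideal"
  by (simp add: relation_congruence_def laurent_retract_id)

sublocale J: congruence_ideal relation_congruence
proof
  interpret ideal relation_ideal "laurent_algebra (Pi_C n)" by (rule ideal_relation_ideal)
  show "0 \<in> relation_congruence"
    using additive_subgroup.zero_closed[OF additive_subgroup_axioms]
    by (simp add: relation_congruence_def laurent_retract_hom laurent_algebra_simps)
  show "x + y \<in> relation_congruence" if "x \<in> relation_congruence" "y \<in> relation_congruence" for x y
    using that additive_subgroup.a_closed[OF additive_subgroup_axioms]
    by (simp add: relation_congruence_def laurent_retract_hom laurent_algebra_simps)
  show "r * x \<in> relation_congruence" if "x \<in> relation_congruence" for x r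
    using that I_l_closed[OF _ laurent_retract_carrier[of "Pi_C n" r]]
    by (simp add: relation_congruence_def laurent_retract_hom laurent_algebra_simps)
qed

sublocale U: symmetric_u_equations relation_congruence h diag_var
proof
  fix i j :: nat
  show "h \<ge> 2" by (rule h2)
  have class_period: "diag_class h (i + 2 * h) j = diag_class h i j" "diag_class h i j = diag_class h j i" for i j
    by (simp_all add: diag_class_def insert_commute)
  show "diag_var (i + 2 * h) j = diag_var i j"
    by (simp add: diag_var_def class_period(1))
  show "diag_var i j = diag_var j i"
    by (simp add: diag_var_def class_period(2)[of i j])
  show "diag_var (i + h) (j + h) = diag_var i j"
    by (simp add: diag_var_def polygon_function_class(2)[OF h1])
  \<comment> \<open>This also covers pairs that form no diagonal: their variables lie outside
    \<open>Pi_C n\<close> but are units of the full Laurent ring.\<close>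
  show "diag_var i j dvd 1"
    by (simp add: diag_var_def laurent_var_unit)
  assume ij: "i + 2 \<le> j" "j + 2 \<le> i + 2 * h"
  have "diag_class h i j \<in> Pi_C n" unfolding Pi_eq using diag_class_in[OF ij h1] .
  then have "u_relation n (diag_class h i j) \<in> relation_congruence" by (rule u_relation_in)
  then show "J.cong (diag_var i j + block_prod diag_var (Suc i) j (Suc j) (i + 2 * h)) 1"
    using prod_compat_degree[OF n h ij, of laurent_var]
    by (simp add: J.cong_def u_relation_def diag_var_def[abs_def])
qed


definition poly_det :: "nat \<Rightarrow> nat \<Rightarrow> nat polynomial" where
  "poly_det k l = vertex_det h poly_var (poly_var 0) k l"

text \<open>The vertices whose parameters enter the chart are 1 to \<open>h - 1\<close>, so index 0
  is free to carry the constant c of the involution, as \<open>P 0\<close> does for complex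
  parameters.\<close>

definition ring_params :: "nat \<Rightarrow> nat set set laurent" where
  "ring_params k = (if k = 0 then U.modulus else U.param k)"

abbreviation ring_eval :: "nat polynomial \<Rightarrow> nat set set laurent" where
  "ring_eval \<equiv> generic_eval ring_params (Poly_Mapping.single 0)"

abbreviation u_value :: "(nat \<Rightarrow> complex) \<Rightarrow> nat set set laurent \<Rightarrow> complex" where
  "u_value z \<equiv> laurent_eval (class_value h (symmetric_points.cross (vertex_point h z)))"

lemma poly_det_complex: "poly_eval P (poly_det k l) = vertex_det h P (P 0) k l"
  unfolding poly_det_def
  by (subst vertex_det_hom[of "poly_eval P"]) (simp_all add: poly_eval_hom)

lemmas ring_eval_hom = scalars.generic_eval_hom[OF laurent_scalars, of ring_params]

lemma poly_det_ring: "ring_eval (poly_det k l) = vertex_det h U.param U.modulus k l"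
proof -
  have "ring_eval (poly_det k l) = vertex_det h ring_params (ring_params 0) k l"
    unfolding poly_det_def by (subst vertex_det_hom[of ring_eval]) (simp_all add: ring_eval_hom)
  also have "\<dots> = vertex_det h U.param U.modulus k l"
    unfolding vertex_det_def vertex_x_def vertex_y_def ring_params_def by auto
  finally show ?thesis .
qed

text \<open>A denominator has to be cancelled in two places: at complex points, where not vanishing
  suffices, and modulo the relations, where zero divisors are not excluded a priori, so that an
  inverse is demanded.\<close>

definition nondegenerate :: "nat polynomial \<Rightarrow> bool" where
  "nondegenerate B \<longleftrightarrow> (\<forall>P. general_position h P \<longrightarrow> poly_eval P B \<noteq> 0) \<and> (\<exists>v. J.cong (v * ring_eval B) 1)"

text \<open>
  The same fraction of polynomials in the parameters computes \<open>F\<close> modulo the relations and at all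
  actual configurations; this transfers polynomial identities between the two.
\<close>

definition represented :: "nat set set laurent \<Rightarrow> nat polynomial \<Rightarrow> nat polynomial \<Rightarrow> bool" where
  "represented F A B \<longleftrightarrow> nondegenerate B \<and> J.cong (F * ring_eval B) (ring_eval A) \<and>
     (\<forall>P. general_position h P \<longrightarrow> u_value (moebius_point P) F * poly_eval P B = poly_eval P A)"

lemma nondegenerate_one: "nondegenerate 1"
  unfolding nondegenerate_def by (auto simp: poly_eval_hom ring_eval_hom intro!: exI[of _ 1])

lemma nondegenerate_mult:
  assumes "nondegenerate A" "nondegenerate B"
  shows "nondegenerate (A * B)"
proof -
  obtain v w where vw: "J.cong (v * ring_eval A) 1" "J.cong (w * ring_eval B) 1"
    using assms unfolding nondegenerate_def by blast
  have "J.cong ((v * w) * ring_eval (A * B)) 1"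
    using J.cong_mult[OF vw] by (simp add: ring_eval_hom mult_ac)
  then show ?thesis using assms unfolding nondegenerate_def by (auto simp: poly_eval_hom)
qed

lemma nondegenerate_poly_det:
  assumes "k < l" "l \<le> 2 * h" "(k, l) \<noteq> (0, 2 * h)"
  shows "nondegenerate (poly_det k l)"
  using U.vertex_det_unit[OF assms] assms
  unfolding nondegenerate_def poly_det_complex poly_det_ring general_position_def by blast

lemma symmetric: "admissible n z \<Longrightarrow> symmetric_points h (vertex_point h z)"
  using symmetric_points_vertex_point n h by blast

lemma u_value_hom:
  assumes "admissible n z"
  shows "u_value z (F + G) = u_value z F + u_value z G" "u_value z (F * G) = u_value z F * u_value z G"
    "u_value z 0 = 0" "u_value z 1 = 1" "u_value z (Poly_Mapping.single 0 c) = c"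
proof -
  interpret symmetric_points h "vertex_point h z" by (rule symmetric[OF assms])
  show "u_value z (F + G) = u_value z F + u_value z G" "u_value z (F * G) = u_value z F * u_value z G"
    "u_value z 0 = 0" "u_value z 1 = 1" "u_value z (Poly_Mapping.single 0 c) = c"
    by (simp_all add: u.laurent_eval_eq u.eval_at_add u.eval_at_mult u.eval_at_zero u.eval_at_one
        u.eval_at_single int_monomial_def)
qed

abbreviation u_at :: "(nat \<Rightarrow> complex) \<Rightarrow> nat set set laurent \<Rightarrow> complex" where
  "u_at P \<equiv> u_value (moebius_point P)"

lemmas u_value_moebius = u_value_hom[OF moebius(1)[OF _ n h]]

lemma represented_const: "represented (Poly_Mapping.single 0 c) (Poly_Mapping.single 0 c) 1"
  unfolding represented_def by (simp add: nondegenerate_one u_value_moebius poly_eval_hom ring_eval_hom)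

lemma represented_add:
  assumes "represented F A B" "represented F' A' B'"
  shows "represented (F + F') (A * B' + A' * B) (B * B')"
proof -
  have "J.cong ((F * ring_eval B) * ring_eval B' + (F' * ring_eval B') * ring_eval B)
      (ring_eval A * ring_eval B' + ring_eval A' * ring_eval B)"
    using assms unfolding represented_def by (intro J.cong_add J.cong_mult J.cong_refl) auto
  then have "J.cong ((F + F') * ring_eval (B * B')) (ring_eval (A * B' + A' * B))"
    by (simp add: ring_eval_hom algebra_simps)
  moreover have "u_at P (F + F') * poly_eval P (B * B') = poly_eval P (A * B' + A' * B)"
    if P: "general_position h P" for P
  proof -
    have "u_at P F * poly_eval P B = poly_eval P A"
      "u_at P F' * poly_eval P B' = poly_eval P A'"
      using assms P unfolding represented_def by auto
    then show ?thesis
      by (simp add: u_value_moebius[OF P] poly_eval_hom distrib_right flip: mult.assoc)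
  qed
  ultimately show ?thesis
    using assms unfolding represented_def by (simp add: nondegenerate_mult)
qed

lemma represented_mult:
  assumes "represented F A B" "represented F' A' B'"
  shows "represented (F * F') (A * A') (B * B')"
proof -
  have "J.cong ((F * ring_eval B) * (F' * ring_eval B')) (ring_eval A * ring_eval A')"
    using assms unfolding represented_def by (intro J.cong_mult) auto
  then have "J.cong ((F * F') * ring_eval (B * B')) (ring_eval (A * A'))"
    by (simp add: ring_eval_hom mult_ac)
  moreover have "u_at P (F * F') * poly_eval P (B * B') = poly_eval P (A * A')"
    if P: "general_position h P" for P
  proof -
    have "u_at P F * poly_eval P B = poly_eval P A"
      "u_at P F' * poly_eval P B' = poly_eval P A'"
      using assms P unfolding represented_def by auto
    then have "(u_at P F * poly_eval P B) * (u_at P F' * poly_eval P B')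
        = poly_eval P A * poly_eval P A'" by simp
    then show ?thesis by (simp only: u_value_moebius[OF P] poly_eval_hom mult_ac)
  qed
  ultimately show ?thesis
    using assms unfolding represented_def by (simp add: nondegenerate_mult)
qed

text \<open>Negative exponents turn numerators into denominators. Hence nondegenerate numerators are
  carried along for variables and monomials, and given up only when sums are formed.\<close>

lemma represented_inverse:
  assumes "represented F A B" "nondegenerate A" "F * G = 1"
  shows "represented G B A"
proof -
  have "J.cong (G * (F * ring_eval B)) (G * ring_eval A)"
    using assms unfolding represented_def by (intro J.cong_mult J.cong_refl) auto
  then have "J.cong ((F * G) * ring_eval B) (G * ring_eval A)" by (simp add: mult_ac)
  then have "J.cong (G * ring_eval A) (ring_eval B)" by (simp add: assms(3) J.cong_sym)
  moreover have "u_at P G * poly_eval P A = poly_eval P B"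
    if P: "general_position h P" for P
  proof -
    have "u_at P F * poly_eval P B = poly_eval P A"
      using assms P unfolding represented_def by auto
    moreover have "u_at P F * u_at P G = 1"
      using assms(3) u_value_moebius[OF P] by metis
    ultimately show ?thesis by (metis mult.assoc mult.commute mult.right_neutral)
  qed
  ultimately show ?thesis
    using assms unfolding represented_def by simp
qed

text \<open>\<open>vertex_det_cross_ratio\<close> modulo the relations and \<open>moebius\<close> at
  configurations yield the same quotient of four determinants.\<close>

lemma represented_var:
  assumes "\<gamma> \<in> Pi_C n"
  shows "\<exists>A B. represented (laurent_var \<gamma>) A B \<and> nondegenerate A"
proof -
  obtain k l where kl: "k + 2 \<le> l" "l < 2 * h" "l + 2 \<le> k + 2 * h" "\<gamma> = diag_class h k l"
    using assms unfolding Pi_eq by (rule diag_class_cases)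
  let ?A = "poly_det (Suc k) l * poly_det k (Suc l)" and ?B = "poly_det k l * poly_det (Suc k) (Suc l)"
  have k0: "k = 0 \<Longrightarrow> l + 2 \<le> 2 * h" using kl(3) by simp
  have "nondegenerate ?A" "nondegenerate ?B"
    by (intro nondegenerate_mult nondegenerate_poly_det; use kl in auto)+
  moreover have "diag_var k l = laurent_var \<gamma>"
    using kl(4) by (simp add: diag_var_def)
  then have "J.cong (laurent_var \<gamma> * ring_eval ?B) (ring_eval ?A)"
    using U.vertex_det_cross_ratio[OF kl(1,2) k0] by (simp add: ring_eval_hom poly_det_ring)
  moreover have "u_at P (laurent_var \<gamma>) * poly_eval P ?B = poly_eval P ?A"
    if P: "general_position h P" for P
  proof -
    interpret symmetric_points h "vertex_point h (moebius_point P)"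
      using moebius(1)[OF P n h] by (rule symmetric)
    have "u_at P (laurent_var \<gamma>) = cross k l"
      using u.laurent_eval_var u_point_diag_class[OF kl(1,3)] kl(4) by simp
    then show ?thesis
      using moebius(2)[OF P n h kl(1,2) k0] by (simp add: poly_eval_hom poly_det_complex)
  qed
  ultimately show ?thesis unfolding represented_def by blast
qed

lemma represented_monomial:
  assumes "Poly_Mapping.keys m \<subseteq> Pi_C n"
  shows "\<exists>A B. represented (Poly_Mapping.single m 1) A B \<and> nondegenerate A"
  using assms
proof (induction m rule: frag_induction)
  case zero
  have "represented 1 1 1" using represented_const[of 1] by simp
  then show ?case using nondegenerate_one by auto
next
  case (one \<gamma>)
  then show ?case using represented_var[of \<gamma>] by (simp add: laurent_var_def)
next
  case (diff a b)
  then obtain A B A' B' where AB: "represented (Poly_Mapping.single a 1) A B" "nondegenerate A"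
    "represented (Poly_Mapping.single b 1) A' B'" "nondegenerate A'" by blast
  have "represented (Poly_Mapping.single (- b) 1) B' A'"
    by (rule represented_inverse[OF AB(3,4)]) (simp add: mult_single)
  from represented_mult[OF AB(1) this] have "represented (Poly_Mapping.single (a - b) 1) (A * B') (B * A')"
    by (simp add: mult_single)
  moreover have "nondegenerate B'" using AB(3) by (simp add: represented_def)
  ultimately show ?case using nondegenerate_mult[OF AB(2)] by blast
qed

lemma represented_all:
  assumes "F \<in> u_laurents"
  shows "\<exists>A B. represented F A B"
proof (rule poly_mapping_additive_induct[of _ F])
  show "\<exists>A B. represented 0 A B" using represented_const[of 0] by auto
next
  fix m c assume "m \<in> Poly_Mapping.keys F"
  then have "Poly_Mapping.keys m \<subseteq> Pi_C n" using assms by (simp add: laurent_algebra_carrier)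
  then obtain A B where "represented (Poly_Mapping.single m 1) A B" using represented_monomial by blast
  from represented_mult[OF represented_const[of c] this]
  show "\<exists>A B. represented (Poly_Mapping.single m c) A B" by (auto simp: mult_single)
next
  fix x y assume "\<exists>A B. represented x A B" "\<exists>A B. represented y A B"
  then show "\<exists>A B. represented (x + y) A B" using represented_add by blast
qed

theorem kernel_in_relation_ideal:
  assumes F: "F \<in> u_laurents"
    and vanish: "\<And>z. admissible n z \<Longrightarrow> u_value z F = 0"
  shows "F \<in> relation_ideal"
proof -
  obtain A B where AB: "represented F A B" using represented_all[OF F] by blast
  define K where "K = {(k, l). k < l \<and> l \<le> 2 * h \<and> (k, l) \<noteq> (0, 2 * h)}"
  have "K \<subseteq> {..2 * h} \<times> {..2 * h}" unfolding K_def by auto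
  then have fin: "finite K" by (rule finite_subset) simp
  define D where "D = (\<Prod>(k, l)\<in>K. poly_det k l)"
  have D: "nondegenerate D"
  proof -
    have "nondegenerate (\<Prod>(k, l)\<in>K'. poly_det k l)" if "finite K'" "K' \<subseteq> K" for K'
      using that
      by (induction K' rule: finite_induct)
        (auto simp: nondegenerate_one K_def intro!: nondegenerate_mult nondegenerate_poly_det)
    then show ?thesis unfolding D_def using fin by blast
  qed
  \<comment> \<open>Outside general position nothing is known about \<open>A\<close>, but there one
    of the determinants in \<open>D\<close> vanishes. An identity at all points is what makes
    \<open>A * D\<close> the zero polynomial.\<close>
  have "poly_eval P (A * D) = 0" for P
  proof (cases "general_position h P")
    case True
    then have "poly_eval P A = u_at P F * poly_eval P B"
      using AB unfolding represented_def by simp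
    then show ?thesis using vanish[OF moebius(1)[OF True n h]] by (simp add: poly_eval_hom)
  next
    case False
    then obtain k l where "(k, l) \<in> K" "vertex_det h P (P 0) k l = 0"
      unfolding general_position_def K_def by blast
    then have "poly_eval P D = 0"
      unfolding D_def poly_eval_hom using fin
      by (intro prod_zero) (auto intro!: bexI[of _ "(k, l)"] simp: poly_det_complex)
    then show ?thesis by (simp add: poly_eval_hom)
  qed
  then have AD: "A * D = 0" by (rule poly_eval_eq_zero_imp)
  obtain v w where v: "J.cong (v * ring_eval D) 1" and w: "J.cong (w * ring_eval B) 1"
    using D AB unfolding represented_def nondegenerate_def by blast
  have "J.cong (F * 1 * 1) (F * (w * ring_eval B) * (v * ring_eval D))"
    by (intro J.cong_mult J.cong_refl J.cong_sym[OF w] J.cong_sym[OF v])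
  also have "F * (w * ring_eval B) * (v * ring_eval D) = (F * ring_eval B) * (w * v * ring_eval D)"
    by (simp only: mult_ac)
  also have "J.cong \<dots> (ring_eval A * (w * v * ring_eval D))"
    using AB unfolding represented_def by (intro J.cong_mult J.cong_refl) auto
  also have "ring_eval A * (w * v * ring_eval D) = w * v * ring_eval (A * D)"
    by (simp only: ring_eval_hom mult_ac)
  also have "\<dots> = 0" unfolding AD by (simp add: ring_eval_hom)
  finally have "J.cong F 0" by simp
  then show ?thesis using relation_congruence_iff[OF F] by (simp add: J.cong_zero_iff)
qed

end

section \<open>Regular functions of the cross ratios\<close>

locale function_algebra =
  fixes S :: "('x \<Rightarrow> complex) set"
  assumes const: "(\<lambda>_. c) \<in> S"
    and add: "f \<in> S \<Longrightarrow> g \<in> S \<Longrightarrow> (\<lambda>z. f z + g z) \<in> S"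
    and mult: "f \<in> S \<Longrightarrow> g \<in> S \<Longrightarrow> (\<lambda>z. f z * g z) \<in> S"
begin

lemma scale: "f \<in> S \<Longrightarrow> (\<lambda>z. c * f z) \<in> S"
  by (rule mult[OF const])

lemma uminus: "f \<in> S \<Longrightarrow> (\<lambda>z. - f z) \<in> S"
  using scale[of f "-1"] by simp

lemma diff: "f \<in> S \<Longrightarrow> g \<in> S \<Longrightarrow> (\<lambda>z. f z - g z) \<in> S"
  using add[OF _ uminus, of f g] by simp

lemma power: "f \<in> S \<Longrightarrow> (\<lambda>z. f z ^ k) \<in> S"
  by (induction k) (simp_all add: const mult)

lemma prod: "(\<And>i. i \<in> I \<Longrightarrow> f i \<in> S) \<Longrightarrow> (\<lambda>z. \<Prod>i\<in>I. f i z) \<in> S"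
  by (induction I rule: infinite_finite_induct) (simp_all add: const mult)

lemma power_int: "f \<in> S \<Longrightarrow> (\<lambda>z. inverse (f z)) \<in> S \<Longrightarrow> (\<lambda>z. f z powi k) \<in> S"
  unfolding power_int_def by (cases "k \<ge> 0") (simp_all add: power)

lemma poly_eval_mem:
  assumes "\<And>i. i \<in> V \<Longrightarrow> (\<lambda>z. x z i) \<in> S" "\<forall>m\<in>Poly_Mapping.keys p. Poly_Mapping.keys m \<subseteq> V"
  shows "(\<lambda>z. poly_eval (x z) p) \<in> S"
proof (rule poly_mapping_additive_induct[of _ p])
  fix m c assume "m \<in> Poly_Mapping.keys p"
  then have "(\<lambda>z. \<Prod>i\<in>Poly_Mapping.keys m. x z i ^ Poly_Mapping.lookup m i) \<in> S"
    using assms by (intro prod power) auto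
  then have "(\<lambda>z. c * (\<Prod>i\<in>Poly_Mapping.keys m. x z i ^ Poly_Mapping.lookup m i)) \<in> S"
    by (rule scale)
  moreover have "poly_eval (x z) (Poly_Mapping.single m c)
      = c * (\<Prod>i\<in>Poly_Mapping.keys m. x z i ^ Poly_Mapping.lookup m i)" for z
    by (simp add: poly_eval_def)
  ultimately show "(\<lambda>z. poly_eval (x z) (Poly_Mapping.single m c)) \<in> S" by simp
qed (simp_all add: poly_eval_hom const add)

end

definition vars_in :: "'v set \<Rightarrow> 'v polynomial \<Rightarrow> bool" where
  "vars_in V p \<longleftrightarrow> (\<forall>m\<in>Poly_Mapping.keys p. Poly_Mapping.keys m \<subseteq> V)"

lemma vars_in_single: "vars_in V (Poly_Mapping.single 0 c)" "vars_in V 1" "v \<in> V \<Longrightarrow> vars_in V (poly_var v)"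
  by (auto simp: vars_in_def poly_var_def)

lemma vars_in_add: "vars_in V p \<Longrightarrow> vars_in V q \<Longrightarrow> vars_in V (p + q)"
  using keys_add[of p q] unfolding vars_in_def by blast

lemma vars_in_diff: "vars_in V p \<Longrightarrow> vars_in V q \<Longrightarrow> vars_in V (p - q)"
  using keys_diff[of p q] unfolding vars_in_def by blast

lemma vars_in_mult:
  assumes "vars_in V p" "vars_in V q"
  shows "vars_in V (p * q)"
  unfolding vars_in_def
proof
  fix m assume "m \<in> Poly_Mapping.keys (p * q)"
  then obtain a b where "a \<in> Poly_Mapping.keys p" "b \<in> Poly_Mapping.keys q" "m = a + b"
    using keys_mult[of p q] by blast
  then show "Poly_Mapping.keys m \<subseteq> V"
    using assms keys_add[of a b] unfolding vars_in_def by blast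
qed

lemma vars_in_prod: "(\<And>i. i \<in> I \<Longrightarrow> vars_in V (f i)) \<Longrightarrow> vars_in V (prod f I)"
  by (induction I rule: infinite_finite_induct) (simp_all add: vars_in_single vars_in_mult)

lemma vars_in_power: "vars_in V p \<Longrightarrow> vars_in V (p ^ k)"
  by (induction k) (simp_all add: vars_in_single vars_in_mult)

text \<open>Plain divisibility would not bound the variables of the cofactor, which becomes the
  numerator of an inverse in \<open>regular_inverse\<close>.\<close>

definition dvd_in :: "'v set \<Rightarrow> 'v polynomial \<Rightarrow> 'v polynomial \<Rightarrow> bool" where
  "dvd_in V p q \<longleftrightarrow> (\<exists>r. vars_in V r \<and> q = p * r)"

lemma dvd_in_mult: "dvd_in V p q \<Longrightarrow> vars_in V r \<Longrightarrow> dvd_in V p (q * r)" "dvd_in V p q \<Longrightarrow> vars_in V r \<Longrightarrow> dvd_in V p (r * q)"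
proof -
  assume "dvd_in V p q" and r: "vars_in V r"
  then obtain s where s: "vars_in V s" "q = p * s" unfolding dvd_in_def by auto
  have "q * r = p * (s * r)" "r * q = p * (s * r)" using s(2) by (simp_all add: mult_ac)
  then show "dvd_in V p (q * r)" "dvd_in V p (r * q)"
    unfolding dvd_in_def using vars_in_mult[OF s(1) r] by auto
qed

lemma dvd_in_prod:
  assumes "finite I" "i \<in> I" "\<And>j. j \<in> I \<Longrightarrow> vars_in V (f j)" "dvd_in V p (f i)"
  shows "dvd_in V p (prod f I)"
  using assms by (subst prod.remove[OF assms(1,2)]) (intro dvd_in_mult vars_in_prod, auto)

lemma dvd_in_refl: "dvd_in V p p"
  unfolding dvd_in_def by (rule exI[of _ 1]) (simp add: vars_in_single)

section \<open>Regular functions on the space of configurations and their units\<close>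

context type_C
begin

definition forms_poly :: "nat polynomial" where
  "forms_poly = (\<Prod>j\<in>{1..n}. \<Prod>i\<in>{1..<j}. (poly_var i - poly_var j) * (poly_var i + poly_var j)) *
     (\<Prod>i\<in>{1..n}. (1 - poly_var i) * (1 + poly_var i) * poly_var i)"

lemma forms_poly_eval: "poly_eval z forms_poly = Z_forms_product n z"
  by (simp add: forms_poly_def Z_forms_product_def poly_eval_hom)

lemma Z_forms_product_nonzero: "admissible n z \<Longrightarrow> Z_forms_product n z \<noteq> 0"
  unfolding Z_forms_product_def admissible_def by (auto simp: prod_zero_iff)

lemma vars_in_linear:
  "i \<in> {1..n} \<Longrightarrow> j \<in> {1..n} \<Longrightarrow> vars_in {1..n} ((poly_var i - poly_var j) * (poly_var i + poly_var j))"
  "i \<in> {1..n} \<Longrightarrow> vars_in {1..n} ((1 - poly_var i) * (1 + poly_var i) * poly_var i)"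
  by (intro vars_in_mult vars_in_add vars_in_diff vars_in_single; simp)+

lemma vars_in_forms_poly: "vars_in {1..n} forms_poly"
  unfolding forms_poly_def
  by (intro vars_in_mult[of _ "prod _ _" "prod _ _"] vars_in_prod vars_in_linear) auto

definition regular_functions :: "((nat \<Rightarrow> complex) \<Rightarrow> complex) set" where
  "regular_functions = {g. \<exists>p k. vars_in {1..n} p \<and>
     (\<forall>z. admissible n z \<longrightarrow> g z = poly_eval z p / Z_forms_product n z ^ k)}"

lemma regular_poly:
  assumes "vars_in {1..n} p" "\<And>z. admissible n z \<Longrightarrow> g z = poly_eval z p"
  shows "g \<in> regular_functions"
  unfolding regular_functions_def using assms by (intro CollectI exI[of _ p] exI[of _ 0]) simp

lemma regular_inverse:
  assumes "dvd_in {1..n} p forms_poly" "\<And>z. admissible n z \<Longrightarrow> g z = poly_eval z p"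
  shows "(\<lambda>z. inverse (g z)) \<in> regular_functions"
proof -
  obtain r where r: "vars_in {1..n} r" "forms_poly = p * r" using assms(1) unfolding dvd_in_def by blast
  have "inverse (g z) = poly_eval z r / Z_forms_product n z ^ 1" if "admissible n z" for z
  proof -
    have "poly_eval z p * poly_eval z r = Z_forms_product n z"
      using r(2) forms_poly_eval[of z] by (simp add: poly_eval_hom)
    moreover from this have "poly_eval z p \<noteq> 0" "poly_eval z r \<noteq> 0"
      using Z_forms_product_nonzero[OF that] by auto
    ultimately show ?thesis
      unfolding assms(2)[OF that] by (simp add: divide_simps flip: \<open>_ = Z_forms_product n z\<close>)
  qed
  then show ?thesis unfolding regular_functions_def using r(1) by blast
qed

sublocale regular: function_algebra regular_functions
proof
  show "(\<lambda>_. c) \<in> regular_functions" for c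
    by (rule regular_poly[of "Poly_Mapping.single 0 c"]) (simp_all add: vars_in_single poly_eval_hom)
next
  fix f g assume "f \<in> regular_functions" "g \<in> regular_functions"
  then obtain p k q l where p: "vars_in {1..n} p" "\<And>z. admissible n z \<Longrightarrow> f z = poly_eval z p / Z_forms_product n z ^ k"
    and q: "vars_in {1..n} q" "\<And>z. admissible n z \<Longrightarrow> g z = poly_eval z q / Z_forms_product n z ^ l"
    unfolding regular_functions_def by blast
  have power: "poly_eval z (forms_poly ^ k) = Z_forms_product n z ^ k" for z k
    by (induction k) (simp_all add: poly_eval_hom forms_poly_eval)
  have "f z + g z = poly_eval z (p * forms_poly ^ l + q * forms_poly ^ k) / Z_forms_product n z ^ (k + l)"
    if "admissible n z" for z
    using Z_forms_product_nonzero[OF that]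
    by (simp add: p(2)[OF that] q(2)[OF that] poly_eval_hom power power_add add_frac_eq)
  moreover have "vars_in {1..n} (p * forms_poly ^ l + q * forms_poly ^ k)"
    by (intro vars_in_add vars_in_mult vars_in_power p q vars_in_forms_poly)
  ultimately show "(\<lambda>z. f z + g z) \<in> regular_functions"
    unfolding regular_functions_def by blast
  have "f z * g z = poly_eval z (p * q) / Z_forms_product n z ^ (k + l)" if "admissible n z" for z
    by (simp add: p(2)[OF that] q(2)[OF that] poly_eval_hom power_add)
  then show "(\<lambda>z. f z * g z) \<in> regular_functions"
    unfolding regular_functions_def using vars_in_mult[OF p(1) q(1)] by blast
qed

definition regular_unit :: "((nat \<Rightarrow> complex) \<Rightarrow> complex) \<Rightarrow> bool" where
  "regular_unit g \<longleftrightarrow> g \<in> regular_functions \<and> (\<lambda>z. inverse (g z)) \<in> regular_functions"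

lemma regular_unit_mult: "regular_unit f \<Longrightarrow> regular_unit g \<Longrightarrow> regular_unit (\<lambda>z. f z * g z)"
  unfolding regular_unit_def by (simp add: regular.mult inverse_mult_distrib)

lemma regular_unit_divide: "regular_unit f \<Longrightarrow> regular_unit g \<Longrightarrow> regular_unit (\<lambda>z. f z / g z)"
  unfolding regular_unit_def by (auto simp: divide_inverse inverse_mult_distrib intro!: regular.mult)

text \<open>The constant 0 is included because \<open>inverse 0 = 0\<close>;
  \<open>regular_unit\<close> only says that a function and its total inverse are both
  regular.\<close>

lemma regular_unit_const: "regular_unit (\<lambda>_. c)"
  unfolding regular_unit_def by (simp add: regular.const)

lemma regular_unit_scale: "regular_unit f \<Longrightarrow> regular_unit (\<lambda>z. c * f z)"
  by (rule regular_unit_mult[OF regular_unit_const])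

lemma regular_unit_dvd:
  assumes "dvd_in {1..n} p forms_poly" "vars_in {1..n} p" "\<And>z. admissible n z \<Longrightarrow> g z = poly_eval z p"
  shows "regular_unit g"
  unfolding regular_unit_def using regular_poly[OF assms(2,3)] regular_inverse[OF assms(1,3)] by blast

lemma regular_unit_linear_form: "linear_form n L \<Longrightarrow> regular_unit L"
proof -
  have pair: "dvd_in {1..n} p forms_poly"
    if ij: "1 \<le> i" "i < j" "j \<le> n" and p: "dvd_in {1..n} p ((poly_var i - poly_var j) * (poly_var i + poly_var j))" for p i j
    unfolding forms_poly_def
  proof (intro dvd_in_mult(1) vars_in_prod vars_in_linear)
    show "dvd_in {1..n} p (\<Prod>j\<in>{1..n}. \<Prod>i\<in>{1..<j}. (poly_var i - poly_var j) * (poly_var i + poly_var j))"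
    proof (rule dvd_in_prod[of _ j])
      show "dvd_in {1..n} p (\<Prod>i\<in>{1..<j}. (poly_var i - poly_var j) * (poly_var i + poly_var j))"
        by (rule dvd_in_prod[of _ i]) (use ij p in \<open>auto simp del: One_nat_def intro!: vars_in_linear\<close>)
    qed (use ij in \<open>auto simp del: One_nat_def intro!: vars_in_prod vars_in_linear\<close>)
  qed
  have single: "dvd_in {1..n} p forms_poly"
    if i: "1 \<le> i" "i \<le> n" and p: "dvd_in {1..n} p ((1 - poly_var i) * (1 + poly_var i) * poly_var i)" for p i
    unfolding forms_poly_def
  proof (intro dvd_in_mult(2) vars_in_prod vars_in_linear)
    show "dvd_in {1..n} p (\<Prod>i\<in>{1..n}. (1 - poly_var i) * (1 + poly_var i) * poly_var i)"
      by (rule dvd_in_prod[of _ i]) (use i p in \<open>auto simp del: One_nat_def intro!: vars_in_linear\<close>)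
  qed (auto simp del: One_nat_def)
  {
    fix i j :: nat assume ij: "1 \<le> i" "i < j" "j \<le> n"
    then have v: "vars_in {1..n} (poly_var i - poly_var j)" "vars_in {1..n} (poly_var i + poly_var j)"
      by (intro vars_in_add vars_in_diff vars_in_single; simp)+
    have "regular_unit (\<lambda>z. z i - z j)"
      by (rule regular_unit_dvd[OF pair[OF ij dvd_in_mult(1)[OF dvd_in_refl v(2)]] v(1)])
        (simp add: poly_eval_hom)
    moreover have "regular_unit (\<lambda>z. z i + z j)"
      by (rule regular_unit_dvd[OF pair[OF ij dvd_in_mult(2)[OF dvd_in_refl v(1)]] v(2)])
        (simp add: poly_eval_hom)
    ultimately have "regular_unit (\<lambda>z. z i - z j)" "regular_unit (\<lambda>z. z i + z j)" .
  }
  note pairs = this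
  {
    fix i :: nat assume i: "1 \<le> i" "i \<le> n"
    then have v: "vars_in {1..n} (1 - poly_var i)" "vars_in {1..n} (1 + poly_var i)" "vars_in {1..n} (poly_var i)"
      by (intro vars_in_add vars_in_diff vars_in_single; simp)+
    have "regular_unit (\<lambda>z. 1 - z i)"
      by (rule regular_unit_dvd[OF single[OF i dvd_in_mult(1)[OF dvd_in_mult(1)[OF dvd_in_refl v(2)] v(3)]] v(1)])
        (simp add: poly_eval_hom)
    moreover have "regular_unit (\<lambda>z. 1 + z i)"
      by (rule regular_unit_dvd[OF single[OF i dvd_in_mult(1)[OF dvd_in_mult(2)[OF dvd_in_refl v(1)] v(3)]] v(2)])
        (simp add: poly_eval_hom)
    moreover have "regular_unit (\<lambda>z. z i)"
      by (rule regular_unit_dvd[OF single[OF i dvd_in_mult(2)[OF dvd_in_refl vars_in_mult[OF v(1,2)]]] v(3)])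
        (simp add: poly_eval_hom)
    ultimately have "regular_unit (\<lambda>z. 1 - z i)" "regular_unit (\<lambda>z. 1 + z i)" "regular_unit (\<lambda>z. z i)" .
  }
  note singles = this
  show "linear_form n L \<Longrightarrow> regular_unit L"
    by (induction rule: linear_form.induct) (simp_all add: pairs singles regular_unit_const)
qed

lemma regular_unit_signed_point:
  assumes "1 \<le> a" "a < b" "b \<le> 2 * h"
  shows "regular_unit (\<lambda>z. signed_point h z a - signed_point h z b)"
proof (rule signed_point_diff[OF h assms])
  fix c L
  assume "linear_form n L" and eq: "\<And>z. signed_point h z a - signed_point h z b = c * L z"
  then show ?thesis unfolding eq by (intro regular_unit_scale regular_unit_linear_form)
qed

lemma regular_unit_vertex_point:
  assumes "vertex h k \<noteq> vertex h l"
  shows "regular_unit (\<lambda>z. vertex_point h z k - vertex_point h z l)"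
proof (cases "vertex h k < vertex h l")
  case True
  then show ?thesis
    using regular_unit_signed_point[of "vertex h k" "vertex h l"] vertex_range[OF h1] by (simp add: vertex_point_def)
next
  case False
  then show ?thesis
    using regular_unit_scale[OF regular_unit_signed_point[of "vertex h l" "vertex h k"], of "-1"]
      vertex_range[OF h1] assms by (simp add: vertex_point_def)
qed

lemma regular_functions_cong:
  "f \<in> regular_functions \<Longrightarrow> (\<And>z. admissible n z \<Longrightarrow> f z = g z) \<Longrightarrow> g \<in> regular_functions"
  unfolding regular_functions_def by fastforce

abbreviation cross_at :: "(nat \<Rightarrow> complex) \<Rightarrow> nat \<Rightarrow> nat \<Rightarrow> complex" where
  "cross_at z \<equiv> symmetric_points.cross (vertex_point h z)"

lemma regular_u_value:
  assumes F: "F \<in> u_laurents"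
  shows "(\<lambda>z. u_value z F) \<in> regular_functions"
proof -
  have var: "regular_unit (\<lambda>z. class_value h (cross_at z) \<gamma>)" if \<gamma>: "\<gamma> \<in> Pi_C n" for \<gamma>
  proof -
    obtain k l where kl: "k + 2 \<le> l" "l + 2 \<le> k + 2 * h" "\<gamma> = diag_class h k l"
      using \<gamma> unfolding Pi_eq by (rule diag_class_cases)
    let ?c = "\<lambda>z. (vertex_point h z k - vertex_point h z (Suc l)) * (vertex_point h z (Suc k) - vertex_point h z l)
      / ((vertex_point h z k - vertex_point h z l) * (vertex_point h z (Suc k) - vertex_point h z (Suc l)))"
    have eq: "?c z = class_value h (cross_at z) \<gamma>" if z: "admissible n z" for z
    proof -
      interpret symmetric_points h "vertex_point h z" by (rule symmetric[OF z])
      show ?thesis unfolding kl(3) u_point_diag_class[OF kl(1,2)] cross_def ..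
    qed
    have "vertex h k \<noteq> vertex h l" "vertex h k \<noteq> vertex h (Suc l)" "vertex h (Suc k) \<noteq> vertex h l"
      "vertex h (Suc k) \<noteq> vertex h (Suc l)"
      using vertex_neq[of k l h] vertex_neq[of k "Suc l" h] vertex_neq[of "Suc k" l h]
        vertex_neq[of "Suc k" "Suc l" h] kl(1,2) h1 by auto
    then have "regular_unit ?c"
      by (intro regular_unit_divide regular_unit_mult regular_unit_vertex_point)
    then have "?c \<in> regular_functions" "(\<lambda>z. inverse (?c z)) \<in> regular_functions"
      unfolding regular_unit_def by blast+
    then show ?thesis
      unfolding regular_unit_def
      by (intro conjI; elim regular_functions_cong) (simp_all only: eq)
  qed
  have mono: "(\<lambda>z. int_monomial (class_value h (cross_at z)) m) \<in> regular_functions"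
    if "m \<in> Poly_Mapping.keys F" for m
    unfolding int_monomial_def using F var that
    by (intro regular.prod regular.power_int) (auto simp: laurent_algebra_carrier regular_unit_def)
  have "(\<lambda>z. \<Sum>m\<in>K. Poly_Mapping.lookup F m * int_monomial (class_value h (cross_at z)) m) \<in> regular_functions"
    if "finite K" "K \<subseteq> Poly_Mapping.keys F" for K
    using that by (induction K rule: finite_induct) (simp_all add: regular.const regular.add regular.scale mono)
  from this[OF finite_keys subset_refl] show ?thesis by (simp add: laurent_eval_def)
qed

lemma admissible_inversion: "admissible n z \<Longrightarrow> admissible n (\<lambda>i. 1 / z i)"
  unfolding admissible_def
proof (intro conjI allI impI; elim conjE)
  assume z: "\<forall>i j. 1 \<le> i \<and> i < j \<and> j \<le> n \<longrightarrow> z i - z j \<noteq> 0 \<and> z i + z j \<noteq> 0"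
    "\<forall>i. 1 \<le> i \<and> i \<le> n \<longrightarrow> 1 - z i \<noteq> 0 \<and> 1 + z i \<noteq> 0 \<and> z i \<noteq> 0"
  {
    fix i j assume ij: "1 \<le> i" "i < j" "j \<le> n"
    then have "z i \<noteq> 0" "z j \<noteq> 0" "z i - z j \<noteq> 0" "z i + z j \<noteq> 0" using z by auto
    moreover from this have "1 / z i - 1 / z j = - (z i - z j) / (z i * z j)"
      "1 / z i + 1 / z j = (z i + z j) / (z i * z j)"
      by (simp_all add: divide_simps)
    ultimately show "1 / z i - 1 / z j \<noteq> 0" "1 / z i + 1 / z j \<noteq> 0" by simp_all
  }
  {
    fix i assume "1 \<le> i" "i \<le> n"
    then have "z i \<noteq> 0" "1 - z i \<noteq> 0" "1 + z i \<noteq> 0" using z by auto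
    moreover from this have "1 - 1 / z i = - (1 - z i) / z i" "1 + 1 / z i = (1 + z i) / z i"
      by (simp_all add: divide_simps)
    ultimately show "1 - 1 / z i \<noteq> 0" "1 + 1 / z i \<noteq> 0" "1 / z i \<noteq> 0" by simp_all
  }
qed

text \<open>Inversion is a Moebius transformation that commutes with negation and fixes 1 and -1, so
  it acts on the whole symmetric configuration at once.\<close>

lemma u_value_inversion:
  assumes z: "admissible n z"
  shows "u_value (\<lambda>i. 1 / z i) F = u_value z F"
proof -
  interpret symmetric_points h "vertex_point h z" by (rule symmetric[OF z])
  have nz: "vertex_point h z k \<noteq> 0" for k
    using distinct[of k "k + h"] opposite[of k] h1 by auto
  have inv: "vertex_point h (\<lambda>i. 1 / z i) k = 1 / vertex_point h z k" for k
    by (simp add: vertex_point_def signed_point_def)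
  have "symmetric_points.cross (vertex_point h (\<lambda>i. 1 / z i)) k l = cross k l" for k l
  proof -
    have "(1 / a - 1 / d) * (1 / b - 1 / c) / ((1 / a - 1 / c) * (1 / b - 1 / d)) = (a - d) * (b - c) / ((a - c) * (b - d))"
      if "a \<noteq> 0" "b \<noteq> 0" "c \<noteq> 0" "d \<noteq> 0" for a b c d :: complex
    proof -
      have e: "1 / x - 1 / y = (y - x) / (x * y)" if "x \<noteq> 0" "y \<noteq> 0" for x y :: complex
        using that by (simp add: divide_simps)
      have "(1 / a - 1 / d) * (1 / b - 1 / c) / ((1 / a - 1 / c) * (1 / b - 1 / d))
          = ((d - a) * (c - b)) / ((c - a) * (d - b))"
        using that by (simp add: e)
      also have "\<dots> = (a - d) * (b - c) / ((a - c) * (b - d))"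
        using minus_mult_minus[of "a - d" "b - c"] minus_mult_minus[of "a - c" "b - d"] by simp
      finally show ?thesis .
    qed
    then show ?thesis
      using nz unfolding symmetric_points.cross_def[OF symmetric[OF admissible_inversion[OF z]]] cross_def inv
      by simp
  qed
  then have "symmetric_points.cross (vertex_point h (\<lambda>i. 1 / z i)) = cross" by (intro ext)
  then show ?thesis by simp
qed

section \<open>Functions given by Laurent polynomials in the cross ratios\<close>

definition pure_functions :: "((nat \<Rightarrow> complex) \<Rightarrow> complex) set" where
  "pure_functions = {g. \<exists>F\<in>u_laurents. \<forall>z. admissible n z \<longrightarrow> g z = u_value z F}"

lemma pure_functions_cong:
  "f \<in> pure_functions \<Longrightarrow> (\<And>z. admissible n z \<Longrightarrow> f z = g z) \<Longrightarrow> g \<in> pure_functions"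
  unfolding pure_functions_def by fastforce

lemma pure_u_value: "F \<in> u_laurents \<Longrightarrow> (\<lambda>z. u_value z F) \<in> pure_functions"
  unfolding pure_functions_def by blast

sublocale pure: function_algebra pure_functions
proof
  show "(\<lambda>_. c) \<in> pure_functions" for c
    by (rule pure_functions_cong[OF pure_u_value[of "Poly_Mapping.single 0 c"]])
      (simp_all add: laurent_algebra_closed u_value_hom)
next
  fix f g assume "f \<in> pure_functions" "g \<in> pure_functions"
  then obtain F G where F: "F \<in> u_laurents" "\<And>z. admissible n z \<Longrightarrow> f z = u_value z F"
    and G: "G \<in> u_laurents" "\<And>z. admissible n z \<Longrightarrow> g z = u_value z G"
    unfolding pure_functions_def by blast
  show "(\<lambda>z. f z + g z) \<in> pure_functions"
    by (rule pure_functions_cong[OF pure_u_value[of "F + G"]])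
      (simp_all add: laurent_algebra_closed F G u_value_hom)
  show "(\<lambda>z. f z * g z) \<in> pure_functions"
    by (rule pure_functions_cong[OF pure_u_value[of "F * G"]])
      (simp_all add: laurent_algebra_closed F G u_value_hom)
qed

definition pure_unit :: "((nat \<Rightarrow> complex) \<Rightarrow> complex) \<Rightarrow> bool" where
  "pure_unit g \<longleftrightarrow> g \<in> pure_functions \<and> (\<lambda>z. inverse (g z)) \<in> pure_functions"

lemma pure_unit_cong: "pure_unit f \<Longrightarrow> (\<And>z. admissible n z \<Longrightarrow> f z = g z) \<Longrightarrow> pure_unit g"
  unfolding pure_unit_def
  using pure_functions_cong[of f g] pure_functions_cong[of "\<lambda>z. inverse (f z)" "\<lambda>z. inverse (g z)"] by simp

lemma pure_unit_mult: "pure_unit f \<Longrightarrow> pure_unit g \<Longrightarrow> pure_unit (\<lambda>z. f z * g z)"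
  unfolding pure_unit_def by (simp add: pure.mult inverse_mult_distrib)

lemma pure_unit_scale: "pure_unit f \<Longrightarrow> pure_unit (\<lambda>z. c * f z)"
  unfolding pure_unit_def by (simp add: pure.scale inverse_mult_distrib)

lemma pure_unit_cross:
  assumes "k + 2 \<le> l" "l + 2 \<le> k + 2 * h"
  shows "pure_unit (\<lambda>z. cross_at z k l)"
proof -
  let ?\<gamma> = "diag_class h k l"
  have \<gamma>: "?\<gamma> \<in> Pi_C n" unfolding Pi_eq using diag_class_in[OF assms h1] .
  have "u_value z (laurent_var ?\<gamma>) = cross_at z k l
      \<and> u_value z (Poly_Mapping.single (Poly_Mapping.single ?\<gamma> (- 1)) 1) = inverse (cross_at z k l)"
    if z: "admissible n z" for z
  proof -
    interpret symmetric_points h "vertex_point h z" by (rule symmetric[OF z])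
    show ?thesis
      using u.laurent_eval_var[of ?\<gamma>] u_point_diag_class[OF assms]
      by (simp add: u.laurent_eval_eq u.eval_at_single int_monomial_def power_int_minus)
  qed
  then show ?thesis
    unfolding pure_unit_def
    using pure_functions_cong[OF pure_u_value[OF laurent_var_closed[OF \<gamma>]], of "\<lambda>z. cross_at z k l"]
      pure_functions_cong[OF pure_u_value[OF laurent_algebra_closed(8)[OF \<gamma>, of "-1"]], of "\<lambda>z. inverse (cross_at z k l)"]
    by simp
qed

lemma pure_unit_block_prod:
  assumes "a \<le> b" "b < c" "c \<le> d" "d < a + 2 * h"
  shows "pure_unit (\<lambda>z. block_prod (cross_at z) a b c d)"
proof -
  have "pure_unit (\<lambda>z. cross_at z k l)" if "k \<in> {a..<b}" "l \<in> {c..<d}" for k l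
    by (rule pure_unit_cross) (use that assms in auto)
  then have "(\<lambda>z. \<Prod>k\<in>{a..<b}. \<Prod>l\<in>{c..<d}. cross_at z k l) \<in> pure_functions"
    "(\<lambda>z. \<Prod>k\<in>{a..<b}. \<Prod>l\<in>{c..<d}. inverse (cross_at z k l)) \<in> pure_functions"
    unfolding pure_unit_def by (auto intro!: pure.prod)
  then show ?thesis unfolding pure_unit_def block_prod_def by (simp flip: prod_inversef)
qed

text \<open>
  Two antipodal pairs of vertices have the cross ratios \<open>(z\<^sub>i \<plusminus> z\<^sub>j)\<^sup>2 / (4 z\<^sub>i z\<^sub>j)\<close>, up to sign.
\<close>

lemma pure_unit_square:
  assumes ij: "1 \<le> i" "i < j" "j \<le> h"
  shows "pure_unit (\<lambda>z. (vertex_point h z i + vertex_point h z j)\<^sup>2 / (vertex_point h z i * vertex_point h z j))"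
    and "pure_unit (\<lambda>z. (vertex_point h z i - vertex_point h z j)\<^sup>2 / (vertex_point h z i * vertex_point h z j))"
proof -
  have *: "4 * block_prod (cross_at z) i j (i + h) (j + h)
      = (vertex_point h z i + vertex_point h z j)\<^sup>2 / (vertex_point h z i * vertex_point h z j)
    \<and> - 4 * block_prod (cross_at z) j (i + h) (j + h) (i + 2 * h)
      = (vertex_point h z i - vertex_point h z j)\<^sup>2 / (vertex_point h z i * vertex_point h z j)"
    if z: "admissible n z" for z
  proof -
    interpret symmetric_points h "vertex_point h z" by (rule symmetric[OF z])
    let ?a = "vertex_point h z i" and ?b = "vertex_point h z j"
    have ne: "?a \<noteq> 0" "?b \<noteq> 0"
      using distinct[of i "i + h"] distinct[of j "j + h"] opposite[of i] opposite[of j] h1 by auto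
    have "block_prod (cross_at z) i j (i + h) (j + h) = (?a + ?b) * (?b + ?a) / ((?a + ?a) * (?b + ?b))"
      using block_prod_cross[of i j "i + h" "j + h"] ij by (simp add: opposite)
    moreover have "block_prod (cross_at z) j (i + h) (j + h) (i + 2 * h)
        = (?b - ?a) * (- ?a + ?b) / ((?b + ?b) * (- ?a - ?a))"
      using block_prod_cross[of j "i + h" "j + h" "i + 2 * h"] ij by (simp add: opposite points_period)
    ultimately show ?thesis
      using ne by (simp add: power2_eq_square divide_simps) (simp add: algebra_simps)
  qed
  have "pure_unit (\<lambda>z. 4 * block_prod (cross_at z) i j (i + h) (j + h))"
    "pure_unit (\<lambda>z. - 4 * block_prod (cross_at z) j (i + h) (j + h) (i + 2 * h))"
    by (intro pure_unit_scale pure_unit_block_prod; use ij in simp)+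
  then show "pure_unit (\<lambda>z. (vertex_point h z i + vertex_point h z j)\<^sup>2 / (vertex_point h z i * vertex_point h z j))"
    "pure_unit (\<lambda>z. (vertex_point h z i - vertex_point h z j)\<^sup>2 / (vertex_point h z i * vertex_point h z j))"
    by (elim pure_unit_cong; use * in simp)+
qed

lemma vertex_point_simps: "1 \<le> i \<Longrightarrow> i < h \<Longrightarrow> vertex_point h z i = z i" "vertex_point h z h = 1"
  using h1 by (simp_all add: vertex_point_def signed_point_def)

lemma pure_unit_squares:
  assumes i: "1 \<le> i" "i < h"
  shows "i < j \<Longrightarrow> j < h \<Longrightarrow> pure_unit (\<lambda>z. (z i + z j)\<^sup>2 / (z i * z j))"
    "i < j \<Longrightarrow> j < h \<Longrightarrow> pure_unit (\<lambda>z. (z i - z j)\<^sup>2 / (z i * z j))"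
    "pure_unit (\<lambda>z. (z i + 1)\<^sup>2 / z i)" "pure_unit (\<lambda>z. (z i - 1)\<^sup>2 / z i)"
  using pure_unit_square[of i j] pure_unit_square[of i h] i by (simp_all add: vertex_point_simps)

lemma admissible_nonzero: "admissible n z \<Longrightarrow> 1 \<le> i \<Longrightarrow> i < h \<Longrightarrow> z i \<noteq> 0"
  using h by (auto simp: admissible_def)

lemma pure_trace: "1 \<le> i \<Longrightarrow> i < h \<Longrightarrow> (\<lambda>z. z i + 1 / z i) \<in> pure_functions"
proof -
  assume i: "1 \<le> i" "i < h"
  have "(\<lambda>z. (z i + 1)\<^sup>2 / z i - 2) \<in> pure_functions"
    using pure_unit_squares(3)[OF i] by (intro pure.diff pure.const) (simp add: pure_unit_def)
  then show ?thesis
    by (rule pure_functions_cong)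
      (use admissible_nonzero[OF _ i] in \<open>simp add: field_simps power2_eq_square\<close>)
qed

text \<open>With y = z_i - 1/z_i, being a unit is stronger than y^2 being pure. For
  \<open>i = 1\<close> it permits division by y, since 1/y is y times the inverse of y^2.\<close>

lemma pure_antitrace_square: "1 \<le> i \<Longrightarrow> i < h \<Longrightarrow> pure_unit (\<lambda>z. (z i - 1 / z i) * (z i - 1 / z i))"
proof -
  assume i: "1 \<le> i" "i < h"
  have "pure_unit (\<lambda>z. (z i + 1)\<^sup>2 / z i * ((z i - 1)\<^sup>2 / z i))"
    using pure_unit_squares(3,4)[OF i] by (rule pure_unit_mult)
  then show ?thesis
    by (rule pure_unit_cong)
      (use admissible_nonzero[OF _ i] in \<open>simp add: field_simps power2_eq_square\<close>)
qed

text \<open>For distinct indices, the product of the traces \<open>z i + 1 / z i\<close> minus the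
  product of the antitraces is 2 (z_1/z_i + z_i/z_1), and this sum of ratios is the square of z_1 +
  z_i over z_1 z_i, minus 2.\<close>

lemma pure_antitrace_mult:
  assumes "1 \<le> i" "i < h"
  shows "(\<lambda>z. (z 1 - 1 / z 1) * (z i - 1 / z i)) \<in> pure_functions"
proof (cases "i = 1")
  case True
  then show ?thesis using pure_antitrace_square[of 1] h2 by (simp add: pure_unit_def)
next
  case False
  have "(\<lambda>z. (z 1 + 1 / z 1) * (z i + 1 / z i) - 2 * ((z 1 + z i)\<^sup>2 / (z 1 * z i) - 2)) \<in> pure_functions"
    using pure_unit_squares(1)[of 1 i] False assms h2
    by (intro pure.diff pure.mult pure.scale pure.const pure_trace) (simp_all add: pure_unit_def)
  then show ?thesis
    by (rule pure_functions_cong)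
      (use admissible_nonzero[of _ 1] admissible_nonzero[OF _ assms] h2 in \<open>simp add: field_simps power2_eq_square\<close>)
qed

section \<open>Splitting of regular functions into an invariant and an anti-invariant part\<close>

definition mixed_functions :: "((nat \<Rightarrow> complex) \<Rightarrow> complex) set" where
  "mixed_functions = {g. \<exists>F\<in>pure_functions. \<exists>G\<in>pure_functions.
     \<forall>z. admissible n z \<longrightarrow> g z = F z + (z 1 - 1 / z 1) * G z}"

lemma mixedI:
  "F \<in> pure_functions \<Longrightarrow> G \<in> pure_functions \<Longrightarrow>
    (\<And>z. admissible n z \<Longrightarrow> g z = F z + (z 1 - 1 / z 1) * G z) \<Longrightarrow> g \<in> mixed_functions"
  unfolding mixed_functions_def by blast

lemma pure_imp_mixed: "f \<in> pure_functions \<Longrightarrow> f \<in> mixed_functions"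
  by (rule mixedI[of f "\<lambda>_. 0"]) (simp_all add: pure.const)

lemma mixed_functions_cong:
  "f \<in> mixed_functions \<Longrightarrow> (\<And>z. admissible n z \<Longrightarrow> f z = g z) \<Longrightarrow> g \<in> mixed_functions"
  unfolding mixed_functions_def by fastforce

sublocale mixed: function_algebra mixed_functions
proof
  show "(\<lambda>_. c) \<in> mixed_functions" for c by (intro pure_imp_mixed pure.const)
next
  fix f g assume "f \<in> mixed_functions" "g \<in> mixed_functions"
  then obtain F G F' G' where pure: "F \<in> pure_functions" "G \<in> pure_functions" "F' \<in> pure_functions" "G' \<in> pure_functions"
    and f: "\<And>z. admissible n z \<Longrightarrow> f z = F z + (z 1 - 1 / z 1) * G z"
    and g: "\<And>z. admissible n z \<Longrightarrow> g z = F' z + (z 1 - 1 / z 1) * G' z"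
    unfolding mixed_functions_def by blast
  show "(\<lambda>z. f z + g z) \<in> mixed_functions"
    by (rule mixedI[OF pure.add[OF pure(1,3)] pure.add[OF pure(2,4)]]) (simp add: f g distrib_left)
  \<comment> \<open>Closure under products rests on y^2 being pure; \<open>split\<close> collects
    the terms without y and those with a single factor y.\<close>
  have y2: "(\<lambda>z. (z 1 - 1 / z 1) * (z 1 - 1 / z 1)) \<in> pure_functions"
    using pure_antitrace_square[of 1] h2 by (simp add: pure_unit_def)
  have split: "(x + y * x') * (u + y * u') = (x * u + y * y * (x' * u')) + y * (x * u' + x' * u)"
    for x y x' u u' :: complex by (simp add: algebra_simps)
  show "(\<lambda>z. f z * g z) \<in> mixed_functions"
    by (rule mixedI[of "\<lambda>z. F z * F' z + (z 1 - 1 / z 1) * (z 1 - 1 / z 1) * (G z * G' z)" "\<lambda>z. F z * G' z + G z * F' z"])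
      (use pure y2 in \<open>auto simp: f g split intro!: pure.add pure.mult\<close>)
qed

lemma mixed_coordinate:
  assumes i: "1 \<le> i" "i < h"
  shows "(\<lambda>z. z i) \<in> mixed_functions" "(\<lambda>z. 1 / z i) \<in> mixed_functions"
proof -
  \<comment> \<open>The coefficient of y is (z_i - 1/z_i)/y, written as 1/y^2 times a product
    already known to be pure.\<close>
  have y: "(\<lambda>z. inverse ((z 1 - 1 / z 1) * (z 1 - 1 / z 1)) * ((z 1 - 1 / z 1) * (z i - 1 / z i))) \<in> pure_functions"
  proof (rule pure.mult[OF _ pure_antitrace_mult[OF i]])
    have "1 < h" using h2 by simp
    from pure_antitrace_square[OF le_refl this]
    show "(\<lambda>z. inverse ((z 1 - 1 / z 1) * (z 1 - 1 / z 1))) \<in> pure_functions"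
      unfolding pure_unit_def by (rule conjunct2)
  qed
  have anti: "(\<lambda>z. z i - 1 / z i) \<in> mixed_functions"
  proof (rule mixedI[OF pure.const[of 0] y])
    fix z assume z: "admissible n z"
    have "z 1 \<noteq> 0" "z 1 - 1 \<noteq> 0" "z 1 + 1 \<noteq> 0"
      using z n unfolding admissible_def by (auto simp: add.commute)
    then have "(z 1 - 1) * (z 1 + 1) / z 1 \<noteq> 0" by simp
    moreover have "(z 1 - 1) * (z 1 + 1) / z 1 = z 1 - 1 / z 1"
      using \<open>z 1 \<noteq> 0\<close> by (simp add: field_simps)
    ultimately have "z 1 - 1 / z 1 \<noteq> 0" by metis
    then show "z i - 1 / z i = 0 + (z 1 - 1 / z 1) * (inverse ((z 1 - 1 / z 1) * (z 1 - 1 / z 1)) * ((z 1 - 1 / z 1) * (z i - 1 / z i)))"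
      by (simp add: inverse_eq_divide)
  qed
  have trace: "(\<lambda>z. z i + 1 / z i) \<in> mixed_functions" by (rule pure_imp_mixed[OF pure_trace[OF i]])
  show "(\<lambda>z. z i) \<in> mixed_functions"
    using mixed.scale[OF mixed.add[OF trace anti], of "1 / 2"] by simp
  show "(\<lambda>z. 1 / z i) \<in> mixed_functions"
    using mixed.scale[OF mixed.diff[OF trace anti], of "1 / 2"] by simp
qed

lemma mixed_vertex_point:
  assumes "1 \<le> i" "i \<le> h"
  shows "(\<lambda>z. vertex_point h z i) \<in> mixed_functions" "(\<lambda>z. 1 / vertex_point h z i) \<in> mixed_functions"
  using mixed_coordinate[of i] assms mixed.const[of 1]
  by (cases "i = h"; simp add: vertex_point_simps)+

text \<open>The difference a - b is not invariant, but (a - b)^2/(ab) is a pure unit, and (1/b -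
  1/a) divided by it is 1/(a - b). For the sum, 1/a + 1/b and (a + b)^2/(ab) play these
  parts.\<close>

lemma mixed_inverse_linear:
  assumes ij: "1 \<le> i" "i < j" "j \<le> h"
  shows "(\<lambda>z. inverse (vertex_point h z i - vertex_point h z j)) \<in> mixed_functions"
    and "(\<lambda>z. inverse (vertex_point h z i + vertex_point h z j)) \<in> mixed_functions"
proof -
  let ?a = "\<lambda>z. vertex_point h z i" and ?b = "\<lambda>z. vertex_point h z j"
  have ne: "?a z \<noteq> 0" "?b z \<noteq> 0" "?a z - ?b z \<noteq> 0" "?a z + ?b z \<noteq> 0" if z: "admissible n z" for z
  proof -
    interpret symmetric_points h "vertex_point h z" by (rule symmetric[OF z])
    show "?a z \<noteq> 0" "?b z \<noteq> 0" "?a z - ?b z \<noteq> 0"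
      using distinct[of i "i + h"] distinct[of j "j + h"] opposite[of i] opposite[of j] distinct[of i j] h1 ij by auto
    show "?a z + ?b z \<noteq> 0"
      using distinct[of i "j + h"] opposite[of j] ij by (auto simp: add_eq_0_iff2)
  qed
  have minus: "(\<lambda>z. (1 / ?b z - 1 / ?a z) * inverse ((?a z - ?b z)\<^sup>2 / (?a z * ?b z))) \<in> mixed_functions"
    and plus: "(\<lambda>z. (1 / ?a z + 1 / ?b z) * inverse ((?a z + ?b z)\<^sup>2 / (?a z * ?b z))) \<in> mixed_functions"
    using pure_unit_square[OF ij] ij
    by (intro mixed.mult mixed.diff mixed.add mixed_vertex_point pure_imp_mixed; simp add: pure_unit_def)+
  have "(1 / b - 1 / a) * inverse ((a - b)\<^sup>2 / (a * b)) = inverse (a - b)"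
    if "a \<noteq> 0" "b \<noteq> 0" "a - b \<noteq> 0" for a b :: complex
  proof -
    have "1 / b - 1 / a = (a - b) / (a * b)" using that by (simp add: divide_simps)
    then show ?thesis using that by (simp add: power2_eq_square inverse_eq_divide)
  qed
  from this[OF ne(1-3)] show "(\<lambda>z. inverse (?a z - ?b z)) \<in> mixed_functions"
    by (intro mixed_functions_cong[OF minus])
  have "(1 / a + 1 / b) * inverse ((a + b)\<^sup>2 / (a * b)) = inverse (a + b)"
    if "a \<noteq> 0" "b \<noteq> 0" "a + b \<noteq> 0" for a b :: complex
  proof -
    have "1 / a + 1 / b = (a + b) / (a * b)" using that by (simp add: divide_simps add.commute)
    then show ?thesis using that by (simp add: power2_eq_square inverse_eq_divide)
  qed
  from this[OF ne(1,2,4)] show "(\<lambda>z. inverse (?a z + ?b z)) \<in> mixed_functions"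
    by (intro mixed_functions_cong[OF plus])
qed

lemma regular_imp_mixed:
  assumes "g \<in> regular_functions"
  shows "g \<in> mixed_functions"
proof -
  obtain p k where p: "vars_in {1..n} p" "\<And>z. admissible n z \<Longrightarrow> g z = poly_eval z p / Z_forms_product n z ^ k"
    using assms unfolding regular_functions_def by blast
  have pair: "(\<lambda>z. inverse (z i - z j)) \<in> mixed_functions" "(\<lambda>z. inverse (z i + z j)) \<in> mixed_functions"
    if "1 \<le> i" "i < j" "j \<le> n" for i j
  proof -
    have "i < h" "1 \<le> j" "j < h" "j \<le> h" using that h by auto
    then show "(\<lambda>z. inverse (z i - z j)) \<in> mixed_functions" "(\<lambda>z. inverse (z i + z j)) \<in> mixed_functions"
      using mixed_inverse_linear[of i j] that by (simp_all add: vertex_point_simps)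
  qed
  have single: "(\<lambda>z. inverse (1 - z i)) \<in> mixed_functions" "(\<lambda>z. inverse (1 + z i)) \<in> mixed_functions"
    "(\<lambda>z. inverse (z i)) \<in> mixed_functions" if "1 \<le> i" "i \<le> n" for i
  proof -
    have "i < h" using that h by simp
    moreover have "inverse (1 - z i) = - 1 * inverse (z i - 1)" for z :: "nat \<Rightarrow> complex"
      using inverse_minus_eq[of "z i - 1"] by simp
    ultimately show "(\<lambda>z. inverse (1 - z i)) \<in> mixed_functions" "(\<lambda>z. inverse (1 + z i)) \<in> mixed_functions"
      "(\<lambda>z. inverse (z i)) \<in> mixed_functions"
      using mixed_inverse_linear[of i h] mixed.scale[of "\<lambda>z. inverse (z i - 1)" "- 1"] that(1)
        mixed_coordinate(2)[of i]
      by (simp_all add: vertex_point_simps inverse_eq_divide add.commute)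
  qed
  have "(\<lambda>z. (\<Prod>j\<in>{1..n}. \<Prod>i\<in>{1..<j}. inverse (z i - z j) * inverse (z i + z j)) *
      (\<Prod>i\<in>{1..n}. inverse (1 - z i) * inverse (1 + z i) * inverse (z i))) \<in> mixed_functions"
    by (intro mixed.mult mixed.prod pair single) auto
  then have "(\<lambda>z. inverse (Z_forms_product n z)) \<in> mixed_functions"
    by (simp add: Z_forms_product_def inverse_mult_distrib flip: prod_inversef)
  moreover have "(\<lambda>z. poly_eval z p) \<in> mixed_functions"
    by (rule mixed.poly_eval_mem[of "{1..n}"]) (use p(1) h mixed_coordinate(1) in \<open>auto simp: vars_in_def\<close>)
  ultimately have "(\<lambda>z. poly_eval z p * inverse (Z_forms_product n z) ^ k) \<in> mixed_functions"
    by (intro mixed.mult mixed.power)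
  then show ?thesis
    by (rule mixed_functions_cong) (simp add: p(2) divide_inverse power_inverse)
qed

lemma invariant_imp_u_value:
  assumes g: "g \<in> regular_functions"
    and inv: "\<And>z. admissible n z \<Longrightarrow> g (\<lambda>i. 1 / z i) = g z"
  shows "\<exists>F\<in>u_laurents. \<forall>z. admissible n z \<longrightarrow> g z = u_value z F"
proof -
  obtain F G where FG: "F \<in> u_laurents" "G \<in> u_laurents"
    and eq: "\<And>z. admissible n z \<Longrightarrow> g z = u_value z F + (z 1 - 1 / z 1) * u_value z G"
    using regular_imp_mixed[OF g] unfolding mixed_functions_def pure_functions_def by auto
  have "g z = u_value z F" if z: "admissible n z" for z
  proof -
    \<comment> \<open>Under inversion the values of \<open>F\<close> and \<open>G\<close> stay while
      y changes sign, so the invariance of \<open>g\<close> forces the term with y to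
      vanish.\<close>
    have "u_value z F + (1 / z 1 - 1 / (1 / z 1)) * u_value z G = u_value z F + (z 1 - 1 / z 1) * u_value z G"
      using inv[OF z] eq[OF z] eq[OF admissible_inversion[OF z]] by (simp only: u_value_inversion[OF z])
    then have "2 * ((z 1 - 1 / z 1) * u_value z G) = 0" by (simp add: algebra_simps)
    then show ?thesis using eq[OF z] by simp
  qed
  then show ?thesis using FG by blast
qed

end

section \<open>The quotient by inversion\<close>

lemma quotient_algebra_simps:
  "carrier (quotient_algebra A I) = carrier (A Quot I)"
  "x \<otimes>\<^bsub>quotient_algebra A I\<^esub> y = x \<otimes>\<^bsub>A Quot I\<^esub> y" "x \<oplus>\<^bsub>quotient_algebra A I\<^esub> y = x \<oplus>\<^bsub>A Quot I\<^esub> y"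
  "\<one>\<^bsub>quotient_algebra A I\<^esub> = \<one>\<^bsub>A Quot I\<^esub>" "\<zero>\<^bsub>quotient_algebra A I\<^esub> = \<zero>\<^bsub>A Quot I\<^esub>"
  "const (quotient_algebra A I) c = I +>\<^bsub>A\<^esub> const A c"
  by (simp_all add: quotient_algebra_def ring.defs complex_algebra.defs)

context type_C
begin

lemma Z_space_eq: "Z_space n = Z_matrix n ` {z. admissible n z}"
  unfolding Z_space_def admissible_def by blast

lemma z_coord_Z_matrix: "1 \<le> i \<Longrightarrow> i \<le> n \<Longrightarrow> z_coord (Z_matrix n z) i = z i"
  by (auto simp: z_coord_def Z_matrix_def)

lemma Z_matrix_cong: "(\<And>i. 1 \<le> i \<Longrightarrow> i \<le> n \<Longrightarrow> z i = z' i) \<Longrightarrow> Z_matrix n z = Z_matrix n z'"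
  by (auto simp: Z_matrix_def intro!: eq_matI)

lemma admissible_cong: "(\<And>i. 1 \<le> i \<Longrightarrow> i \<le> n \<Longrightarrow> z i = z' i) \<Longrightarrow> admissible n z = admissible n z'"
  unfolding admissible_def by auto

text \<open>The coordinates read off from a matrix are tied to the original tuple at the indices 1
  to \<open>n\<close>. Passing between tuples and matrices requires that the remaining values have
  no influence.\<close>

lemma u_value_cong:
  assumes "\<And>i. 1 \<le> i \<Longrightarrow> i \<le> n \<Longrightarrow> z i = z' i"
  shows "u_value z F = u_value z' F"
proof -
  have "signed_point h z k = signed_point h z' k" if "1 \<le> k" for k
    using assms that h by (auto simp: signed_point_def)
  then have "vertex_point h z = vertex_point h z'"
    using vertex_range[OF h1] by (auto simp: vertex_point_def fun_eq_iff)
  then show ?thesis by simp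
qed

lemma regular_functions_local:
  assumes g: "g \<in> regular_functions" and z: "admissible n z"
    and eq: "\<And>i. 1 \<le> i \<Longrightarrow> i \<le> n \<Longrightarrow> z i = z' i"
  shows "g z = g z'"
proof -
  obtain p k where p: "vars_in {1..n} p" "\<And>z. admissible n z \<Longrightarrow> g z = poly_eval z p / Z_forms_product n z ^ k"
    using g unfolding regular_functions_def by blast
  have "z i = z' i" if "m \<in> Poly_Mapping.keys p" "i \<in> Poly_Mapping.keys m" for m i
  proof -
    have "i \<in> {1..n}" using p(1) that unfolding vars_in_def by blast
    then show ?thesis using eq by simp
  qed
  then have "poly_eval z p = poly_eval z' p"
    unfolding poly_eval_def by simp
  moreover have "Z_forms_product n z = Z_forms_product n z'"
    unfolding Z_forms_product_def
    by (intro arg_cong2[of _ _ _ _ "(*)"] prod.cong refl) (use eq in auto)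
  moreover have "admissible n z'" using z admissible_cong[of z z'] eq by simp
  ultimately show ?thesis using p(2)[OF z] p(2)[of z'] by simp
qed

lemma Z_space_coord:
  assumes "A \<in> Z_space n"
  shows "admissible n (z_coord A)" "Z_matrix n (z_coord A) = A"
proof -
  obtain z where z: "admissible n z" "A = Z_matrix n z" using assms Z_space_eq by auto
  show "Z_matrix n (z_coord A) = A"
    unfolding z(2) by (rule Z_matrix_cong) (simp add: z_coord_Z_matrix)
  show "admissible n (z_coord A)"
    using z admissible_cong[of "z_coord A" z] by (simp add: z_coord_Z_matrix)
qed

section \<open>The action of the group of order two and its invariants\<close>

definition inversion :: "complex mat \<Rightarrow> complex mat" where
  "inversion A = Z_matrix n (\<lambda>i. 1 / z_coord A i)"

lemma inversion_closed: "A \<in> Z_space n \<Longrightarrow> inversion A \<in> Z_space n"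
  unfolding inversion_def Z_space_eq
  by (intro imageI CollectI admissible_inversion Z_space_coord(1)) (simp add: Z_space_eq)

lemma z_coord_inversion: "1 \<le> i \<Longrightarrow> i \<le> n \<Longrightarrow> z_coord (inversion A) i = 1 / z_coord A i"
  by (simp add: inversion_def z_coord_Z_matrix)

lemma inversion_inversion:
  assumes "A \<in> Z_space n"
  shows "inversion (inversion A) = A"
proof -
  have "inversion (inversion A) = Z_matrix n (z_coord A)"
    unfolding inversion_def[of "inversion A"] by (rule Z_matrix_cong) (simp add: z_coord_inversion)
  then show ?thesis using Z_space_coord(2)[OF assms] by simp
qed

text \<open>A fixed matrix would have z_1^2 = 1, against 1 - z_1 and 1 + z_1 being nonzero.\<close>

lemma inversion_free:
  assumes "A \<in> Z_space n"
  shows "inversion A \<noteq> A"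
proof
  assume "inversion A = A"
  then have eq: "z_coord A 1 = 1 / z_coord A 1" using z_coord_inversion[of 1 A] n by simp
  have z: "z_coord A 1 \<noteq> 0" "1 - z_coord A 1 \<noteq> 0" "1 + z_coord A 1 \<noteq> 0"
    using Z_space_coord(1)[OF assms] n unfolding admissible_def by auto
  have "z_coord A 1 * z_coord A 1 = 1" using eq z(1) by (metis nonzero_eq_divide_eq)
  then have "(1 - z_coord A 1) * (1 + z_coord A 1) = 0" by (simp add: algebra_simps)
  then show False using z by simp
qed

lemma Z_action_eq: "Z_action n g = (\<lambda>A\<in>Z_space n. if g = 0 then A else inversion A)"
  unfolding Z_action_def inversion_def ..

lemma carrier_Z2: "g \<in> carrier (integer_mod_group 2) \<longleftrightarrow> g = 0 \<or> g = 1"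
  by (auto simp: carrier_integer_mod_group)

lemma group_action_Z: "group_action (integer_mod_group 2) (Z_space n) (Z_action n)"
  unfolding group_action_def
proof (intro group_hom.intro group_hom_axioms.intro homI)
  have closed: "Z_action n g A \<in> Z_space n" if "A \<in> Z_space n" for g A
    using that by (simp add: Z_action_eq inversion_closed)
  have invol: "Z_action n g (Z_action n g A) = A" if "A \<in> Z_space n" for g A
    using that by (simp add: Z_action_eq inversion_closed inversion_inversion)
  have bij: "Z_action n g \<in> Bij (Z_space n)" for g
  proof -
    have "bij_betw (Z_action n g) (Z_space n) (Z_space n)"
      by (rule bij_betw_byWitness[where f' = "Z_action n g"]) (use closed invol in auto)
    moreover have "Z_action n g \<in> extensional (Z_space n)" by (simp add: Z_action_eq)
    ultimately show ?thesis by (simp add: Bij_def)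
  qed
  then show "Z_action n g \<in> carrier (BijGroup (Z_space n))" for g by (simp add: BijGroup_def)
  fix x y assume xy: "x \<in> carrier (integer_mod_group 2)" "y \<in> carrier (integer_mod_group 2)"
  have "Z_action n (x \<otimes>\<^bsub>integer_mod_group 2\<^esub> y) = compose (Z_space n) (Z_action n x) (Z_action n y)"
  proof (rule extensionalityI[of _ "Z_space n"])
    fix A assume A: "A \<in> Z_space n"
    then show "Z_action n (x \<otimes>\<^bsub>integer_mod_group 2\<^esub> y) A = compose (Z_space n) (Z_action n x) (Z_action n y) A"
      using xy unfolding carrier_Z2
      by (auto simp: compose_eq Z_action_eq inversion_closed inversion_inversion)
  qed (simp_all add: Z_action_eq compose_extensional)
  then show "Z_action n (x \<otimes>\<^bsub>integer_mod_group 2\<^esub> y) = Z_action n x \<otimes>\<^bsub>BijGroup (Z_space n)\<^esub> Z_action n y"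
    using bij by (simp add: BijGroup_def)
qed (simp_all add: group_BijGroup)

abbreviation invariants :: "(complex mat \<Rightarrow> complex) complex_algebra" where
  "invariants \<equiv> invariant_algebra (integer_mod_group 2) (Z_space n) (Z_action n) (Z_regular n)"

lemma carrier_Z_regular:
  "f \<in> carrier (Z_regular n) \<longleftrightarrow>
    f \<in> extensional (Z_space n) \<and> (\<exists>g\<in>regular_functions. \<forall>A\<in>Z_space n. f A = g (z_coord A))"
proof
  assume "f \<in> carrier (Z_regular n)"
  then obtain p k where f: "f \<in> extensional (Z_space n)" "vars_in {1..n} p"
    "\<forall>A\<in>Z_space n. f A = poly_eval (z_coord A) p / Z_forms_product n (z_coord A) ^ k"
    by (auto simp: Z_regular_def vars_in_def)
  have "(\<lambda>z. poly_eval z p / Z_forms_product n z ^ k) \<in> regular_functions"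
    unfolding regular_functions_def using f(2) by blast
  then show "f \<in> extensional (Z_space n) \<and> (\<exists>g\<in>regular_functions. \<forall>A\<in>Z_space n. f A = g (z_coord A))"
    using f by auto
next
  assume "f \<in> extensional (Z_space n) \<and> (\<exists>g\<in>regular_functions. \<forall>A\<in>Z_space n. f A = g (z_coord A))"
  then obtain g where f: "f \<in> extensional (Z_space n)" "g \<in> regular_functions" "\<forall>A\<in>Z_space n. f A = g (z_coord A)"
    by auto
  then obtain p k where p: "vars_in {1..n} p" "\<And>z. admissible n z \<Longrightarrow> g z = poly_eval z p / Z_forms_product n z ^ k"
    unfolding regular_functions_def by blast
  then have "\<forall>A\<in>Z_space n. f A = poly_eval (z_coord A) p / Z_forms_product n (z_coord A) ^ k"
    using f(3) Z_space_coord(1) by simp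
  then show "f \<in> carrier (Z_regular n)"
    using f(1) p(1) unfolding Z_regular_def vars_in_def by auto
qed

lemma carrier_invariants:
  "f \<in> carrier invariants \<longleftrightarrow>
    f \<in> extensional (Z_space n) \<and> (\<exists>g\<in>regular_functions. \<forall>A\<in>Z_space n. f A = g (z_coord A)) \<and>
    (\<forall>A\<in>Z_space n. f (inversion A) = f A)"
proof -
  have "(\<forall>g\<in>carrier (integer_mod_group 2). \<forall>A\<in>Z_space n. f (Z_action n g A) = f A)
      \<longleftrightarrow> (\<forall>A\<in>Z_space n. f (inversion A) = f A)"
    unfolding Ball_def carrier_Z2 by (auto simp: Z_action_eq)
  then show ?thesis
    by (simp add: invariant_algebra_def carrier_Z_regular)
qed

lemma invariants_simps:
  "f \<otimes>\<^bsub>invariants\<^esub> g = (\<lambda>A\<in>Z_space n. f A * g A)" "f \<oplus>\<^bsub>invariants\<^esub> g = (\<lambda>A\<in>Z_space n. f A + g A)"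
  "\<one>\<^bsub>invariants\<^esub> = (\<lambda>A\<in>Z_space n. 1)" "\<zero>\<^bsub>invariants\<^esub> = (\<lambda>A\<in>Z_space n. 0)"
  "const invariants = (\<lambda>c. \<lambda>A\<in>Z_space n. c)"
  by (simp_all add: invariant_algebra_def Z_regular_def)

lemma invariants_memI:
  assumes "f \<in> regular_functions" "\<And>A. A \<in> Z_space n \<Longrightarrow> g A = f (z_coord A)"
    "\<And>A. A \<in> Z_space n \<Longrightarrow> g (inversion A) = g A"
  shows "restrict g (Z_space n) \<in> carrier invariants"
  unfolding carrier_invariants using assms inversion_closed by (auto intro!: bexI[of _ f])

lemma invariants_memE:
  assumes "f \<in> carrier invariants"
  obtains g where "g \<in> regular_functions" "\<And>A. A \<in> Z_space n \<Longrightarrow> f A = g (z_coord A)"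
    "\<And>A. A \<in> Z_space n \<Longrightarrow> f (inversion A) = f A" "f \<in> extensional (Z_space n)"
  using assms unfolding carrier_invariants by blast

lemma invariants_closed:
  "(\<lambda>A\<in>Z_space n. c) \<in> carrier invariants"
  "f \<in> carrier invariants \<Longrightarrow> f' \<in> carrier invariants \<Longrightarrow> (\<lambda>A\<in>Z_space n. f A + f' A) \<in> carrier invariants"
  "f \<in> carrier invariants \<Longrightarrow> f' \<in> carrier invariants \<Longrightarrow> (\<lambda>A\<in>Z_space n. f A * f' A) \<in> carrier invariants"
proof -
  show "(\<lambda>A\<in>Z_space n. c) \<in> carrier invariants"
    by (rule invariants_memI[OF regular.const[of c]]) simp_all
  assume "f \<in> carrier invariants" "f' \<in> carrier invariants"
  then obtain g g' where g: "g \<in> regular_functions" "\<And>A. A \<in> Z_space n \<Longrightarrow> f A = g (z_coord A)"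
      "\<And>A. A \<in> Z_space n \<Longrightarrow> f (inversion A) = f A"
    and g': "g' \<in> regular_functions" "\<And>A. A \<in> Z_space n \<Longrightarrow> f' A = g' (z_coord A)"
      "\<And>A. A \<in> Z_space n \<Longrightarrow> f' (inversion A) = f' A"
    by (metis invariants_memE)
  show "(\<lambda>A\<in>Z_space n. f A + f' A) \<in> carrier invariants"
    by (rule invariants_memI[OF regular.add[OF g(1) g'(1)]]) (use g(2,3) g'(2,3) in auto)
  show "(\<lambda>A\<in>Z_space n. f A * f' A) \<in> carrier invariants"
    by (rule invariants_memI[OF regular.mult[OF g(1) g'(1)]]) (use g(2,3) g'(2,3) in auto)
qed

lemma invariants_cring: "cring invariants"
proof -
  have ext: "f \<in> extensional (Z_space n)" if "f \<in> carrier invariants" for f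
    using that by (simp add: carrier_invariants)
  show ?thesis
  proof (rule cringI)
    show "abelian_group invariants"
    proof (rule abelian_groupI)
      fix f assume f: "f \<in> carrier invariants"
      show "\<zero>\<^bsub>invariants\<^esub> \<oplus>\<^bsub>invariants\<^esub> f = f"
        unfolding invariants_simps by (rule extensionalityI[OF _ ext[OF f]]) simp_all
      have "(\<lambda>A\<in>Z_space n. (\<lambda>A\<in>Z_space n. -1) A * f A) \<in> carrier invariants"
        by (intro invariants_closed f)
      moreover have "(\<lambda>A\<in>Z_space n. (\<lambda>A\<in>Z_space n. -1) A * f A) \<oplus>\<^bsub>invariants\<^esub> f = \<zero>\<^bsub>invariants\<^esub>"
        unfolding invariants_simps by (rule extensionalityI[of _ "Z_space n"]) simp_all
      ultimately show "\<exists>g\<in>carrier invariants. g \<oplus>\<^bsub>invariants\<^esub> f = \<zero>\<^bsub>invariants\<^esub>" by blast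
    qed (auto simp: invariants_simps invariants_closed add_ac intro!: restrict_ext)
    show "comm_monoid invariants"
    proof (rule comm_monoidI)
      fix f assume f: "f \<in> carrier invariants"
      show "\<one>\<^bsub>invariants\<^esub> \<otimes>\<^bsub>invariants\<^esub> f = f"
        unfolding invariants_simps by (rule extensionalityI[OF _ ext[OF f]]) simp_all
    qed (auto simp: invariants_simps invariants_closed mult_ac intro!: restrict_ext)
  qed (auto simp: invariants_simps distrib_right intro!: restrict_ext)
qed

section \<open>Substitution of cross ratios as an isomorphism of algebras\<close>

definition comorphism :: "nat set set laurent \<Rightarrow> complex mat \<Rightarrow> complex" where
  "comorphism F = (\<lambda>A\<in>Z_space n. u_value (z_coord A) F)"

lemma comorphism_closed:
  assumes "F \<in> u_laurents"
  shows "comorphism F \<in> carrier invariants"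
  unfolding comorphism_def
proof (rule invariants_memI[OF regular_u_value[OF assms]])
  fix A assume A: "A \<in> Z_space n"
  have "u_value (z_coord (inversion A)) F = u_value (\<lambda>i. 1 / z_coord A i) F"
    by (rule u_value_cong) (rule z_coord_inversion)
  then show "u_value (z_coord (inversion A)) F = u_value (z_coord A) F"
    using u_value_inversion[OF Z_space_coord(1)[OF A]] by simp
qed simp

lemma comorphism_ring_hom: "ring_hom_ring (laurent_algebra (Pi_C n)) invariants comorphism"
proof (intro ring_hom_ringI2 ring_hom_memI)
  show "ring (laurent_algebra (Pi_C n))" by (rule cring.axioms(1)[OF laurent_algebra_cring])
  show "ring invariants" by (rule cring.axioms(1)[OF invariants_cring])
  show "comorphism F \<in> carrier invariants" if "F \<in> u_laurents" for F
    using that by (rule comorphism_closed)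
qed (auto simp: laurent_algebra_simps invariants_simps comorphism_def u_value_hom
    Z_space_coord intro!: restrict_ext)

lemma comorphism_surj: "comorphism ` u_laurents = carrier invariants"
proof (intro equalityI subsetI)
  fix f assume "f \<in> carrier invariants"
  then obtain g where g: "g \<in> regular_functions" "\<And>A. A \<in> Z_space n \<Longrightarrow> f A = g (z_coord A)"
    "\<And>A. A \<in> Z_space n \<Longrightarrow> f (inversion A) = f A" "f \<in> extensional (Z_space n)"
    by (rule invariants_memE) blast
  \<comment> \<open>Invariance is given on matrices but is wanted on tuples; \<open>loc\<close>
    compares a tuple with the coordinates of its matrix.\<close>
  have loc: "g (z_coord (Z_matrix n z)) = g z" if "admissible n z" for z
    using regular_functions_local[OF g(1) that, of "z_coord (Z_matrix n z)"] by (simp add: z_coord_Z_matrix)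
  have "g (\<lambda>i. 1 / z i) = g z" if z: "admissible n z" for z
  proof -
    have A: "Z_matrix n z \<in> Z_space n" unfolding Z_space_eq using z by blast
    have "inversion (Z_matrix n z) = Z_matrix n (\<lambda>i. 1 / z i)"
      unfolding inversion_def by (rule Z_matrix_cong) (simp add: z_coord_Z_matrix)
    then show ?thesis
      using g(3)[OF A] g(2)[OF A] g(2)[OF inversion_closed[OF A]] loc[OF z] loc[OF admissible_inversion[OF z]]
      by simp
  qed
  from invariant_imp_u_value[OF g(1) this]
  obtain F where F: "F \<in> u_laurents" "\<forall>z. admissible n z \<longrightarrow> g z = u_value z F"
    by blast
  have "f = comorphism F"
    by (rule extensionalityI[OF g(4)]) (use F(2) g(2) Z_space_coord(1) in \<open>auto simp: comorphism_def\<close>)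
  then show "f \<in> comorphism ` u_laurents" using F(1) by blast
qed (auto simp: comorphism_closed)

lemma comorphism_kernel: "a_kernel (laurent_algebra (Pi_C n)) invariants comorphism = relation_ideal"
proof (intro equalityI)
  interpret hom: ring_hom_ring "laurent_algebra (Pi_C n)" invariants comorphism
    by (rule comorphism_ring_hom)
  show "relation_ideal \<subseteq> a_kernel (laurent_algebra (Pi_C n)) invariants comorphism"
    unfolding relation_ideal_def
  proof (rule hom.R.genideal_minimal[OF hom.kernel_is_ideal], rule subsetI)
    fix r assume "r \<in> u_relation n ` Pi_C n"
    then obtain \<gamma> where \<gamma>: "\<gamma> \<in> Pi_C n" "r = u_relation n \<gamma>" by blast
    have "u_value z r = 0" if "admissible n z" for z
      unfolding \<gamma>(2) by (rule symmetric_points.u_relation_vanishes[OF symmetric[OF that] n h \<gamma>(1)])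
    then have "comorphism r = \<zero>\<^bsub>invariants\<^esub>"
      by (auto simp: comorphism_def invariants_simps Z_space_coord intro!: restrict_ext)
    moreover have "r \<in> u_laurents"
      unfolding \<gamma>(2) by (rule u_relation_closed[OF \<gamma>(1)])
    ultimately show "r \<in> a_kernel (laurent_algebra (Pi_C n)) invariants comorphism"
      unfolding a_kernel_def' by blast
  qed
  show "a_kernel (laurent_algebra (Pi_C n)) invariants comorphism \<subseteq> relation_ideal"
  proof
    fix F assume "F \<in> a_kernel (laurent_algebra (Pi_C n)) invariants comorphism"
    then have F: "F \<in> u_laurents" "comorphism F = (\<lambda>A\<in>Z_space n. 0)"
      unfolding a_kernel_def' invariants_simps by blast+
    have "u_value z F = 0" if z: "admissible n z" for z
    proof -
      have A: "Z_matrix n z \<in> Z_space n" unfolding Z_space_eq using z by blast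
      have "u_value (z_coord (Z_matrix n z)) F = 0"
        using fun_cong[OF F(2), of "Z_matrix n z"] A by (simp add: comorphism_def)
      moreover have "u_value (z_coord (Z_matrix n z)) F = u_value z F"
        by (rule u_value_cong) (rule z_coord_Z_matrix)
      ultimately show ?thesis by simp
    qed
    then show "F \<in> relation_ideal" using kernel_in_relation_ideal F(1) by blast
  qed
qed

text \<open>\<open>u_algebra n\<close> is the quotient ring with the scalar map added as a record
  field; the identity is a ring isomorphism between the two and carries the structure over.\<close>

lemma u_algebra_cring: "cring (u_algebra n)"
proof -
  interpret ideal relation_ideal "laurent_algebra (Pi_C n)" by (rule ideal_relation_ideal)
  interpret Q: cring "laurent_algebra (Pi_C n) Quot relation_ideal"
    by (rule quotient_is_cring[OF laurent_algebra_cring])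
  have "id \<in> ring_iso (laurent_algebra (Pi_C n) Quot relation_ideal) (u_algebra n)"
    unfolding u_algebra_def relation_ideal_def[symmetric]
    by (rule ring_iso_memI) (simp_all add: quotient_algebra_simps)
  from Q.ring_iso_imp_img_cring[OF this] show ?thesis
    by (simp add: u_algebra_def quotient_algebra_def ring.defs flip: relation_ideal_def)
qed

text \<open>By the first isomorphism theorem: \<open>comorphism\<close> is constant on the cosets of
  its kernel, and \<open>the_elem\<close> extracts the common value.\<close>

lemma u_algebra_iso: "(\<lambda>X. the_elem (comorphism ` X)) \<in> complex_algebra_iso (u_algebra n) invariants"
proof -
  interpret hom: ring_hom_ring "laurent_algebra (Pi_C n)" invariants comorphism
    by (rule comorphism_ring_hom)
  have iso: "(\<lambda>X. the_elem (comorphism ` X)) \<in> ring_iso (laurent_algebra (Pi_C n) Quot relation_ideal) invariants"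
    using hom.FactRing_iso_set[OF comorphism_surj] by (simp add: comorphism_kernel)
  have "(\<lambda>X. the_elem (comorphism ` X)) \<in> ring_iso (u_algebra n) invariants"
    using ring_iso_memE[OF iso]
    unfolding u_algebra_def relation_ideal_def[symmetric]
    by (intro ring_iso_memI) (simp_all add: quotient_algebra_simps)
  moreover have "the_elem (comorphism ` const (u_algebra n) c) = const invariants c" for c
  proof -
    have "const (u_algebra n) c = relation_ideal +>\<^bsub>laurent_algebra (Pi_C n)\<^esub> Poly_Mapping.single 0 c"
      by (simp add: u_algebra_def quotient_algebra_simps laurent_algebra_simps flip: relation_ideal_def)
    then have "the_elem (comorphism ` const (u_algebra n) c) = comorphism (Poly_Mapping.single 0 c)"
      using hom.the_elem_simp[of "Poly_Mapping.single 0 c"] by (simp add: comorphism_kernel laurent_algebra_closed)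
    also have "\<dots> = const invariants c"
      by (auto simp: comorphism_def invariants_simps u_value_hom Z_space_coord intro!: restrict_ext)
    finally show ?thesis .
  qed
  ultimately show ?thesis by (simp add: complex_algebra_iso_def)
qed

lemma const_u_algebra_closed: "const (u_algebra n) c \<in> carrier (u_algebra n)"
proof -
  interpret ideal relation_ideal "laurent_algebra (Pi_C n)" by (rule ideal_relation_ideal)
  have "relation_ideal +>\<^bsub>laurent_algebra (Pi_C n)\<^esub> Poly_Mapping.single 0 c
      \<in> a_rcosets\<^bsub>laurent_algebra (Pi_C n)\<^esub> relation_ideal"
    by (intro a_rcosetsI a_subset laurent_algebra_closed)
  then show ?thesis
    by (simp add: u_algebra_def quotient_algebra_simps laurent_algebra_simps FactRing_def
        flip: relation_ideal_def)
qed

theorem M_C_isomorphic: "ringed_space_isomorphic (M_C n) (Z_quotient n)"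
  unfolding M_C_def Z_quotient_def
  by (rule Spec_isomorphic[OF u_algebra_cring invariants_cring const_u_algebra_closed u_algebra_iso])

end

theorem proposition7p5:
  fixes n :: nat
  assumes "n \<ge> 1"
  shows "group_action (integer_mod_group 2) (Z_space n) (Z_action n) \<and>
    (\<forall>g \<in> carrier (integer_mod_group 2). g \<noteq> \<one>\<^bsub>integer_mod_group 2\<^esub> \<longrightarrow>
       (\<forall>A \<in> Z_space n. Z_action n g A \<noteq> A)) \<and>
    ringed_space_isomorphic (M_C n) (Z_quotient n)"
proof -
  interpret type_C n "n + 1" using assms by unfold_locales simp_all
  show ?thesis
    using group_action_Z inversion_free M_C_isomorphic by (auto simp: Z_action_eq)
qed

end
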